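(* Let $N\in\mathbb{N}$, $T>0$, and let $V\in C^1(\mathbb{R}\times\mathbb{R}^N,\mathbb{R})$ be $T$-periodic in $t$ and of the form $$V(t,u)=\tfrac12\langle U(t)u,u\rangle+W(t,u),$$ where $U(\cdot)$ is a continuous $T$-periodic function with values in the symmetric real $N\times N$ matrices. Assume: (AQ$_1$) $W(t,u)\ge 0$ for all $(t,u)\in[0,T]\times\mathbb{R}^N$, and there exist constants $\mu\in(0,2)$ and $R_1>0$ such that $\langle\nabla_uW(t,u),u\rangle\le\mu W(t,u)$ for all $t\in[0,T]$ and $|u|\ge R_1$; (AQ$_2$) $\lim_{|u|\to0}\frac{W(t,u)}{|u|^2}=\infty$ uniformly for $t\in[0,T]$, and there exist constants $c_2,R_2>0$ such that $W(t,u)\le c_2|u|$ for all $t\in[0,T]$ and $|u|\le R_2$; (AQ$_3$) there is a constant $d>0$ such that $\liminf_{|u|\to\infty}\frac{W(t,u)}{|u|}\ge d$ uniformly for $t\in[0,T]$. Assume also that $W(t,u)$ is even in $u$, i.e. $W(t,-u)=W(t,u)$ for all $(t,u)\in[0,T]\times\mathbb{R}^N$. Then the problem $$\ddot u+\nabla_uV(t,u)=0\quad(t\in\mathbb{R}),\qquad u(0)=u(T),\quad \dot u(0)=\dot u(T)$$ possesses infinitely many nontrivial solutions.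
   Context: $\langle\cdot,\cdot\rangle$ and $|\cdot|$ denote the standard inner product and norm on $\mathbb{R}^N$; $\nabla_u$ denotes the gradient with respect to $u$. Solutions are ($T$-periodic) functions $u$ with values in $\mathbb{R}^N$; nontrivial means not identically zero. *)

theory Defs
  imports "HOL-Analysis.Analysis"
begin

definition C1_function :: "('a::real_normed_vector \<Rightarrow> 'b::real_normed_vector) \<Rightarrow> bool" where
  "C1_function f \<longleftrightarrow>
     (\<exists>f' :: 'a \<Rightarrow> 'a \<Rightarrow>\<^sub>L 'b.
        (\<forall>x. (f has_derivative blinfun_apply (f' x)) (at x)) \<and> continuous_on UNIV f')"

text \<open>Only meaningful at points where \<open>f\<close> is differentiable, see \<open>gradient_eqI\<close>.\<close>

definition gradient :: "('a::real_inner \<Rightarrow> real) \<Rightarrow> 'a \<Rightarrow> 'a" where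
  "gradient f x = (THE D. GDERIV f x :> D)"

lemma gradient_eqI:
  assumes "GDERIV f x :> D"
  shows "gradient f x = D"
  unfolding gradient_def
proof (rule the_equality)
  show "GDERIV f x :> D" by (fact assms)
next
  fix E assume "GDERIV f x :> E"
  then have "(\<lambda>h. inner h E) = (\<lambda>h. inner h D)"
    using assms has_derivative_unique unfolding gderiv_def by blast
  then show "E = D"
    by (metis vector_eq_ldot)
qed

text \<open>
  Classical \<open>T\<close>-periodic solutions of \<open>u'' + \<nabla>\<^sub>u V(t, u) = 0\<close>, \<open>u(0) = u(T)\<close>, \<open>u'(0) = u'(T)\<close>;
  the function \<open>v\<close> is the derivative of \<open>u\<close>. Periodicity is required separately because for
  \<open>V\<close> of class \<open>C\<^sup>1\<close> initial value problems need not be uniquely solvable, so the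
  boundary conditions alone do not make a solution on the whole line periodic.
\<close>

definition periodic_solution ::
    "real \<Rightarrow> (real \<Rightarrow> 'a::real_inner \<Rightarrow> real) \<Rightarrow> (real \<Rightarrow> 'a) \<Rightarrow> bool" where
  "periodic_solution T V u \<longleftrightarrow>
     (\<forall>t. u (t + T) = u t) \<and>
     (\<exists>v u''. (\<forall>t. (u has_vector_derivative v t) (at t)) \<and>
              (\<forall>t. (v has_vector_derivative u'' t) (at t)) \<and>
              (\<forall>t. u'' t + gradient (V t) (u t) = 0) \<and>
              u 0 = u T \<and> v 0 = v T)"

end

theory Submission
  imports Defs "HOL-Complex_Analysis.Great_Picard"
begin

text \<open>Only the behaviour of \<open>V\<close> near \<open>u = 0\<close> matters. Multiplying \<open>V + |u|\<^sup>2 / 2\<close> by a cutoff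
  gives a potential \<open>Q\<close> with bounded gradient \<open>p\<close> that agrees with it on the unit ball, and the
  \<open>T\<close>-periodic solutions of \<open>u'' = u - p(t, u)\<close> are the fixed points of the compact odd
  map \<open>u \<mapsto> G(p(\<cdot>, u))\<close>, with \<open>G = (1 - d\<^sup>2/dt\<^sup>2)\<^sup>-\<^sup>1\<close>, and the critical points of the functional
  \<open>\<Phi>(u) = \<integral> |u'|\<^sup>2 / 2 + |u|\<^sup>2 / 2 - Q(t, u)\<close>, which is bounded below. Since \<open>Q\<close> is superquadratic
  at \<open>0\<close>, \<open>\<Phi>\<close> is negative on small spheres of every finite dimension.

  Suppose that there is no small nonzero solution. Then the nonzero fixed points form a compact
  symmetric set away from \<open>0\<close>, covered by finitely many small balls. Follow the damped iteration
  \<open>u \<mapsto> (1 - \<tau>) u + \<tau> G(p(\<cdot>, u))\<close>, along which \<open>\<Phi>\<close> decreases up to an arbitrarily small error,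
  from a point with \<open>\<Phi> < 0\<close> through a fixed number of long time windows. Leaving the
  neighbourhood of the fixed points costs a fixed amount of \<open>\<Phi>\<close>, and so does a whole window spent
  outside it; as \<open>\<Phi>\<close> is bounded below, some window ends near a fixed point. The pairs (window, ball)
  label the points of the sphere so that no label is taken at nearly antipodal points, and their number
  does not depend on the dimension of the sphere. This contradicts the Lyusternik-Shnirel'man covering
  theorem, which follows from a parity count of alternating simplices in the manner of Ky Fan.\<close>

section \<open>Ky Fan's lemma on a glued cube\<close>

text \<open>As \<open>V\<close> is only of class C^1, \<open>p\<close> need not be Lipschitz and a
  gradient flow of \<Phi> need not exist; Euler steps replace it, at the price of an error in the
  descent. The obstacle is the order of the choices. The speed of descent degenerates near 0, and
  how near to 0 an orbit may come depends on the level of the sphere, hence on its dimension.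
  Therefore the number of windows is computed from the speed in an annulus around the nonzero fixed
  points only, which does not see the sphere; the length of a window, the admissible error and the
  step size are chosen after the sphere. A ball around a nonzero fixed point is small compared with
  the distance of its centre from 0, so it is far from its mirror image; this separates the labels
  of nearly antipodal points. The smallness of the solution sought is arbitrary, and nonzero
  solutions of arbitrarily small size cannot be finite in number. All orbits live in the sup norm,
  with compactness from Arzela-Ascoli; the \<open>H\<^sup>1\<close> norm enters only through \<Phi>
  and the inequality by which it dominates the sup norm.\<close>

text \<open>A lattice point stands for a face of the subdivision of a cube into cubes of side \<open>2\<close>: an even
  coordinate is a vertex coordinate, an odd one the midpoint of an edge. The simplices of the
  barycentric subdivision are then the chains of \<open>face_le\<close>, and the dimension of the
  face \<open>z\<close> is \<open>card (odds z)\<close>.\<close>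

definition face_le :: "(nat \<Rightarrow> nat) \<Rightarrow> (nat \<Rightarrow> nat) \<Rightarrow> bool" where
  "face_le z w \<longleftrightarrow>
     (\<forall>i. z i = w i \<or> (even (z i) \<and> odd (w i) \<and> (z i = w i + 1 \<or> w i = z i + 1)))"

definition odds :: "(nat \<Rightarrow> nat) \<Rightarrow> nat set" where
  "odds z = {i. odd (z i)}"

text \<open>Coordinates from \<open>k\<close> on are 0, so that \<open>grid M k\<close> is, as a
  set, the face \<open>z k = 0\<close> of \<open>grid M (Suc k)\<close>; an induction on the
  dimension can then keep one and the same labelling.\<close>

definition grid :: "nat \<Rightarrow> nat \<Rightarrow> (nat \<Rightarrow> nat) set" where
  "grid M k = {z. (\<forall>i<k. z i \<le> 2 * M) \<and> (\<forall>i\<ge>k. z i = 0)}"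

definition face_chain :: "nat \<Rightarrow> nat \<Rightarrow> (nat \<Rightarrow> nat) set \<Rightarrow> bool" where
  "face_chain M k C \<longleftrightarrow> C \<subseteq> grid M k \<and> (\<forall>z\<in>C. \<forall>w\<in>C. face_le z w \<or> face_le w z)"

definition completions :: "nat \<Rightarrow> nat \<Rightarrow> (nat \<Rightarrow> nat) set \<Rightarrow> (nat \<Rightarrow> nat) set" where
  "completions M k f = {z. z \<notin> f \<and> face_chain M k (insert z f)}"

definition boundary_chain :: "nat \<Rightarrow> nat \<Rightarrow> (nat \<Rightarrow> nat) set \<Rightarrow> bool" where
  "boundary_chain M k f \<longleftrightarrow> (\<exists>j<k. \<exists>v\<in>{0, 2 * M}. \<forall>z\<in>f. z j = v)"

lemma face_le_refl [simp]: "face_le z z"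
  by (simp add: face_le_def)

lemma face_le_trans: "face_le z w \<Longrightarrow> face_le w x \<Longrightarrow> face_le z x"
  unfolding face_le_def by metis

lemma face_le_odds: "face_le z w \<Longrightarrow> odds z \<subseteq> odds w"
  unfolding face_le_def odds_def subset_iff mem_Collect_eq by metis

lemma face_le_eq: "face_le z w \<Longrightarrow> odds z = odds w \<Longrightarrow> z = w"
  unfolding face_le_def odds_def by (intro ext) blast

lemma face_le_odd_eq: "face_le z w \<Longrightarrow> odd (z i) \<Longrightarrow> w i = z i"
  unfolding face_le_def by metis

lemma face_le_even_eq: "face_le z w \<Longrightarrow> even (w i) \<Longrightarrow> z i = w i"
  unfolding face_le_def by metis

lemma face_le_upd_left: "face_le b a \<Longrightarrow> face_le b (b(i := a i))"
  unfolding face_le_def by simp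

lemma face_le_upd_right: "face_le b a \<Longrightarrow> face_le (b(i := a i)) a"
  unfolding face_le_def by simp

lemma face_le_dist: "face_le z w \<Longrightarrow> z i \<le> w i + 1 \<and> w i \<le> z i + 1"
  unfolding face_le_def by (metis le_add1 le_refl trans_le_add1)

lemma fun_upd_neqI: "x \<noteq> y \<Longrightarrow> f(i := x) \<noteq> f(i := y)"
  by (metis fun_upd_same)

lemma finite_grid [simp]: "finite (grid M k)"
proof -
  have "grid M k \<subseteq> (\<lambda>f i. if i < k then f i else 0) ` (PiE {..<k} (\<lambda>_. {..2 * M}))"
  proof
    fix z assume z: "z \<in> grid M k"
    then have "z = (\<lambda>i. if i < k then restrict z {..<k} i else 0)"
      by (auto simp: grid_def)
    moreover have "restrict z {..<k} \<in> PiE {..<k} (\<lambda>_. {..2 * M})"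
      using z by (auto simp: grid_def)
    ultimately show "z \<in> (\<lambda>f i. if i < k then f i else 0) ` (PiE {..<k} (\<lambda>_. {..2 * M}))"
      by blast
  qed
  then show ?thesis
    by (rule finite_subset) (intro finite_imageI finite_PiE; simp)
qed

lemma grid_mono: "k \<le> K \<Longrightarrow> grid M k \<subseteq> grid M K"
  unfolding grid_def by auto (metis le0 not_le)

lemma odds_grid: "z \<in> grid M k \<Longrightarrow> odds z \<subseteq> {..<k}"
proof
  fix i assume "z \<in> grid M k" "i \<in> odds z"
  then have "odd (z i)" "i \<ge> k \<longrightarrow> z i = 0"
    by (auto simp: grid_def odds_def)
  then have "\<not> i \<ge> k"
    by force
  then show "i \<in> {..<k}"
    by simp
qed

lemma finite_odds: "z \<in> grid M k \<Longrightarrow> finite (odds z)"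
  by (rule finite_subset[OF odds_grid]) auto

lemma card_odds_le: "z \<in> grid M k \<Longrightarrow> card (odds z) \<le> k"
  using card_mono[OF _ odds_grid] by fastforce

lemma finite_face_chain: "face_chain M k C \<Longrightarrow> finite C"
  unfolding face_chain_def using finite_grid finite_subset by blast

lemma face_chain_subset: "face_chain M k C \<Longrightarrow> D \<subseteq> C \<Longrightarrow> face_chain M k D"
  unfolding face_chain_def by blast

lemma face_chain_le:
  assumes "face_chain M k C" "z \<in> C" "w \<in> C" "card (odds z) \<le> card (odds w)"
  shows "face_le z w"
proof (rule ccontr)
  assume n: "\<not> face_le z w"
  then have w: "face_le w z"
    using assms unfolding face_chain_def by blast
  have "finite (odds z)"
    using assms finite_odds unfolding face_chain_def by blast
  then have "odds w = odds z"
    using face_le_odds[OF w] assms(4) card_seteq by blast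
  then show False
    using face_le_eq[OF w] n by auto
qed

lemma face_chain_inj: "face_chain M k C \<Longrightarrow> inj_on (\<lambda>z. card (odds z)) C"
proof (rule inj_onI)
  fix z w assume *: "face_chain M k C" "z \<in> C" "w \<in> C" "card (odds z) = card (odds w)"
  then have "face_le z w" "face_le w z"
    using face_chain_le[OF *(1-3)] face_chain_le[OF *(1) *(3) *(2)] by simp_all
  then show "z = w"
    by (intro face_le_eq) (auto dest: face_le_odds)
qed

lemma face_chain_ranks:
  assumes "face_chain M k C"
  shows "(\<lambda>z. card (odds z)) ` C \<subseteq> {..k}" "card ((\<lambda>z. card (odds z)) ` C) = card C"
proof -
  show "(\<lambda>z. card (odds z)) ` C \<subseteq> {..k}"
  proof
    fix n assume "n \<in> (\<lambda>z. card (odds z)) ` C"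
    then obtain z where "z \<in> C" "n = card (odds z)"
      by blast
    then show "n \<in> {..k}"
      using assms card_odds_le[of z M k] by (auto simp: face_chain_def)
  qed
  show "card ((\<lambda>z. card (odds z)) ` C) = card C"
    by (rule card_image[OF face_chain_inj[OF assms]])
qed

lemma face_chain_insertI:
  assumes "face_chain M k f" "z \<in> grid M k" "\<And>x. x \<in> f \<Longrightarrow> face_le x z \<or> face_le z x"
  shows "face_chain M k (insert z f)"
  using assms unfolding face_chain_def by auto

lemma completion_rank:
  assumes f: "face_chain M k f" and ranks: "(\<lambda>z. card (odds z)) ` f = {..k} - {r}"
    and z: "z \<in> completions M k f"
  shows "card (odds z) = r"
proof -
  have c: "face_chain M k (insert z f)" "z \<notin> f"
    using z by (auto simp: completions_def)
  have "card (odds z) \<le> k"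
    using c(1) by (auto simp: face_chain_def intro: card_odds_le)
  moreover have "card (odds z) \<notin> (\<lambda>z. card (odds z)) ` f"
    using face_chain_inj[OF c(1)] c(2) by (auto simp: inj_on_def)
  ultimately show ?thesis
    using ranks by auto
qed

text \<open>The subdivision is a pseudomanifold with boundary. The \<open>k\<close> vertices of
  \<open>f\<close> have distinct dimensions in \<open>{..k}\<close>, so exactly one dimension
  \<open>r\<close> is missing and every completion has dimension \<open>r\<close>. There are two
  completions, except that for \<open>r = k\<close> one of them may lie outside the grid.\<close>

lemma odd_card_completions_iff:
  assumes f: "face_chain M k f" "card f = k" and "k > 0" "M > 0"
  shows "odd (card (completions M k f)) \<longleftrightarrow> boundary_chain M k f"
proof -
  define rk where "rk = (\<lambda>z::nat\<Rightarrow>nat. card (odds z))"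
  have fin: "finite f"
    using f finite_face_chain by blast
  have fg: "f \<subseteq> grid M k"
    using f by (simp add: face_chain_def)
  have "card (rk ` f) = k" "rk ` f \<subseteq> {..k}"
    using face_chain_ranks[OF f(1)] f(2) by (auto simp: rk_def)
  then have "card ({..k} - rk ` f) = 1"
    by (subst card_Diff_subset) (auto simp: fin)
  then obtain r where r: "{..k} - rk ` f = {r}"
    by (auto simp: card_1_singleton_iff)
  have ranks: "rk ` f = {..k} - {r}" "r \<le> k"
    using r \<open>rk ` f \<subseteq> {..k}\<close> by auto
  have ranks': "(\<lambda>z. card (odds z)) ` f = {..k} - {r}"
    using ranks by (simp add: rk_def)
  have rkz: "rk z = r" if "z \<in> completions M k f" for z
    using completion_rank[OF f(1) ranks' that] by (simp add: rk_def)
  have lef: "face_le x y" if "x \<in> f" "y \<in> f" "rk x \<le> rk y" for x y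
    using face_chain_le[OF f(1)] that by (simp add: rk_def)
  have le1: "face_le x z" if "z \<in> completions M k f" "x \<in> f" "rk x \<le> r" for x z
    using face_chain_le[of M k "insert z f" x z] that rkz[OF that(1)]
    by (auto simp: completions_def rk_def)
  have le2: "face_le z x" if "z \<in> completions M k f" "x \<in> f" "r \<le> rk x" for x z
    using face_chain_le[of M k "insert z f" z x] that rkz[OF that(1)]
    by (auto simp: completions_def rk_def)
  have cg: "z \<in> grid M k" if "z \<in> completions M k f" for z
    using that by (auto simp: completions_def face_chain_def)
  have rne: "rk x \<noteq> r" if "x \<in> f" for x
    using ranks that by auto
  have full: "odds z = {..<k}" if "z \<in> f" "rk z = k" for z
    using that fg odds_grid[of z M k] card_subset_eq[of "{..<k}" "odds z"] by (auto simp: rk_def)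
  \<comment> \<open>Only a chain lacking the top dimension can lie in the boundary: a full cube has
    all its coordinates odd, hence none equal to 0 or \<open>2 * M\<close>.\<close>
  have notbd: "\<not> boundary_chain M k f" if "r < k"
  proof -
    have "k \<in> rk ` f"
      using ranks that by auto
    then obtain z where z: "z \<in> f" "rk z = k"
      by auto
    have "odd (z j)" if "j < k" for j
      using full[OF z] that by (auto simp: odds_def)
    then show ?thesis
      using z(1) unfolding boundary_chain_def
      by (metis dvd_0_right dvd_triv_left insertE singletonD)
  qed
  consider "0 < r" "r < k" | "r = 0" | "r = k" "0 < r"
    using ranks(2) by fastforce
  then show ?thesis
  proof cases
    \<comment> \<open>Between \<open>b\<close> and \<open>a\<close>, whose dimensions differ by 2,
      there are exactly two faces: either of the two directions that \<open>a\<close> adds to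
      \<open>b\<close> can be opened first.\<close>
    case 1
    have "r - 1 \<in> rk ` f"
      using ranks 1 by auto
    then obtain b where b: "b \<in> f" "rk b = r - 1"
      by auto
    have "r + 1 \<in> rk ` f"
      using ranks 1 by auto
    then obtain a where a: "a \<in> f" "rk a = r + 1"
      by auto
    have ba: "face_le b a"
      using lef a b by simp
    have fin_a: "finite (odds a)"
      using finite_odds fg a by blast
    have "card (odds a - odds b) = 2"
      using face_le_odds[OF ba] fin_a a b 1 by (subst card_Diff_subset) (auto simp: rk_def finite_subset)
    then obtain i j where ij: "odds a - odds b = {i, j}" "i \<noteq> j"
      by (auto simp: card_2_iff)
    have upd: "odds (b(l := a l)) = insert l (odds b)" if "l \<in> {i, j}" for l
    proof -
      have "odd (a l)" using that ij by (auto simp: odds_def)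
      then show ?thesis by (auto simp: odds_def)
    qed
    have comp: "completions M k f = {b(i := a i), b(j := a j)}"
    proof (intro equalityI subsetI)
      fix z assume z: "z \<in> completions M k f"
      have bz: "face_le b z" and za: "face_le z a"
        using le1[OF z b(1)] le2[OF z a(1)] a b by auto
      have finz: "finite (odds z)"
        using finite_odds cg[OF z] by blast
      have "card (odds z - odds b) = 1"
        using face_le_odds[OF bz] finz rkz[OF z] b 1
        by (subst card_Diff_subset) (auto simp: rk_def finite_subset)
      then obtain l where l: "odds z - odds b = {l}"
        by (auto simp: card_1_singleton_iff)
      have lij: "l \<in> {i, j}"
        using l ij face_le_odds[OF za] by blast
      have "z = b(l := a l)"
      proof
        fix x
        show "z x = (b(l := a l)) x"
        proof (cases "x = l")
          case True
          then have "odd (z x)" using l by (auto simp: odds_def)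
          then show ?thesis using face_le_odd_eq[OF za] True by simp
        next
          case False
          then have "x \<notin> odds z \<or> x \<in> odds b" using l by blast
          then have "even (z x) \<or> odd (b x)" by (auto simp: odds_def)
          then show ?thesis
            using face_le_odd_eq[OF bz] face_le_even_eq[OF bz] False by (metis fun_upd_other)
        qed
      qed
      then show "z \<in> {b(i := a i), b(j := a j)}"
        using lij by auto
    next
      fix z assume "z \<in> {b(i := a i), b(j := a j)}"
      then obtain l where l: "l \<in> {i, j}" "z = b(l := a l)"
        by auto
      have "l \<notin> odds b"
        using ij l by auto
      then have rz: "rk z = r"
        using upd[OF l(1)] l(2) b 1 finite_odds[of b M k] fg by (auto simp: rk_def)
      have "z \<in> grid M k"
        using l a b fg by (auto simp: grid_def subset_iff)
      moreover have "face_le x z \<or> face_le z x" if "x \<in> f" for x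
      proof (cases "rk x < r")
        case True
        then have "face_le x b" using lef that b by simp
        then show ?thesis using face_le_trans face_le_upd_left[OF ba] l by blast
      next
        case False
        then have "rk x \<ge> r + 1" using rne[OF that] by simp
        then have "face_le a x" using lef that a by simp
        then show ?thesis using face_le_trans face_le_upd_right[OF ba] l by blast
      qed
      ultimately show "z \<in> completions M k f"
        using face_chain_insertI[OF f(1)] rne rz by (auto simp: completions_def)
    qed
    have "b(i := a i) \<noteq> b(j := a j)"
      using upd[of i] upd[of j] ij by (metis DiffE insertE insertI1 insert_commute)
    then show ?thesis
      using comp notbd 1 by simp
  next
    \<comment> \<open>The lowest remaining face is an edge, completed by either endpoint.\<close>
    case 2
    have "1 \<in> rk ` f"
      using ranks 2 \<open>k > 0\<close> by auto
    then obtain a where a: "a \<in> f" "rk a = 1"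
      by auto
    then obtain i where i: "odds a = {i}"
      by (auto simp: rk_def card_1_singleton_iff)
    then have oi: "odd (a i)" and oth: "\<And>j. j \<noteq> i \<Longrightarrow> even (a j)"
      by (auto simp: odds_def)
    have ik: "i < k"
      using odds_grid[of a M k] a fg i by auto
    have ai: "a i + 1 \<le> 2 * M"
    proof -
      have "a i \<le> 2 * M" using a fg ik by (auto simp: grid_def)
      then show ?thesis using oi by (metis Suc_eq_plus1 dvd_triv_left le_neq_implies_less Suc_leI)
    qed
    have comp: "completions M k f = {a(i := a i + 1), a(i := a i - 1)}"
    proof (intro equalityI subsetI)
      fix z assume z: "z \<in> completions M k f"
      have za: "face_le z a"
        using le2[OF z a(1)] 2 by auto
      have "odds z = {}"
        using rkz[OF z] 2 finite_odds[OF cg[OF z]] by (auto simp: rk_def)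
      then have ev: "even (z j)" for j
        by (auto simp: odds_def)
      have "z j = a j" if "j \<noteq> i" for j
        using face_le_even_eq[OF za] oth[OF that] by metis
      moreover have "z i = a i + 1 \<or> z i = a i - 1"
        using za ev[of i] oi unfolding face_le_def by (metis add_diff_cancel_right')
      ultimately have "z = a(i := a i + 1) \<or> z = a(i := a i - 1)"
        by (metis (no_types, lifting) ext fun_upd_other fun_upd_same)
      then show "z \<in> {a(i := a i + 1), a(i := a i - 1)}"
        by simp
    next
      fix z assume zz: "z \<in> {a(i := a i + 1), a(i := a i - 1)}"
      then have za: "face_le z a"
        using oi by (auto simp: face_le_def) presburger+
      have "odds z = {}"
        using zz oi oth by (auto simp: odds_def split: if_splits)
      then have rz: "rk z = r"
        using 2 by (auto simp: rk_def)
      have "z \<in> grid M k"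
        using zz a fg ai ik by (auto simp: grid_def subset_iff)
      moreover have "face_le z x" if "x \<in> f" for x
      proof -
        have "rk x \<ge> 1" using rne[OF that] 2 by simp
        then have "face_le a x" using lef that a by simp
        then show ?thesis using face_le_trans za by blast
      qed
      ultimately show "z \<in> completions M k f"
        using face_chain_insertI[OF f(1)] rne rz by (auto simp: completions_def)
    qed
    have "a(i := a i + 1) \<noteq> a(i := a i - 1)"
      by (rule fun_upd_neqI) simp
    then show ?thesis
      using comp notbd 2 \<open>k > 0\<close> by simp
  next
    \<comment> \<open>The highest remaining face \<open>b\<close> is a wall between two cubes; one
      of them is missing exactly when the wall lies in the boundary of the grid.\<close>
    case 3
    have "k - 1 \<in> rk ` f"
      using ranks 3 by auto
    then obtain b where b: "b \<in> f" "rk b = k - 1"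
      by auto
    have bg: "b \<in> grid M k" using b fg by auto
    have "card ({..<k} - odds b) = 1"
      using odds_grid[OF bg] b 3 by (subst card_Diff_subset) (auto simp: rk_def finite_subset)
    then obtain i where i: "{..<k} - odds b = {i}"
      by (auto simp: card_1_singleton_iff)
    then have ik: "i < k" and ei: "even (b i)" and oth: "\<And>j. j < k \<Longrightarrow> j \<noteq> i \<Longrightarrow> odd (b j)"
      by (auto simp: odds_def)
    have bi: "b i \<le> 2 * M"
      using bg ik by (auto simp: grid_def)
    have below: "face_le x b" if "x \<in> f" for x
    proof -
      have "rk x \<le> k" using that ranks by auto
      then have "rk x \<le> k - 1" using rne[OF that] 3 by simp
      then show ?thesis using lef that b by simp
    qed
    have bd: "boundary_chain M k f \<longleftrightarrow> b i = 0 \<or> b i = 2 * M"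
    proof
      assume "boundary_chain M k f"
      then obtain j v where jv: "j < k" "v \<in> {0, 2 * M}" "\<forall>z\<in>f. z j = v"
        by (auto simp: boundary_chain_def)
      then have "even (b j)" using b by auto
      then have "j = i" using oth jv by blast
      then show "b i = 0 \<or> b i = 2 * M" using jv b by auto
    next
      assume "b i = 0 \<or> b i = 2 * M"
      moreover have "\<forall>z\<in>f. z i = b i"
        using below face_le_even_eq ei by metis
      ultimately show "boundary_chain M k f"
        unfolding boundary_chain_def using ik by blast
    qed
    have comp: "completions M k f = {z. (z = b(i := b i + 1) \<and> b i \<noteq> 2 * M) \<or> (z = b(i := b i - 1) \<and> b i \<noteq> 0)}"
      (is "_ = ?R")
    proof (intro equalityI subsetI)
      fix z assume z: "z \<in> completions M k f"
      have bz: "face_le b z"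
        using le1[OF z b(1)] b 3 by auto
      have "odds z = {..<k}"
        using odds_grid[OF cg[OF z]] rkz[OF z] 3 card_subset_eq[of "{..<k}" "odds z"] by (auto simp: rk_def)
      then have oz: "odd (z i)" using ik by (auto simp: odds_def)
      have "z j = b j" if "j \<noteq> i" for j
      proof (cases "j < k")
        case True then show ?thesis using face_le_odd_eq[OF bz] oth that by metis
      next
        case False then show ?thesis using cg[OF z] bg by (auto simp: grid_def)
      qed
      then have zb: "z = b(i := z i)"
        by (auto intro!: ext)
      have "b i = z i + 1 \<or> z i = b i + 1"
        using bz ei oz unfolding face_le_def by metis
      moreover have "z i \<le> 2 * M"
        using cg[OF z] ik by (auto simp: grid_def)
      ultimately have "(z i = b i + 1 \<and> b i \<noteq> 2 * M) \<or> (z i = b i - 1 \<and> b i \<noteq> 0)"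
        by auto
      moreover have "z = b(i := x)" if "z i = x" for x
        using zb that by metis
      ultimately show "z \<in> ?R"
        by blast
    next
      fix z assume zz: "z \<in> ?R"
      then have "z i = b i + 1 \<or> b i = z i + 1" "\<And>j. j \<noteq> i \<Longrightarrow> z j = b j"
        by auto
      then have bz: "face_le b z"
        using ei unfolding face_le_def by (metis even_plus_one_iff)
      have "odds z = insert i (odds b)"
        using zz ei by (auto simp: odds_def split: if_splits)
      then have "odds z = {..<k}"
        using i odds_grid[OF bg] by auto
      then have rz: "rk z = r"
        using 3 by (auto simp: rk_def)
      have "z i \<le> 2 * M"
        using zz bi by auto
      then have "z \<in> grid M k"
        using zz bg ik by (auto simp: grid_def)
      moreover have "face_le x z" if "x \<in> f" for x
        using below[OF that] bz face_le_trans by blast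
      ultimately show "z \<in> completions M k f"
        using face_chain_insertI[OF f(1)] rne rz by (auto simp: completions_def)
    qed
    have ne: "b(i := b i + 1) \<noteq> b(i := b i - 1)"
      by (rule fun_upd_neqI) simp
    show ?thesis
    proof (cases "b i = 0 \<or> b i = 2 * M")
      case True
      have "completions M k f = {b(i := b i + 1)} \<or> completions M k f = {b(i := b i - 1)}"
        unfolding comp using True \<open>M > 0\<close> by (elim disjE) (simp_all add: set_eq_iff)
      then show ?thesis
        using bd True by auto
    next
      case False
      then have "completions M k f = {b(i := b i + 1), b(i := b i - 1)}"
        unfolding comp using False by (simp add: set_eq_iff)
      then show ?thesis
        using bd False ne by simp
    qed
  qed
qed

text \<open>Listed by increasing absolute value, the elements of \<open>S\<close> have alternating signs, starting with \<open>e\<close>.\<close>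

definition alternating :: "int \<Rightarrow> int set \<Rightarrow> bool" where
  "alternating e S \<longleftrightarrow> (\<forall>x\<in>S. sgn x = e * (-1) ^ card {y \<in> S. \<bar>y\<bar> < \<bar>x\<bar>})"

lemma alternating_empty [simp]: "alternating e {}"
  by (simp add: alternating_def)

text \<open>The new element precedes all others in absolute value, so every rank in \<open>S\<close>
  goes up by one and the starting sign required of \<open>S\<close> is reversed.\<close>

lemma alternating_insert:
  assumes "finite S" "\<And>y. y \<in> S \<Longrightarrow> \<bar>x\<bar> < \<bar>y\<bar>"
  shows "alternating e (insert x S) \<longleftrightarrow> sgn x = e \<and> alternating (- e) S"
proof -
  have x: "{y \<in> insert x S. \<bar>y\<bar> < \<bar>x\<bar>} = {}"
    using assms(2) by force
  have "card {y \<in> insert x S. \<bar>y\<bar> < \<bar>z\<bar>} = Suc (card {y \<in> S. \<bar>y\<bar> < \<bar>z\<bar>})" if "z \<in> S" for z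
  proof -
    have "{y \<in> insert x S. \<bar>y\<bar> < \<bar>z\<bar>} = insert x {y \<in> S. \<bar>y\<bar> < \<bar>z\<bar>}"
      using assms(2)[OF that] by auto
    moreover have "x \<notin> {y \<in> S. \<bar>y\<bar> < \<bar>z\<bar>}"
      using assms(2)[of x] by auto
    ultimately show ?thesis
      using assms(1) by simp
  qed
  then have "(\<forall>z\<in>S. sgn z = e * (-1) ^ card {y \<in> insert x S. \<bar>y\<bar> < \<bar>z\<bar>}) \<longleftrightarrow> alternating (- e) S"
    by (simp add: alternating_def)
  then show ?thesis
    unfolding alternating_def[of e] ball_simps x by simp
qed

lemma alternating_sign_unique:
  assumes "finite S" "S \<noteq> {}" "alternating 1 S" shows "\<not> alternating (-1) S"
  using assms unfolding alternating_def by fastforce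

lemma alternating_uminus: "alternating e (uminus ` S) \<longleftrightarrow> alternating (- e) S"
proof -
  have "card {y \<in> uminus ` S. \<bar>y\<bar> < \<bar>- x\<bar>} = card {y \<in> S. \<bar>y\<bar> < \<bar>x\<bar>}" for x
    by (rule bij_betw_same_card[of uminus], rule bij_betw_byWitness[where f' = uminus]) auto
  then show ?thesis
    by (auto simp: alternating_def sgn_minus)
qed

text \<open>An alternating set has exactly one facet that alternates starting with \<open>e\<close>:
  its last element is dropped if it starts with \<open>e\<close> itself, its first one otherwise. A
  set that is not alternating has none or two. For nonempty \<open>S\<close> the right-hand side
  says that \<open>S\<close> does not alternate; for the empty set both sides hold. The induction
  splits off the element of least absolute value.\<close>

lemma even_card_alternating_facets:
  assumes "finite S" "0 \<notin> S" "inj_on abs S" "e \<in> {1, -1}"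
  shows "even (card {s \<in> S. alternating e (S - {s})}) \<longleftrightarrow> (alternating 1 S \<longleftrightarrow> alternating (-1) S)"
  using assms
proof (induction "card S" arbitrary: S e)
  case 0
  then show ?case by simp
next
  case (Suc n)
  then have fin: "finite S" and ne: "S \<noteq> {}"
    by auto
  define m where "m = Min (abs ` S)"
  have "m \<in> abs ` S"
    unfolding m_def using fin ne by (intro Min_in) auto
  then obtain x where x: "x \<in> S" "\<bar>x\<bar> = m"
    by auto
  define S' where "S' = S - {x}"
  have S: "S = insert x S'" "x \<notin> S'" "finite S'"
    using x fin by (auto simp: S'_def)
  have less: "\<bar>x\<bar> < \<bar>y\<bar>" if "y \<in> S'" for y
  proof -
    have "\<bar>x\<bar> \<le> \<bar>y\<bar>"
      using that fin x by (auto simp: m_def S'_def)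
    moreover have "\<bar>x\<bar> \<noteq> \<bar>y\<bar>"
      using that Suc.prems(3) x by (auto simp: S'_def inj_on_def)
    ultimately show ?thesis by simp
  qed
  have x0: "x \<noteq> 0"
    using Suc.prems(2) x by auto
  have IH: "even (card {s \<in> S'. alternating e' (S' - {s})}) \<longleftrightarrow> (alternating 1 S' \<longleftrightarrow> alternating (-1) S')"
    if "e' \<in> {1, -1}" for e'
  proof (rule Suc.hyps(1))
    show "n = card S'" using Suc.hyps(2) S by simp
    show "finite S'" "0 \<notin> S'" "inj_on abs S'"
      using Suc.prems S by (auto simp: inj_on_def)
  qed (use that in simp)
  have ins: "alternating e' (insert x D) \<longleftrightarrow> sgn x = e' \<and> alternating (- e') D" if "D \<subseteq> S'" for e' D
    using that S less by (intro alternating_insert) (auto intro: finite_subset)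
  have "{s \<in> S. alternating e (S - {s})} =
      {s. s = x \<and> alternating e S'} \<union> {s \<in> S'. alternating e (insert x (S' - {s}))}"
  proof -
    have "S - {s} = insert x (S' - {s})" if "s \<in> S'" for s
      using that S by auto
    moreover have "S - {x} = S'" by (simp add: S'_def)
    ultimately show ?thesis
      using S by auto
  qed
  also have "{s \<in> S'. alternating e (insert x (S' - {s}))} =
      {s \<in> S'. sgn x = e \<and> alternating (- e) (S' - {s})}"
    by (subst ins) auto
  finally have eq: "{s \<in> S. alternating e (S - {s})} =
      {s. s = x \<and> alternating e S'} \<union> {s \<in> S'. sgn x = e \<and> alternating (- e) (S' - {s})}" .
  have card: "card {s \<in> S. alternating e (S - {s})} =
      card {s. s = x \<and> alternating e S'} + card {s \<in> S'. sgn x = e \<and> alternating (- e) (S' - {s})}"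
    unfolding eq using S by (intro card_Un_disjoint) auto
  have c1: "card {s. s = x \<and> alternating e S'} = (if alternating e S' then 1 else 0)"
    by auto
  have sg: "sgn x = e \<or> sgn x = - e"
    using x0 Suc.prems(4) by (auto simp: sgn_if)
  have altS: "alternating e' S \<longleftrightarrow> sgn x = e' \<and> alternating (- e') S'" for e'
    using ins[of S' e'] S by simp
  have IH': "even (card {s \<in> S'. alternating (- e) (S' - {s})}) \<longleftrightarrow> (alternating 1 S' \<longleftrightarrow> alternating (-1) S')"
    using IH[of "- e"] Suc.prems(4) by auto
  show ?case
  proof (cases "sgn x = e")
    case True
    then show ?thesis
      unfolding card c1 altS using IH' Suc.prems(4) by (auto split: if_splits)
  next
    case False
    then show ?thesis
      unfolding card c1 altS using sg Suc.prems(4) by (auto split: if_splits)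
  qed
qed

definition chain_alternating :: "((nat \<Rightarrow> nat) \<Rightarrow> int) \<Rightarrow> int \<Rightarrow> (nat \<Rightarrow> nat) set \<Rightarrow> bool" where
  "chain_alternating lab e C \<longleftrightarrow> inj_on lab C \<and> alternating e (lab ` C)"

text \<open>If \<open>lab\<close> agrees at \<open>c\<close> and \<open>d\<close>, only the removal
  of one of these two can leave an injective labelling, and both removals leave the same labels; so
  the count is 0 or 2. Otherwise this is a statement about label sets, in which the absence of
  opposite labels makes the absolute values distinct.\<close>

lemma odd_card_alternating_facets_chain:
  assumes "finite C" "C \<noteq> {}" and nz: "\<And>c. c \<in> C \<Longrightarrow> lab c \<noteq> 0"
    and nc: "\<And>c d. c \<in> C \<Longrightarrow> d \<in> C \<Longrightarrow> lab c \<noteq> - lab d"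
  shows "odd (card {c \<in> C. chain_alternating lab 1 (C - {c})}) \<longleftrightarrow>
    chain_alternating lab 1 C \<or> chain_alternating lab (-1) C"
proof (cases "inj_on lab C")
  case True
  have inj_abs: "inj_on abs (lab ` C)"
  proof (rule inj_onI)
    fix x y assume "x \<in> lab ` C" "y \<in> lab ` C" "\<bar>x\<bar> = \<bar>y\<bar>"
    then show "x = y"
      using nc by (auto simp: abs_eq_iff)
  qed
  have im: "lab ` (C - {c}) = lab ` C - {lab c}" if "c \<in> C" for c
    using True that by (auto simp: inj_on_def)
  have "card {c \<in> C. chain_alternating lab 1 (C - {c})} = card {s \<in> lab ` C. alternating 1 (lab ` C - {s})}"
  proof (rule bij_betw_same_card[of lab])
    have "{s \<in> lab ` C. alternating 1 (lab ` C - {s})} = lab ` {c \<in> C. chain_alternating lab 1 (C - {c})}"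
      using im inj_on_diff[OF True] by (auto simp: chain_alternating_def)
    moreover have "inj_on lab {c \<in> C. chain_alternating lab 1 (C - {c})}"
      using True by (auto simp: inj_on_def)
    ultimately show "bij_betw lab {c \<in> C. chain_alternating lab 1 (C - {c})} {s \<in> lab ` C. alternating 1 (lab ` C - {s})}"
      by (simp add: bij_betw_def)
  qed
  moreover have "even (card {s \<in> lab ` C. alternating 1 (lab ` C - {s})}) \<longleftrightarrow>
      (alternating 1 (lab ` C) \<longleftrightarrow> alternating (-1) (lab ` C))"
    using assms nz by (intro even_card_alternating_facets inj_abs) auto
  moreover have "\<not> (alternating 1 (lab ` C) \<and> alternating (-1) (lab ` C))"
    using alternating_sign_unique[of "lab ` C"] assms by auto
  ultimately show ?thesis
    using True by (auto simp: chain_alternating_def)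
next
  case False
  then obtain c d where cd: "c \<in> C" "d \<in> C" "c \<noteq> d" "lab c = lab d"
    by (auto simp: inj_on_def)
  have sub: "{x \<in> C. chain_alternating lab 1 (C - {x})} \<subseteq> {c, d}"
  proof
    fix x assume "x \<in> {x \<in> C. chain_alternating lab 1 (C - {x})}"
    then have "inj_on lab (C - {x})"
      by (simp add: chain_alternating_def)
    then show "x \<in> {c, d}"
      using cd by (auto simp: inj_on_def)
  qed
  have im: "lab ` (C - {c}) = lab ` C" "lab ` (C - {d}) = lab ` C"
    using cd by (auto simp: image_iff) (metis Diff_iff imageI singletonD)+
  have "card (C - {c}) = card (C - {d})"
    using cd by simp
  then have "inj_on lab (C - {c}) \<longleftrightarrow> inj_on lab (C - {d})"
    using im assms(1) by (metis eq_card_imp_inj_on card_image finite_Diff)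
  then have "chain_alternating lab 1 (C - {c}) \<longleftrightarrow> chain_alternating lab 1 (C - {d})"
    by (simp add: chain_alternating_def im)
  then have "{x \<in> C. chain_alternating lab 1 (C - {x})} = {} \<or> {x \<in> C. chain_alternating lab 1 (C - {x})} = {c, d}"
    using sub cd by blast
  then have "even (card {x \<in> C. chain_alternating lab 1 (C - {x})})"
  proof
    assume eq: "{x \<in> C. chain_alternating lab 1 (C - {x})} = {}"
    show ?thesis unfolding eq by simp
  next
    assume eq: "{x \<in> C. chain_alternating lab 1 (C - {x})} = {c, d}"
    show ?thesis unfolding eq using cd by simp
  qed
  then show ?thesis
    using False by (auto simp: chain_alternating_def)
qed

definition max_chains :: "nat \<Rightarrow> nat \<Rightarrow> (nat \<Rightarrow> nat) set set" where
  "max_chains M k = {C. face_chain M k C \<and> card C = Suc k}"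

definition facet_chains :: "nat \<Rightarrow> nat \<Rightarrow> (nat \<Rightarrow> nat) set set" where
  "facet_chains M k = {f. face_chain M k f \<and> card f = k}"

lemma finite_chains [simp]: "finite (max_chains M k)" "finite (facet_chains M k)"
  by (rule finite_subset[of _ "Pow (grid M k)"]; auto simp: max_chains_def facet_chains_def face_chain_def)+

lemma finite_completions [simp]: "finite (completions M k f)"
  by (rule finite_subset[OF _ finite_grid[of M k]]) (auto simp: completions_def face_chain_def)

text \<open>Double counting of the pairs (simplex, positively alternating facet): interior facets lie in two
  simplices, boundary facets in one.\<close>

lemma odd_card_alternating_max_chains:
  assumes "k > 0" "M > 0" and nz: "\<And>z. z \<in> grid M k \<Longrightarrow> lab z \<noteq> 0"
    and nc: "\<And>z w. z \<in> grid M k \<Longrightarrow> w \<in> grid M k \<Longrightarrow> face_le z w \<Longrightarrow> lab z \<noteq> - lab w"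
  shows "odd (card {C \<in> max_chains M k. chain_alternating lab 1 C \<or> chain_alternating lab (-1) C}) \<longleftrightarrow>
    odd (card {f \<in> facet_chains M k. boundary_chain M k f \<and> chain_alternating lab 1 f})"
proof -
  define F where "F = {f \<in> facet_chains M k. chain_alternating lab 1 f}"
  define A where "A = (SIGMA C:max_chains M k. {c \<in> C. chain_alternating lab 1 (C - {c})})"
  define B where "B = (SIGMA f:F. completions M k f)"
  have finC: "finite C" if "C \<in> max_chains M k" for C
    using that finite_face_chain by (auto simp: max_chains_def)
  have "bij_betw (\<lambda>(C, c). (C - {c}, c)) A B"
  proof (rule bij_betw_byWitness[where f' = "\<lambda>(f, c). (insert c f, c)"])
    show "\<forall>a\<in>A. (\<lambda>(f, c). (insert c f, c)) ((\<lambda>(C, c). (C - {c}, c)) a) = a"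
      by (auto simp: A_def)
    show "\<forall>b\<in>B. (\<lambda>(C, c). (C - {c}, c)) ((\<lambda>(f, c). (insert c f, c)) b) = b"
      by (auto simp: B_def completions_def)
    show "(\<lambda>(C, c). (C - {c}, c)) ` A \<subseteq> B"
    proof clarsimp
      fix C c assume "(C, c) \<in> A"
      then have C: "face_chain M k C" "card C = Suc k" "c \<in> C" "chain_alternating lab 1 (C - {c})"
        by (auto simp: A_def max_chains_def)
      then have "face_chain M k (C - {c})" "card (C - {c}) = k" "insert c (C - {c}) = C"
        using face_chain_subset[of M k C "C - {c}"] by auto
      then show "(C - {c}, c) \<in> B"
        using C by (auto simp: B_def F_def facet_chains_def completions_def)
    qed
    show "(\<lambda>(f, c). (insert c f, c)) ` B \<subseteq> A"
    proof clarsimp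
      fix f c assume "(f, c) \<in> B"
      then have f: "face_chain M k (insert c f)" "card f = k" "c \<notin> f" "chain_alternating lab 1 f" "finite f"
        using finite_face_chain by (auto simp: B_def F_def facet_chains_def completions_def)
      then show "(insert c f, c) \<in> A"
        by (auto simp: A_def max_chains_def)
    qed
  qed
  then have "card A = card B"
    by (rule bij_betw_same_card)
  moreover have "card A = (\<Sum>C\<in>max_chains M k. card {c \<in> C. chain_alternating lab 1 (C - {c})})"
    unfolding A_def using finC by (subst card_SigmaI) auto
  moreover have "card B = (\<Sum>f\<in>F. card (completions M k f))"
    unfolding B_def by (subst card_SigmaI) (auto simp: F_def)
  ultimately have sums: "(\<Sum>C\<in>max_chains M k. card {c \<in> C. chain_alternating lab 1 (C - {c})}) = (\<Sum>f\<in>F. card (completions M k f))"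
    by simp
  have 1: "{C \<in> max_chains M k. odd (card {c \<in> C. chain_alternating lab 1 (C - {c})})} =
      {C \<in> max_chains M k. chain_alternating lab 1 C \<or> chain_alternating lab (-1) C}"
  proof (intro Collect_cong conj_cong refl)
    fix C assume C: "C \<in> max_chains M k"
    show "odd (card {c \<in> C. chain_alternating lab 1 (C - {c})}) \<longleftrightarrow>
        chain_alternating lab 1 C \<or> chain_alternating lab (-1) C"
    proof (rule odd_card_alternating_facets_chain)
      show "finite C"
        by (rule finC[OF C])
      show "C \<noteq> {}"
        using C by (auto simp: max_chains_def)
      show "lab c \<noteq> 0" if "c \<in> C" for c
        using C that nz by (auto simp: max_chains_def face_chain_def)
      show "lab c \<noteq> - lab d" if "c \<in> C" "d \<in> C" for c d
      proof -
        have "face_le c d \<or> face_le d c" "c \<in> grid M k" "d \<in> grid M k"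
          using C that by (auto simp: max_chains_def face_chain_def)
        then show ?thesis
          using nc[of c d] nc[of d c] by auto
      qed
    qed
  qed
  have 2: "{f \<in> F. odd (card (completions M k f))} = {f \<in> facet_chains M k. boundary_chain M k f \<and> chain_alternating lab 1 f}"
    using odd_card_completions_iff[OF _ _ assms(1,2)] by (auto simp: F_def facet_chains_def)
  have "finite F" by (simp add: F_def)
  then show ?thesis
    using sums even_sum_iff[of "max_chains M k" "\<lambda>C. card {c \<in> C. chain_alternating lab 1 (C - {c})}"]
      even_sum_iff[of F "\<lambda>f. card (completions M k f)"] 1 2 by simp
qed

section \<open>Gluing the boundary of the cube\<close>

definition flip :: "nat \<Rightarrow> nat set \<Rightarrow> (nat \<Rightarrow> nat) \<Rightarrow> nat \<Rightarrow> nat" where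
  "flip M J z = (\<lambda>i. if i \<in> J then 2 * M - z i else z i)"

lemma flip_grid: "J \<subseteq> {..<k} \<Longrightarrow> z \<in> grid M k \<Longrightarrow> flip M J z \<in> grid M k"
  by (auto simp: flip_def grid_def)

lemma flip_flip: "J \<subseteq> {..<k} \<Longrightarrow> z \<in> grid M k \<Longrightarrow> flip M J (flip M J z) = z"
  by (auto simp: flip_def grid_def fun_eq_iff)

lemma flip_face_le:
  assumes "J \<subseteq> {..<k}" "z \<in> grid M k" "w \<in> grid M k" "face_le z w"
  shows "face_le (flip M J z) (flip M J w)"
  unfolding face_le_def
proof
  fix i
  have zw: "z i = w i \<or> (even (z i) \<and> odd (w i) \<and> (z i = w i + 1 \<or> w i = z i + 1))"
    using assms(4) by (simp add: face_le_def)
  show "flip M J z i = flip M J w i \<or> (even (flip M J z i) \<and> odd (flip M J w i) \<and>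
      (flip M J z i = flip M J w i + 1 \<or> flip M J w i = flip M J z i + 1))"
  proof (cases "i \<in> J")
    case True
    then have "z i \<le> 2 * M" "w i \<le> 2 * M"
      using assms by (auto simp: grid_def)
    then show ?thesis
      using zw True by (auto simp: flip_def)
  qed (use zw in \<open>auto simp: flip_def\<close>)
qed

lemma flip_face_chain:
  assumes "J \<subseteq> {..<k}" "face_chain M k C"
  shows "face_chain M k (flip M J ` C)" "card (flip M J ` C) = card C" "flip M J ` flip M J ` C = C"
    "inj_on (flip M J) C"
proof -
  have C: "C \<subseteq> grid M k"
    using assms by (simp add: face_chain_def)
  show "face_chain M k (flip M J ` C)"
    using assms C flip_grid[OF assms(1)] flip_face_le[OF assms(1)]
    unfolding face_chain_def by (smt (verit, best) image_iff subset_iff)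
  show inj: "inj_on (flip M J) C"
    using C flip_flip[OF assms(1)] by (intro inj_onI) (metis subsetD)
  then show "card (flip M J ` C) = card C"
    by (rule card_image)
  show "flip M J ` flip M J ` C = C"
    using C flip_flip[OF assms(1)] by (force simp: image_image)
qed

lemma chain_alternating_flip:
  assumes "J \<subseteq> {..<k}" "face_chain M k C" "s \<in> {1, -1}" "\<And>z. z \<in> C \<Longrightarrow> lab (flip M J z) = s * lab z"
  shows "chain_alternating lab e (flip M J ` C) \<longleftrightarrow> chain_alternating lab (s * e) C"
proof -
  have "lab ` flip M J ` C = (\<lambda>x. s * x) ` lab ` C"
    using assms(4) by (force simp: image_image)
  moreover have "alternating e ((\<lambda>x. s * x) ` L) \<longleftrightarrow> alternating (s * e) L" for L
    using assms(3) alternating_uminus[of e L] by auto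
  moreover have "inj_on lab (flip M J ` C) \<longleftrightarrow> inj_on lab C"
  proof -
    have "inj_on lab (flip M J ` C) \<longleftrightarrow> inj_on (lab \<circ> flip M J) C"
      using flip_face_chain(4)[OF assms(1,2)] by (metis comp_inj_on inj_on_imageI)
    also have "\<dots> \<longleftrightarrow> inj_on lab C"
      using assms(3,4) by (auto simp: inj_on_def)
    finally show ?thesis .
  qed
  ultimately show ?thesis
    by (simp add: chain_alternating_def)
qed

text \<open>Ky Fan's lemma for the barycentric subdivision of a cubical grid on a cube whose boundary is
  glued so that it represents the sphere with its antipodal action: the face \<open>z\<^sub>j = 2M\<close> is the
  mirror image of \<open>z\<^sub>j = 0\<close> under the flip of the coordinates \<open>j\<close> and \<open>j + 1\<close>, and for the last
  coordinate \<open>j\<close> the two faces are antipodal.\<close>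

lemma odd_card_alternating_chains:
  assumes "M > 0" and nz: "\<And>z. z \<in> grid M K \<Longrightarrow> lab z \<noteq> 0"
    and nc: "\<And>z w. z \<in> grid M K \<Longrightarrow> w \<in> grid M K \<Longrightarrow> face_le z w \<Longrightarrow> lab z \<noteq> - lab w"
    and side: "\<And>z j. z \<in> grid M K \<Longrightarrow> j + 1 < K \<Longrightarrow> z j \<in> {0, 2 * M} \<Longrightarrow> lab (flip M {j, j + 1} z) = lab z"
    and anti: "\<And>z j. z \<in> grid M K \<Longrightarrow> j < K \<Longrightarrow> z j \<in> {0, 2 * M} \<Longrightarrow> (\<forall>i>j. z i = 0) \<Longrightarrow> lab (flip M {j} z) = - lab z"
    and "k \<le> K"
  shows "odd (card {C \<in> max_chains M k. chain_alternating lab 1 C \<or> chain_alternating lab (-1) C})"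
  using \<open>k \<le> K\<close>
proof (induction k)
  case 0
  have g: "grid M 0 = {\<lambda>_. 0}"
    by (auto simp: grid_def)
  have "lab (\<lambda>_. 0) \<noteq> 0"
    using nz by (auto simp: grid_def)
  then have "sgn (lab (\<lambda>_. 0)) = 1 \<or> sgn (lab (\<lambda>_. 0)) = -1"
    by (auto simp: sgn_if)
  then have "chain_alternating lab 1 {\<lambda>_. 0} \<or> chain_alternating lab (-1) {\<lambda>_. 0}"
    using alternating_insert[of "{}"] by (auto simp: chain_alternating_def)
  moreover have "max_chains M 0 = {{\<lambda>_. 0}}"
  proof -
    have "C = {\<lambda>_. 0}" if "C \<subseteq> {\<lambda>_. 0}" "card C = Suc 0" for C :: "(nat \<Rightarrow> nat) set"
      using that by (metis card.empty nat.distinct(1) subset_singletonD)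
    then show ?thesis
      by (auto simp: max_chains_def face_chain_def g)
  qed
  ultimately have "{C \<in> max_chains M 0. chain_alternating lab 1 C \<or> chain_alternating lab (-1) C} = {{\<lambda>_. 0}}"
    by auto
  then show ?case by simp
next
  case (Suc k)
  then have kK: "k < K" "Suc k \<le> K" by auto
  have gK: "z \<in> grid M K" if "z \<in> grid M (Suc k)" for z
    using grid_mono[OF kK(2)] that by blast
  define P where "P = {f \<in> facet_chains M (Suc k). chain_alternating lab 1 f}"
  define G where "G = (\<lambda>j v. {f \<in> P. \<forall>z\<in>f. z j = v})"
  have finG: "finite (G j v)" for j v
    by (simp add: G_def P_def)
  have fcP: "face_chain M (Suc k) f" "card f = Suc k" "chain_alternating lab 1 f" if "f \<in> P" for f
    using that by (auto simp: P_def facet_chains_def)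
  have bd: "{f \<in> facet_chains M (Suc k). boundary_chain M (Suc k) f \<and> chain_alternating lab 1 f} =
      (\<Union>j<Suc k. G j 0 \<union> G j (2 * M))"
    by (auto simp: P_def G_def boundary_chain_def)
  \<comment> \<open>A chain of \<open>Suc k\<close> vertices is frozen in one coordinate at most:
    two coordinates fixed at even values would leave it only the dimensions
    \<open>{..k - 1}\<close>.\<close>
  have uniq: "j = j'" if "f \<in> G j v" "f \<in> G j' v'" "v \<in> {0, 2 * M}" "v' \<in> {0, 2 * M}"
    "j < Suc k" "j' < Suc k" for f j j' v v'
  proof (rule ccontr)
    assume "j \<noteq> j'"
    have f: "face_chain M (Suc k) f" "card f = Suc k"
      using that fcP by (auto simp: G_def)
    have "card (odds z) \<le> k - 1" if "z \<in> f" for z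
    proof -
      have "odds z \<subseteq> {..<Suc k}"
        using f that odds_grid by (auto simp: face_chain_def)
      moreover have "j \<notin> odds z" "j' \<notin> odds z"
        using \<open>f \<in> G j v\<close> \<open>f \<in> G j' v'\<close> \<open>v \<in> _\<close> \<open>v' \<in> _\<close> \<open>z \<in> f\<close> by (auto simp: G_def odds_def)
      ultimately have "odds z \<subseteq> {..<Suc k} - {j, j'}"
        by auto
      then have "card (odds z) \<le> card ({..<Suc k} - {j, j'})"
        by (intro card_mono) auto
      also have "\<dots> = k - 1"
        using \<open>j \<noteq> j'\<close> that \<open>j < Suc k\<close> \<open>j' < Suc k\<close> by (subst card_Diff_subset) auto
      finally show ?thesis .
    qed
    then have "(\<lambda>z. card (odds z)) ` f \<subseteq> {..k - 1}"
      by auto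
    then have "card f \<le> card {..k - 1}"
      using face_chain_ranks(2)[OF f(1)] by (metis card_mono finite_atMost)
    moreover have "k > 0"
      using \<open>j \<noteq> j'\<close> \<open>j < Suc k\<close> \<open>j' < Suc k\<close> by auto
    ultimately show False
      using f(2) by simp
  qed
  have disj: "G j 0 \<inter> G j (2 * M) = {}" for j
  proof -
    have "f \<noteq> {}" if "f \<in> P" for f
      using fcP[OF that] by auto
    then show ?thesis
      using \<open>M > 0\<close> by (fastforce simp: G_def)
  qed
  \<comment> \<open>As \<open>J\<close> contains \<open>j\<close>, the flip exchanges the facets
    \<open>z j = 0\<close> and \<open>z j = 2 * M\<close>; it multiplies the labels by
    \<open>s\<close> and thereby turns the starting sign 1 into \<open>s\<close>.\<close>
  have flipG: "card {f \<in> facet_chains M (Suc k). (\<forall>z\<in>f. z j = 2 * M) \<and> chain_alternating lab 1 f} =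
      card {f \<in> facet_chains M (Suc k). (\<forall>z\<in>f. z j = 0) \<and> chain_alternating lab s f}"
    if J: "j \<in> J" "J \<subseteq> {..<Suc k}" and s: "s \<in> {1, -1}"
      and lab: "\<And>z. z \<in> grid M (Suc k) \<Longrightarrow> z j \<in> {0, 2 * M} \<Longrightarrow> lab (flip M J z) = s * lab z" for j J s
  proof (rule bij_betw_same_card, rule bij_betw_byWitness[where f = "image (flip M J)" and f' = "image (flip M J)"])
    have fl: "flip M J ` f \<in> facet_chains M (Suc k)" "flip M J ` flip M J ` f = f" if "f \<in> facet_chains M (Suc k)" for f
      using that flip_face_chain[OF J(2), of M f] by (auto simp: facet_chains_def)
    have al: "chain_alternating lab e (flip M J ` f) \<longleftrightarrow> chain_alternating lab (s * e) f"
      if "f \<in> facet_chains M (Suc k)" "\<forall>z\<in>f. z j = v" "v \<in> {0, 2 * M}" for f v e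
    proof (rule chain_alternating_flip[OF J(2) _ s])
      show "face_chain M (Suc k) f" using that by (simp add: facet_chains_def)
      fix z assume "z \<in> f"
      then have "z \<in> grid M (Suc k)" "z j \<in> {0, 2 * M}"
        using that by (auto simp: facet_chains_def face_chain_def)
      then show "lab (flip M J z) = s * lab z" by (rule lab)
    qed
    have ss: "s * s = 1" using s by auto
    show "\<forall>a\<in>{f \<in> facet_chains M (Suc k). (\<forall>z\<in>f. z j = 2 * M) \<and> chain_alternating lab 1 f}.
        flip M J ` flip M J ` a = a"
      using fl by blast
    show "\<forall>a\<in>{f \<in> facet_chains M (Suc k). (\<forall>z\<in>f. z j = 0) \<and> chain_alternating lab s f}.
        flip M J ` flip M J ` a = a"
      using fl by blast
    show "(`) (flip M J) ` {f \<in> facet_chains M (Suc k). (\<forall>z\<in>f. z j = 2 * M) \<and> chain_alternating lab 1 f}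
        \<subseteq> {f \<in> facet_chains M (Suc k). (\<forall>z\<in>f. z j = 0) \<and> chain_alternating lab s f}"
    proof (rule image_subsetI, clarsimp)
      fix f assume f: "f \<in> facet_chains M (Suc k)" "\<forall>z\<in>f. z j = 2 * M" "chain_alternating lab 1 f"
      then show "flip M J ` f \<in> facet_chains M (Suc k) \<and> (\<forall>z\<in>f. flip M J z j = 0) \<and> chain_alternating lab s (flip M J ` f)"
        using fl al[OF f(1,2), of s] J ss by (auto simp: flip_def)
    qed
    show "(`) (flip M J) ` {f \<in> facet_chains M (Suc k). (\<forall>z\<in>f. z j = 0) \<and> chain_alternating lab s f}
        \<subseteq> {f \<in> facet_chains M (Suc k). (\<forall>z\<in>f. z j = 2 * M) \<and> chain_alternating lab 1 f}"
    proof (rule image_subsetI, clarsimp)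
      fix f assume f: "f \<in> facet_chains M (Suc k)" "\<forall>z\<in>f. z j = 0" "chain_alternating lab s f"
      then show "flip M J ` f \<in> facet_chains M (Suc k) \<and> (\<forall>z\<in>f. flip M J z j = 2 * M) \<and> chain_alternating lab 1 (flip M J ` f)"
        using fl al[OF f(1,2), of 1] J by (auto simp: flip_def)
    qed
  qed
  have Geq: "G j v = {f \<in> facet_chains M (Suc k). (\<forall>z\<in>f. z j = v) \<and> chain_alternating lab 1 f}" for j v
    by (auto simp: G_def P_def)
  have sides: "card (G j (2 * M)) = card (G j 0)" if "j < k" for j
    unfolding Geq by (rule flipG[of j "{j, j + 1}" 1]) (use that side gK kK in auto)
  have bottom: "{f \<in> facet_chains M (Suc k). (\<forall>z\<in>f. z k = 0) \<and> chain_alternating lab e f} =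
      {C \<in> max_chains M k. chain_alternating lab e C}" for e
  proof -
    have "C \<subseteq> grid M (Suc k) \<and> (\<forall>z\<in>C. z k = 0) \<longleftrightarrow> C \<subseteq> grid M k" for C
    proof -
      have "z \<in> grid M (Suc k) \<and> z k = 0 \<longleftrightarrow> z \<in> grid M k" for z
        unfolding grid_def mem_Collect_eq
        by (metis Suc_leI Suc_leD le_eq_less_or_eq less_Suc_eq zero_le)
      then show ?thesis by blast
    qed
    then show ?thesis
      by (auto simp: facet_chains_def max_chains_def face_chain_def)
  qed
  \<comment> \<open>The sides \<open>j < k\<close> contribute an even number. On the last pair of
    facets the gluing is antipodal, so positive alternation on top corresponds to negative
    alternation at the bottom. Together the two facets count the maximal chains of
    \<open>grid M k\<close> that alternate with either starting sign, an odd number by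
    induction.\<close>
  have top: "card (G k (2 * M)) = card {C \<in> max_chains M k. chain_alternating lab (-1) C}"
    unfolding Geq bottom[symmetric]
  proof (rule flipG[of k "{k}" "-1"])
    fix z assume "z \<in> grid M (Suc k)" "z k \<in> {0, 2 * M}"
    then show "lab (flip M {k} z) = - 1 * lab z"
      using anti[of z k] gK kK by (auto simp: grid_def)
  qed auto
  have G0: "G k 0 = {C \<in> max_chains M k. chain_alternating lab 1 C}"
    unfolding Geq bottom ..
  have "card (\<Union>j<Suc k. G j 0 \<union> G j (2 * M)) = (\<Sum>j<Suc k. card (G j 0 \<union> G j (2 * M)))"
    by (rule card_UN_disjoint) (use finG uniq in blast)+
  also have "\<dots> = (\<Sum>j<Suc k. card (G j 0) + card (G j (2 * M)))"
    by (intro sum.cong refl card_Un_disjoint finG disj)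
  also have "\<dots> = (\<Sum>j<k. 2 * card (G j 0)) + (card (G k 0) + card (G k (2 * M)))"
    using sides by (simp add: mult_2)
  finally have "odd (card (\<Union>j<Suc k. G j 0 \<union> G j (2 * M))) \<longleftrightarrow> odd (card (G k 0) + card (G k (2 * M)))"
    by (simp add: sum_distrib_left[symmetric])
  also have "card (G k 0) + card (G k (2 * M)) =
      card {C \<in> max_chains M k. chain_alternating lab 1 C \<or> chain_alternating lab (-1) C}"
  proof -
    have "\<not> (chain_alternating lab 1 C \<and> chain_alternating lab (-1) C)" if "C \<in> max_chains M k" for C
    proof -
      have "finite (lab ` C)" "lab ` C \<noteq> {}"
        using that finite_face_chain by (auto simp: max_chains_def)
      then show ?thesis
        using alternating_sign_unique by (auto simp: chain_alternating_def)
    qed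
    then have "{C \<in> max_chains M k. chain_alternating lab 1 C} \<inter> {C \<in> max_chains M k. chain_alternating lab (-1) C} = {}"
      by blast
    moreover have "{C \<in> max_chains M k. chain_alternating lab 1 C \<or> chain_alternating lab (-1) C} =
       {C \<in> max_chains M k. chain_alternating lab 1 C} \<union> {C \<in> max_chains M k. chain_alternating lab (-1) C}"
      by blast
    ultimately show ?thesis
      unfolding top G0 by (simp add: card_Un_disjoint)
  qed
  finally have "odd (card (\<Union>j<Suc k. G j 0 \<union> G j (2 * M)))"
    using Suc by simp
  then show ?case
    using odd_card_alternating_max_chains[of "Suc k" M lab] \<open>M > 0\<close> nz nc gK bd by simp
qed

text \<open>Of the odd count only the existence of one chain is used: its \<open>Suc K\<close>
  labels are distinct and never opposite, so their absolute values are \<open>Suc K\<close>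
  different elements of \<open>{1..int m}\<close>.\<close>

lemma fan_lemma:
  assumes "M > 0" and nz: "\<And>z. z \<in> grid M K \<Longrightarrow> lab z \<noteq> 0"
    and nc: "\<And>z w. z \<in> grid M K \<Longrightarrow> w \<in> grid M K \<Longrightarrow> face_le z w \<Longrightarrow> lab z \<noteq> - lab w"
    and side: "\<And>z j. z \<in> grid M K \<Longrightarrow> j + 1 < K \<Longrightarrow> z j \<in> {0, 2 * M} \<Longrightarrow> lab (flip M {j, j + 1} z) = lab z"
    and anti: "\<And>z j. z \<in> grid M K \<Longrightarrow> j < K \<Longrightarrow> z j \<in> {0, 2 * M} \<Longrightarrow> (\<forall>i>j. z i = 0) \<Longrightarrow> lab (flip M {j} z) = - lab z"
    and bound: "\<And>z. z \<in> grid M K \<Longrightarrow> \<bar>lab z\<bar> \<le> int m"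
  shows "K < m"
proof -
  have "odd (card {C \<in> max_chains M K. chain_alternating lab 1 C \<or> chain_alternating lab (-1) C})"
    using odd_card_alternating_chains[of M K lab K] assms by blast
  then obtain C where C: "C \<in> max_chains M K" "inj_on lab C"
    by (metis (mono_tags, lifting) card.empty chain_alternating_def empty_Collect_eq even_zero)
  then have sub: "C \<subseteq> grid M K" and card: "card C = Suc K" and cmp: "\<forall>z\<in>C. \<forall>w\<in>C. face_le z w \<or> face_le w z"
    by (auto simp: max_chains_def face_chain_def)
  have "inj_on (\<lambda>c. \<bar>lab c\<bar>) C"
  proof (rule inj_onI)
    fix c d assume cd: "c \<in> C" "d \<in> C" "\<bar>lab c\<bar> = \<bar>lab d\<bar>"
    have "lab c \<noteq> - lab d"
      using cmp cd sub nc[of c d] nc[of d c] by fastforce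
    then show "c = d"
      using cd C(2) by (auto simp: abs_eq_iff inj_on_def)
  qed
  moreover have "(\<lambda>c. \<bar>lab c\<bar>) ` C \<subseteq> {1..int m}"
    using sub nz bound by force
  ultimately have "card C \<le> card {1..int m}"
    by (intro card_inj_on_le) auto
  then show ?thesis
    using card by simp
qed

section \<open>Antipodal labellings of spheres\<close>

text \<open>Iterated spherical coordinates, with all angles ranging over \<open>[0, \<pi>]\<close>; the gluing of the cube
  in \<open>odd_card_alternating_chains\<close> is the one induced by this map.\<close>

primrec sphere_point :: "nat \<Rightarrow> (nat \<Rightarrow> 'a::real_normed_vector) \<Rightarrow> nat \<Rightarrow> (nat \<Rightarrow> nat) \<Rightarrow> 'a" where
  "sphere_point M b 0 z = b 0"
| "sphere_point M b (Suc j) z = cos (pi * z j / (2 * M)) *\<^sub>R sphere_point M b j z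
     + sin (pi * z j / (2 * M)) *\<^sub>R b (Suc j)"

text \<open>The image of the Euclidean unit sphere of coefficient vectors, which provides an
  antipodal sphere in any normed space. There are \<open>k + 1\<close> vectors, so \<open>k\<close>
  is the dimension of the sphere.\<close>

definition coord_sphere :: "(nat \<Rightarrow> 'a::real_normed_vector) \<Rightarrow> nat \<Rightarrow> 'a set" where
  "coord_sphere b k = {\<Sum>i\<le>k. c i *\<^sub>R b i |c. (\<Sum>i\<le>k. (c i)\<^sup>2) = 1}"

lemma sphere_point_in_coord_sphere: "sphere_point M b k z \<in> coord_sphere b k"
proof (induction k)
  case 0
  show ?case
    unfolding coord_sphere_def by (intro CollectI exI[of _ "\<lambda>i. 1"]) simp
next
  case (Suc k)
  then obtain c where c: "sphere_point M b k z = (\<Sum>i\<le>k. c i *\<^sub>R b i)" "(\<Sum>i\<le>k. (c i)\<^sup>2) = 1"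
    by (auto simp: coord_sphere_def)
  define x where "x = pi * z k / (2 * M)"
  define d where "d = (\<lambda>i. if i \<le> k then cos x * c i else sin x)"
  have "sphere_point M b (Suc k) z = (\<Sum>i\<le>Suc k. d i *\<^sub>R b i)"
    using c by (simp add: d_def x_def scaleR_sum_right)
  moreover have "(\<Sum>i\<le>Suc k. (d i)\<^sup>2) = 1"
  proof -
    have "(\<Sum>i\<le>k. (d i)\<^sup>2) = (cos x)\<^sup>2 * (\<Sum>i\<le>k. (c i)\<^sup>2)"
      by (simp add: d_def power_mult_distrib sum_distrib_left)
    then show ?thesis
      using c by (simp add: d_def)
  qed
  ultimately show ?case
    unfolding coord_sphere_def by (intro CollectI exI[of _ d] conjI)
qed

lemma norm_sphere_point_le: "norm (sphere_point M b k z) \<le> (\<Sum>i\<le>k. norm (b i))"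
proof (induction k)
  case (Suc k)
  have "norm (sphere_point M b (Suc k) z) \<le> 1 * norm (sphere_point M b k z) + 1 * norm (b (Suc k))"
    unfolding sphere_point.simps
    by (rule norm_triangle_le, unfold norm_scaleR) (intro add_mono mult_right_mono; simp)
  then show ?case
    using Suc by simp
qed simp

lemma abs_cos_diff_le: "\<bar>cos x - cos y\<bar> \<le> \<bar>x - y\<bar>" for x y :: real
proof -
  have "norm (cos x - cos y) \<le> 1 * norm (x - y)"
    by (rule field_differentiable_bound[of UNIV _ "\<lambda>x. - sin x"]) (auto intro!: derivative_eq_intros)
  then show ?thesis by simp
qed

lemma abs_sin_diff_le: "\<bar>sin x - sin y\<bar> \<le> \<bar>x - y\<bar>" for x y :: real
proof -
  have "norm (sin x - sin y) \<le> 1 * norm (x - y)"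
    by (rule field_differentiable_bound[of UNIV _ cos]) (auto intro!: derivative_eq_intros)
  then show ?thesis by simp
qed

lemma dist_sphere_point_face_le:
  assumes "M > 0" "face_le z w"
  shows "norm (sphere_point M b k z - sphere_point M b k w) \<le> k * (pi / (2 * M)) * (\<Sum>i\<le>k. norm (b i))"
proof (induction k)
  case (Suc k)
  define x where "x = pi * z k / (2 * M)"
  define y where "y = pi * w k / (2 * M)"
  define h where "h = pi / (2 * M)"
  define s where "s = (\<Sum>i\<le>k. norm (b i))"
  have "\<bar>real (z k) - real (w k)\<bar> \<le> 1"
    using face_le_dist[OF assms(2), of k] by linarith
  moreover have "x - y = h * (real (z k) - real (w k))"
    by (simp add: x_def y_def h_def diff_divide_distrib algebra_simps)
  moreover have "h \<ge> 0" by (simp add: h_def)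
  ultimately have xy: "\<bar>x - y\<bar> \<le> h"
    by (simp add: abs_mult mult_left_le)
  have eq: "sphere_point M b (Suc k) z - sphere_point M b (Suc k) w =
     (cos x - cos y) *\<^sub>R sphere_point M b k z + cos y *\<^sub>R (sphere_point M b k z - sphere_point M b k w)
     + (sin x - sin y) *\<^sub>R b (Suc k)"
    by (simp add: x_def y_def algebra_simps)
  have "norm ((cos x - cos y) *\<^sub>R sphere_point M b k z) \<le> h * s"
    unfolding norm_scaleR s_def
    using order_trans[OF abs_cos_diff_le xy] norm_sphere_point_le \<open>h \<ge> 0\<close> by (intro mult_mono) auto
  moreover have "norm (cos y *\<^sub>R (sphere_point M b k z - sphere_point M b k w)) \<le> 1 * (k * h * s)"
    unfolding norm_scaleR
    using Suc.IH by (intro mult_mono) (auto simp: h_def s_def)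
  moreover have "norm ((sin x - sin y) *\<^sub>R b (Suc k)) \<le> h * norm (b (Suc k))"
    unfolding norm_scaleR
    using order_trans[OF abs_sin_diff_le xy] by (intro mult_right_mono) auto
  ultimately have "norm (sphere_point M b (Suc k) z - sphere_point M b (Suc k) w) \<le> h * s + k * h * s + h * norm (b (Suc k))"
    unfolding eq by (intro norm_triangle_le) (smt (verit) norm_triangle_ineq)
  also have "\<dots> \<le> Suc k * h * (s + norm (b (Suc k)))"
    using \<open>h \<ge> 0\<close> by (simp add: algebra_simps)
  finally show ?case
    by (simp add: h_def s_def)
qed simp

lemma sphere_point_cong: "(\<And>i. i < k \<Longrightarrow> z i = w i) \<Longrightarrow> sphere_point M b k z = sphere_point M b k w"
  by (induction k) auto

lemma cos_flip: "M > 0 \<Longrightarrow> t \<le> 2 * M \<Longrightarrow> cos (pi * real (2 * M - t) / (2 * M)) = - cos (pi * t / (2 * M))"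
  and sin_flip: "M > 0 \<Longrightarrow> t \<le> 2 * M \<Longrightarrow> sin (pi * real (2 * M - t) / (2 * M)) = sin (pi * t / (2 * M))"
proof -
  assume "M > 0" "t \<le> 2 * M"
  then have "pi * real (2 * M - t) / (2 * M) = pi - pi * t / (2 * M)"
    by (simp add: of_nat_diff field_simps)
  then show "cos (pi * real (2 * M - t) / (2 * M)) = - cos (pi * t / (2 * M))"
    "sin (pi * real (2 * M - t) / (2 * M)) = sin (pi * t / (2 * M))"
    by simp_all
qed

lemma sin_grid_boundary: "M > 0 \<Longrightarrow> t \<in> {0, 2 * M} \<Longrightarrow> sin (pi * real t / (2 * M)) = 0"
  by auto

lemma sphere_point_flip_last:
  assumes "M > 0" "z \<in> grid M K" "j < K" "z j \<in> {0, 2 * M}" "j \<in> J" "J \<inter> {..<j} = {}"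
  shows "sphere_point M b (Suc j) (flip M J z) = - sphere_point M b (Suc j) z"
proof -
  have "z j \<le> 2 * M" using assms by auto
  moreover have "sphere_point M b j (flip M J z) = sphere_point M b j z"
    using assms(6) by (intro sphere_point_cong) (auto simp: flip_def)
  ultimately show ?thesis
    using assms cos_flip[of M "z j"] sin_flip[of M "z j"] sin_grid_boundary[of M "z j"]
    by (simp add: flip_def)
qed

text \<open>Flipping coordinate \<open>j\<close> replaces the partial point by its antipode;
  flipping \<open>j + 1\<close> replaces the next angle by its supplement and so reverses the cosine
  in front of that point. The two signs cancel.\<close>

lemma sphere_point_flip_side:
  assumes "M > 0" "z \<in> grid M K" "j + 1 < K" "z j \<in> {0, 2 * M}"
  shows "sphere_point M b K (flip M {j, j + 1} z) = sphere_point M b K z"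
proof -
  have "sphere_point M b (j + 2 + m) (flip M {j, j + 1} z) = sphere_point M b (j + 2 + m) z" for m
  proof (induction m)
    case 0
    have "sphere_point M b (Suc j) (flip M {j, j + 1} z) = - sphere_point M b (Suc j) z"
      using assms by (intro sphere_point_flip_last) auto
    moreover have "z (Suc j) \<le> 2 * M"
      using assms by (auto simp: grid_def)
    moreover have "sphere_point M b (Suc (Suc j)) (flip M {j, j + 1} z) =
      cos (pi * real (2 * M - z (Suc j)) / (2 * M)) *\<^sub>R sphere_point M b (Suc j) (flip M {j, j + 1} z)
       + sin (pi * real (2 * M - z (Suc j)) / (2 * M)) *\<^sub>R b (Suc (Suc j))"
      unfolding sphere_point.simps(2)[of M b "Suc j"] by (simp add: flip_def del: sphere_point.simps)
    ultimately have "sphere_point M b (Suc (Suc j)) (flip M {j, j + 1} z) = sphere_point M b (Suc (Suc j)) z"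
      unfolding sphere_point.simps(2)[of M b "Suc j" z]
      using assms(1) cos_flip[of M "z (Suc j)"] sin_flip[of M "z (Suc j)"] by (simp del: sphere_point.simps)
    then show ?case by simp
  next
    case (Suc m)
    have "flip M {j, j + 1} z (j + 2 + m) = z (j + 2 + m)"
      by (simp add: flip_def)
    then show ?case
      using Suc by (simp only: add_Suc_right sphere_point.simps)
  qed
  moreover have "j + 2 + (K - (j + 2)) = K"
    using assms(3) by simp
  ultimately show ?thesis
    by metis
qed

lemma sphere_point_flip_antipodal:
  assumes "M > 0" "z \<in> grid M K" "j < K" "z j \<in> {0, 2 * M}" "\<forall>i>j. z i = 0"
  shows "sphere_point M b K (flip M {j} z) = - sphere_point M b K z"
proof -
  have "sphere_point M b (Suc j + m) (flip M {j} z) = - sphere_point M b (Suc j + m) z" for m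
  proof (induction m)
    case 0
    then show ?case
      using sphere_point_flip_last[OF assms(1-4), of "{j}" b] by simp
  next
    case (Suc m)
    have "flip M {j} z (Suc j + m) = 0" "z (Suc j + m) = 0"
      using assms(5) by (auto simp: flip_def)
    then show ?case
      using Suc by (simp only: add_Suc_right sphere_point.simps) simp
  qed
  from this[of "K - Suc j"] show ?thesis
    using assms(3) by simp
qed

text \<open>The Lyusternik-Shnirel'man theorem in a metric form: a uniform separation takes the
  place of closedness of the sets. The label of \<open>u\<close> is the first index at which
  \<open>u\<close> or \<open>- u\<close> is covered, with a sign telling whether \<open>u\<close>
  itself is; this makes it odd.\<close>

theorem antipodal_cover:
  fixes b :: "nat \<Rightarrow> 'a::real_normed_vector" and A :: "nat \<Rightarrow> 'a \<Rightarrow> bool"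
  assumes cover: "\<And>u. u \<in> coord_sphere b k \<Longrightarrow> \<exists>l<n. A l u"
    and "\<delta> > 0"
    and sep: "\<And>u v l. u \<in> coord_sphere b k \<Longrightarrow> v \<in> coord_sphere b k \<Longrightarrow> l < n \<Longrightarrow> dist u v < \<delta> \<Longrightarrow>
      A l u \<Longrightarrow> \<not> A l (- v)"
  shows "k < n"
proof -
  let ?S = "coord_sphere b k"
  define m where "m = (\<lambda>u. LEAST l. A l u \<or> A l (- u))"
  define lab where "lab = (\<lambda>u. if A (m u) u then int (m u) + 1 else - (int (m u) + 1))"
  have m: "m u < n" "A (m u) u \<or> A (m u) (- u)" if "u \<in> ?S" for u
  proof -
    obtain l where l: "l < n" "A l u" using cover \<open>u \<in> ?S\<close> by blast
    then have "m u \<le> l" unfolding m_def by (intro Least_le) simp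
    then show "m u < n" using l by simp
    show "A (m u) u \<or> A (m u) (- u)"
      unfolding m_def by (rule LeastI[of _ l]) (use l in simp)
  qed
  have m_minus: "m (- u) = m u" for u
    unfolding m_def by (simp add: disj_commute)
  have lab_minus: "lab (- u) = - lab u" if "u \<in> ?S" for u
  proof -
    have "A (m u) u \<Longrightarrow> \<not> A (m u) (- u)"
      using sep[OF that that m(1)[OF that]] \<open>\<delta> > 0\<close> by simp
    then show ?thesis
      using m(2)[OF that] by (auto simp: lab_def m_minus)
  qed
  have lab_far: "lab u \<noteq> - lab v" if uv: "u \<in> ?S" "v \<in> ?S" "dist u v < \<delta>" for u v
  proof
    assume eq: "lab u = - lab v"
    then have muv: "m u = m v"
      by (auto simp: lab_def split: if_splits)
    have "A (m u) u \<and> \<not> A (m v) v \<or> \<not> A (m u) u \<and> A (m v) v"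
      using eq by (auto simp: lab_def split: if_splits)
    then have "A (m u) u \<and> A (m u) (- v) \<or> A (m u) (- u) \<and> A (m u) v"
      using m(2)[OF uv(1)] m(2)[OF uv(2)] muv by auto
    then show False
      using sep[OF uv(1,2) m(1)[OF uv(1)]] sep[OF uv(2,1) m(1)[OF uv(1)]] uv(3) by (auto simp: dist_commute)
  qed
  define C where "C = k * pi * (\<Sum>i\<le>k. norm (b i))"
  have "C \<ge> 0" by (simp add: C_def sum_nonneg)
  \<comment> \<open>A mesh so fine that comparable faces are mapped to points closer than
    \<open>\<delta>\<close>; \<open>lab_far\<close> then excludes opposite labels on a
    simplex.\<close>
  obtain M :: nat where M: "M > C / \<delta>"
    using reals_Archimedean2 by blast
  then have "real M > 0" using \<open>C \<ge> 0\<close> \<open>\<delta> > 0\<close> by (meson divide_nonneg_pos le_less_trans)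
  then have "M > 0" by simp
  have close: "dist (sphere_point M b k z) (sphere_point M b k w) < \<delta>" if "face_le z w" for z w
  proof -
    have "dist (sphere_point M b k z) (sphere_point M b k w) \<le> C / (2 * M)"
      using dist_sphere_point_face_le[OF \<open>M > 0\<close> that, of b k] by (simp add: dist_norm C_def)
    also have "\<dots> \<le> C / M"
      using \<open>C \<ge> 0\<close> \<open>M > 0\<close> by (intro divide_left_mono) auto
    also have "\<dots> < \<delta>"
      using M \<open>real M > 0\<close> \<open>\<delta> > 0\<close> by (simp add: field_simps)
    finally show ?thesis .
  qed
  have inS: "sphere_point M b k z \<in> ?S" for z
    by (rule sphere_point_in_coord_sphere)
  show ?thesis
  proof (rule fan_lemma[OF \<open>M > 0\<close>, of k "\<lambda>z. lab (sphere_point M b k z)"])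
    fix z assume z: "z \<in> grid M k"
    show "lab (sphere_point M b k z) \<noteq> 0"
      by (auto simp: lab_def)
    show "\<bar>lab (sphere_point M b k z)\<bar> \<le> int n"
      using m(1)[OF inS[of z]] by (auto simp: lab_def)
    {
      fix w assume "face_le z w"
      then show "lab (sphere_point M b k z) \<noteq> - lab (sphere_point M b k w)"
        by (intro lab_far inS close)
    }
    {
      fix j assume "j + 1 < k" "z j \<in> {0, 2 * M}"
      then show "lab (sphere_point M b k (flip M {j, j + 1} z)) = lab (sphere_point M b k z)"
        using sphere_point_flip_side[OF \<open>M > 0\<close> z, of j b] by simp
    }
    {
      fix j assume "j < k" "z j \<in> {0, 2 * M}" "\<forall>i>j. z i = 0"
      then show "lab (sphere_point M b k (flip M {j} z)) = - lab (sphere_point M b k z)"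
        using sphere_point_flip_antipodal[OF \<open>M > 0\<close> z, of j b] lab_minus[OF inS] by simp
    }
  qed
qed

section \<open>A Clark-type argument without a gradient flow\<close>

text \<open>A Palais-Smale condition in disguise: if \<open>u n - K (u n)\<close> tends to 0, a
  subsequence of \<open>K (u n)\<close> converges in the compact set \<open>C\<close>, hence
  \<open>u n\<close> converges along it too, and the limit would be a fixed point in
  \<open>A\<close>.\<close>

lemma compact_perturbation_gap:
  fixes K :: "'a::real_normed_vector \<Rightarrow> 'a"
  assumes "closed A" "A \<subseteq> X" "continuous_on X K" "compact C" "K ` X \<subseteq> C"
    and "\<And>u. u \<in> A \<Longrightarrow> K u \<noteq> u"
  shows "\<exists>\<sigma>>0. \<forall>u\<in>A. \<sigma> \<le> norm (u - K u)"
proof (rule ccontr)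
  assume "\<not> ?thesis"
  then have "\<forall>n. \<exists>u\<in>A. norm (u - K u) < 1 / Suc n"
    by (metis not_le of_nat_0_less_iff zero_less_Suc zero_less_divide_1_iff)
  then obtain u where u: "\<And>n. u n \<in> A" "\<And>n. norm (u n - K (u n)) < 1 / Suc n"
    by metis
  have "\<forall>n. K (u n) \<in> C"
    using u assms by blast
  then obtain w r where w: "w \<in> C" "strict_mono r" "((\<lambda>n. K (u n)) \<circ> r) \<longlonglongrightarrow> w"
    using \<open>compact C\<close> unfolding compact_def by metis
  have "(\<lambda>n. u n - K (u n)) \<longlonglongrightarrow> 0"
    by (rule Lim_null_comparison[OF _ LIMSEQ_inverse_real_of_nat])
       (use u(2) in \<open>auto simp: inverse_eq_divide intro!: always_eventually less_imp_le\<close>)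
  then have "(\<lambda>n. u (r n) - K (u (r n))) \<longlonglongrightarrow> 0"
    using LIMSEQ_subseq_LIMSEQ[OF _ w(2)] by (auto simp: o_def)
  from tendsto_add[OF this w(3)[unfolded o_def]] have ul: "(\<lambda>n. u (r n)) \<longlonglongrightarrow> w"
    by simp
  have "w \<in> A"
    by (rule closed_sequentially[OF \<open>closed A\<close> _ ul]) (use u in auto)
  have "(\<lambda>n. K (u (r n))) \<longlonglongrightarrow> K w"
    by (rule continuous_on_tendsto_compose[OF assms(3) ul]) (use u \<open>w \<in> A\<close> assms(2) in \<open>auto intro!: always_eventually\<close>)
  then have "K w = w"
    using LIMSEQ_unique w(3) by (auto simp: o_def)
  then show False
    using assms(6) \<open>w \<in> A\<close> by blast
qed

text \<open>As long as \<open>g\<close> stays above \<open>c\<close>, a step of length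
  \<open>\<tau> * g j\<close> costs at least \<open>a * c\<close> times its length, and at least
  \<open>a * \<tau> * c\<^sup>2\<close>. The first bound pays for distance and does not involve the
  step size, the second pays for time.\<close>

lemma path_drop:
  fixes u :: "nat \<Rightarrow> 'a::real_normed_vector" and f g :: "nat \<Rightarrow> real"
  assumes "p \<le> q" "a > 0" "\<tau> > 0"
    and dec: "\<And>j. f (Suc j) \<le> f j - a * \<tau> * (g j)\<^sup>2"
    and step: "\<And>j. norm (u (Suc j) - u j) = \<tau> * g j"
    and low: "\<And>j. p \<le> j \<Longrightarrow> j < q \<Longrightarrow> c \<le> g j" and "c > 0"
  shows "a * c * norm (u q - u p) \<le> f p - f q" "real (q - p) * (a * \<tau> * c\<^sup>2) \<le> f p - f q"
  using \<open>p \<le> q\<close> low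
proof (induction q rule: dec_induct)
  case base
  {
    case 1 then show ?case by simp
  next
    case 2 then show ?case by simp
  }
next
  case (step n)
  have gn: "c \<le> g n" if "\<And>j. p \<le> j \<Longrightarrow> j < Suc n \<Longrightarrow> c \<le> g j"
    using that step by auto
  {
    case 1
    have "a * c * norm (u (Suc n) - u p) \<le> a * c * (norm (u n - u p) + norm (u (Suc n) - u n))"
      using assms(2,7) norm_triangle_ineq[of "u n - u p" "u (Suc n) - u n"] by (intro mult_left_mono) auto
    also have "\<dots> = a * c * norm (u n - u p) + a * \<tau> * (c * g n)"
      by (simp add: assms(5) algebra_simps)
    also have "a * \<tau> * (c * g n) \<le> a * \<tau> * (g n)\<^sup>2"
      using gn[OF 1] assms(2,3,7) by (simp add: power2_eq_square mult_left_mono mult_right_mono)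
    finally show ?case
      using step.IH(1) 1 dec[of n] by fastforce
  next
    case 2
    have "c\<^sup>2 \<le> (g n)\<^sup>2"
      using gn[OF 2] assms(7) by (simp add: power_mono)
    then have "a * \<tau> * c\<^sup>2 \<le> a * \<tau> * (g n)\<^sup>2"
      using assms(2,3) by simp
    moreover have "real (n - p) * (a * \<tau> * c\<^sup>2) \<le> f p - f n"
      using step.IH(2) 2 by auto
    moreover have "real (Suc n - p) * (a * \<tau> * c\<^sup>2) = real (n - p) * (a * \<tau> * c\<^sup>2) + a * \<tau> * c\<^sup>2"
      using step(1) by (simp add: Suc_diff_le algebra_simps)
    ultimately show ?case
      using dec[of n] by linarith
  }
qed

text \<open>The dichotomy for one time window \<open>{s..e}\<close>: either it is spent outside the small balls around \<open>F\<close>,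
  where \<open>f\<close> drops at a definite rate, or the orbit crosses an annulus after its last visit.\<close>

lemma window_drop:
  fixes u :: "nat \<Rightarrow> 'a::real_normed_vector" and f g :: "nat \<Rightarrow> real"
  assumes pos: "a > 0" "\<tau> > 0" "\<sigma> > 0" "\<sigma>\<^sub>0 > 0" "\<eta> > 0"
    and dec: "\<And>j. f (Suc j) \<le> f j - a * \<tau> * (g j)\<^sup>2"
    and step: "\<And>j. norm (u (Suc j) - u j) = \<tau> * g j"
    and small: "\<And>j. \<tau> * g j \<le> \<eta> / 2"
    and far: "\<And>j. s \<le> j \<Longrightarrow> j < e \<Longrightarrow> u j \<notin> (\<Union>v\<in>F. ball v \<eta>) \<Longrightarrow> \<sigma> \<le> g j"
    and annulus: "\<And>j. u j \<in> (\<Union>v\<in>F. ball v (2 * \<eta>)) \<Longrightarrow> u j \<notin> (\<Union>v\<in>F. ball v \<eta>) \<Longrightarrow> \<sigma>\<^sub>0 \<le> g j"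
    and "s \<le> e" and long: "a * \<sigma>\<^sub>0 * \<eta> / 2 \<le> real (e - s) * (a * \<tau> * \<sigma>\<^sup>2)"
    and out: "u e \<notin> (\<Union>v\<in>F. ball v (2 * \<eta>))"
  shows "a * \<sigma>\<^sub>0 * \<eta> / 2 \<le> f s - f e"
proof -
  let ?N1 = "\<Union>v\<in>F. ball v \<eta>" and ?N2 = "\<Union>v\<in>F. ball v (2 * \<eta>)"
  have f_Suc: "f (Suc j) \<le> f j" for j
    using dec[of j] pos by (smt (verit) mult_nonneg_nonneg zero_le_power2)
  have mono: "f j \<le> f i" if "i \<le> j" for i j
    using lift_Suc_antimono_le[of f, OF f_Suc that] .
  have N12: "?N1 \<subseteq> ?N2"
    using pos by (auto intro: less_trans)
  show ?thesis
  proof (cases "\<exists>j. s \<le> j \<and> j < e \<and> u j \<in> ?N1")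
    case False
    then show ?thesis
      using long path_drop(2)[of s e a \<tau> f g u \<sigma>, OF \<open>s \<le> e\<close> pos(1,2) dec step _ pos(3)] far
      by (metis (no_types, lifting) order_trans)
  next
    case True
    define j0 where "j0 = Max {j. s \<le> j \<and> j < e \<and> u j \<in> ?N1}"
    have fin: "finite {j. s \<le> j \<and> j < e \<and> u j \<in> ?N1}"
      by simp
    have j0: "s \<le> j0" "j0 < e" "u j0 \<in> ?N1"
      using Max_in[OF fin] True unfolding j0_def by blast+
    have j0max: "u j \<notin> ?N1" if "j0 < j" "j < e" for j
    proof
      assume "u j \<in> ?N1"
      then have "j \<le> j0"
        unfolding j0_def using that j0 by (intro Max_ge[OF fin]) auto
      then show False using that by simp
    qed
    define j1 where "j1 = (LEAST j. j0 < j \<and> u j \<notin> ?N2)"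
    have "j0 < e \<and> u e \<notin> ?N2" using j0 out by simp
    then have j1: "j0 < j1" "u j1 \<notin> ?N2" "j1 \<le> e"
      using LeastI[of "\<lambda>j. j0 < j \<and> u j \<notin> ?N2" e] Least_le[of "\<lambda>j. j0 < j \<and> u j \<notin> ?N2" e]
      unfolding j1_def by blast+
    have j1min: "u j \<in> ?N2" if "j0 < j" "j < j1" for j
      using not_less_Least[of j "\<lambda>j. j0 < j \<and> u j \<notin> ?N2"] that unfolding j1_def by blast
    obtain v where v: "v \<in> F" "dist v (u j0) < \<eta>"
      using j0(3) by auto
    have "dist v (u j1) \<ge> 2 * \<eta>"
      using j1(2) v(1) by auto
    \<comment> \<open>At \<open>j0\<close> the orbit is still in a small ball, where no lower bound
      on \<open>g\<close> is available. The distance is therefore counted from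
      \<open>Suc j0\<close>, and the step in between uses up at most half of the width
      \<open>\<eta>\<close> of the annulus.\<close>
    moreover have "dist (u j0) (u (Suc j0)) \<le> \<eta> / 2"
      using step[of j0] small[of j0] by (simp add: dist_norm norm_minus_commute)
    moreover have "dist v (u j1) \<le> dist v (u j0) + dist (u j0) (u (Suc j0)) + dist (u (Suc j0)) (u j1)"
      by (metis add.assoc add_left_mono dist_triangle order_trans)
    ultimately have "\<eta> / 2 \<le> norm (u j1 - u (Suc j0))"
      using v(2) by (simp add: dist_norm norm_minus_commute)
    then have "a * \<sigma>\<^sub>0 * (\<eta> / 2) \<le> a * \<sigma>\<^sub>0 * norm (u j1 - u (Suc j0))"
      using pos by (intro mult_left_mono) auto
    also have "\<dots> \<le> f (Suc j0) - f j1"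
    proof (rule path_drop(1)[of _ _ a \<tau> f g u])
      fix j assume "Suc j0 \<le> j" "j < j1"
      then show "\<sigma>\<^sub>0 \<le> g j"
        using annulus j1min j0max j1(3) by auto
    qed (use pos dec step j1 in auto)
    also have "\<dots> \<le> f s - f e"
      using mono[of s "Suc j0"] mono[of j1 e] j0 j1 by simp
    finally show ?thesis by simp
  qed
qed

definition euler_step :: "('a::real_normed_vector \<Rightarrow> 'a) \<Rightarrow> real \<Rightarrow> 'a \<Rightarrow> 'a" where
  "euler_step K \<tau> u = (1 - \<tau>) *\<^sub>R u + \<tau> *\<^sub>R K u"

text \<open>The argument is a chain of choices. First \<eta>, the finite set \<open>F\<close>,
  \<open>\<sigma>\<^sub>0\<close>, \<delta> and the number \<open>W\<close> of windows, which depend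
  on the fixed points and on \<open>B\<close>; they determine the dimension \<open>W * m\<close> of
  the sphere. Then \<epsilon>, \<open>r\<close>, \<sigma>, the duration \<Theta> of a window, the
  error \<open>E\<close> and last the step size. The set \<open>X\<close> is closed, as compactness
  arguments for fixed points demand, while \<Phi> is only controlled on the invariant set
  \<open>D\<close>, which need not be closed.\<close>

theorem clark_contradiction:
  fixes K :: "'a::real_normed_vector \<Rightarrow> 'a" and \<Phi> :: "'a \<Rightarrow> real" and X D C :: "'a set"
  assumes X: "closed X" "\<And>u. u \<in> X \<Longrightarrow> - u \<in> X"
    and C: "compact C" "K ` X \<subseteq> C"
    and uc: "uniformly_continuous_on X K"
    and K_odd: "\<And>u. u \<in> X \<Longrightarrow> K (- u) = - K u"
    and D: "D \<subseteq> X" "bounded D"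
    and D_step: "\<And>u \<tau>. u \<in> D \<Longrightarrow> 0 \<le> \<tau> \<Longrightarrow> \<tau> \<le> 1 \<Longrightarrow> euler_step K \<tau> u \<in> D"
    and a: "a > 0"
    and descent: "\<And>E. E > 0 \<Longrightarrow> \<exists>\<tau>\<^sub>0>0. \<forall>\<tau> u. 0 < \<tau> \<longrightarrow> \<tau> < \<tau>\<^sub>0 \<longrightarrow> u \<in> D \<longrightarrow>
      \<Phi> (euler_step K \<tau> u) \<le> \<Phi> u - a * \<tau> * (norm (u - K u))\<^sup>2 + \<tau> * E"
    and lower: "\<And>u. u \<in> D \<Longrightarrow> - B \<le> \<Phi> u"
    and lsc: "\<And>\<epsilon>. \<epsilon> > 0 \<Longrightarrow> \<exists>r>0. \<forall>u\<in>D. norm u < r \<longrightarrow> - \<epsilon> \<le> \<Phi> u"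
    and \<rho>: "\<rho> > 0" "\<And>u. u \<in> X \<Longrightarrow> K u = u \<Longrightarrow> u = 0 \<or> \<rho> \<le> norm u"
    and spheres: "\<And>k. \<exists>b \<epsilon>. \<epsilon> > 0 \<and> (\<forall>u\<in>coord_sphere b k. u \<in> D \<and> \<Phi> u \<le> - \<epsilon>)"
  shows False
proof -
  have K_cont: "continuous_on X K"
    using uc by (rule uniformly_continuous_imp_continuous)
  \<comment> \<open>With one eighth the balls of radius \<open>2 * \<eta>\<close> stay outside the
    ball of radius \<open>\<rho> / 2\<close>, and the final estimate
    \<open>2 * \<eta> + 2 * \<eta> + \<rho> < 2 * \<rho>\<close> holds.\<close>
  define \<eta> where "\<eta> = \<rho> / 8"
  have \<eta>: "\<eta> > 0" using \<rho> by (simp add: \<eta>_def)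
  define Fix where "Fix = {u \<in> X. K u = u \<and> \<rho> \<le> norm u}"
  have "closed {u \<in> X. K u - u \<in> {0}}"
    using continuous_closed_preimage[OF continuous_on_diff[OF K_cont continuous_on_id] X(1), of "{0}"]
    by (simp add: vimage_def Int_def)
  moreover have "closed {u::'a. \<rho> \<le> norm u}"
    by (intro closed_Collect_le continuous_intros)
  moreover have "Fix = C \<inter> ({u \<in> X. K u - u \<in> {0}} \<inter> {u. \<rho> \<le> norm u})"
  proof -
    have "u \<in> C" if "u \<in> X" "K u = u" for u
      using C(2) that by (metis image_subset_iff)
    then show ?thesis
      by (auto simp: Fix_def)
  qed
  ultimately have "compact Fix"
    using compact_Int_closed[OF C(1) closed_Int] by simp
  moreover have "Fix \<subseteq> (\<Union>v\<in>Fix. ball v \<eta>)"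
    by (rule subsetI, rule UN_I, assumption) (simp add: \<eta>)
  ultimately obtain F where F: "F \<subseteq> Fix" "finite F" "Fix \<subseteq> (\<Union>v\<in>F. ball v \<eta>)"
    by (rule compactE_image[OF _ open_ball])
  have F_norm: "\<rho> \<le> norm v" if "v \<in> F" for v
    using F(1) that by (auto simp: Fix_def)
  let ?N1 = "\<Union>v\<in>F. ball v \<eta>" and ?N2 = "\<Union>v\<in>F. ball v (2 * \<eta>)"
  have gap: "\<exists>\<sigma>>0. \<forall>u\<in>X. r \<le> norm u \<longrightarrow> u \<notin> ?N1 \<longrightarrow> \<sigma> \<le> norm (u - K u)" if "r > 0" for r
  proof -
    have "\<exists>\<sigma>>0. \<forall>u\<in>X \<inter> {u. r \<le> norm u} \<inter> - ?N1. \<sigma> \<le> norm (u - K u)"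
    proof (rule compact_perturbation_gap[OF _ _ K_cont C])
      have "closed {u::'a. r \<le> norm u}"
        by (intro closed_Collect_le continuous_intros)
      then show "closed (X \<inter> {u. r \<le> norm u} \<inter> - ?N1)"
        using X(1) by (intro closed_Int closed_Compl open_UN) auto
      show "K u \<noteq> u" if u: "u \<in> X \<inter> {u. r \<le> norm u} \<inter> - ?N1" for u
      proof
        assume "K u = u"
        then have "\<rho> \<le> norm u"
          using \<rho>(2)[of u] u \<open>r > 0\<close> by auto
        then have "u \<in> Fix"
          using u \<open>K u = u\<close> by (simp add: Fix_def)
        then show False
          using u F(3) by blast
      qed
    qed auto
    then show ?thesis by auto
  qed
  obtain \<sigma>\<^sub>0 where \<sigma>\<^sub>0: "\<sigma>\<^sub>0 > 0" "\<And>u. u \<in> X \<Longrightarrow> \<rho> / 2 \<le> norm u \<Longrightarrow> u \<notin> ?N1 \<Longrightarrow> \<sigma>\<^sub>0 \<le> norm (u - K u)"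
    using gap[of "\<rho> / 2"] \<rho>(1) by auto
  define \<delta> where "\<delta> = a * \<sigma>\<^sub>0 * \<eta> / 2"
  have \<delta>: "\<delta> > 0" using a \<sigma>\<^sub>0 \<eta> by (simp add: \<delta>_def)
  \<comment> \<open>\<open>B\<close> bounds the total descent from a negative level; the additional
    1 pays for the accumulated Euler error.\<close>
  obtain W :: nat where W: "real W * \<delta> > B + 1"
    using reals_Archimedean3[OF \<delta>] by blast
  define m where "m = card F"
  obtain b \<epsilon> where \<epsilon>: "\<epsilon> > 0" and sphere: "\<And>u. u \<in> coord_sphere b (W * m) \<Longrightarrow> u \<in> D"
    "\<And>u. u \<in> coord_sphere b (W * m) \<Longrightarrow> \<Phi> u \<le> - \<epsilon>"
    using spheres[of "W * m"] by blast
  \<comment> \<open>During the \<open>W\<close> windows an orbit from the sphere keeps \<Phi> below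
    \<open>- (\<epsilon> / 2)\<close>, so it cannot enter the ball of radius \<open>r\<close>;
    \<open>\<sigma>\<close> bounds the residual from below outside this ball and the small
    balls.\<close>
  obtain r where r: "r > 0" "\<And>u. u \<in> D \<Longrightarrow> norm u < r \<Longrightarrow> - (\<epsilon> / 2) \<le> \<Phi> u"
    using lsc[of "\<epsilon> / 2"] \<epsilon> by auto
  obtain \<sigma> where \<sigma>: "\<sigma> > 0" "\<And>u. u \<in> X \<Longrightarrow> r \<le> norm u \<Longrightarrow> u \<notin> ?N1 \<Longrightarrow> \<sigma> \<le> norm (u - K u)"
    using gap[OF r(1)] by auto
  define \<Theta> where "\<Theta> = \<delta> / (a * \<sigma>\<^sup>2)"
  have \<Theta>: "\<Theta> > 0" using \<delta> a \<sigma> by (simp add: \<Theta>_def)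
  \<comment> \<open>Over the total time \<open>W * \<Theta>\<close> the error stays below 1, as
    reserved in the choice of \<open>W\<close>, and below \<open>\<epsilon> / 2\<close>, as needed
    to keep away from 0.\<close>
  define E where "E = min 1 (\<epsilon> / 2) / (W * \<Theta> + 1)"
  have WT: "W * \<Theta> + 1 > 0" using \<Theta> by (simp add: add_nonneg_pos)
  have E: "E > 0" using \<epsilon> WT by (simp add: E_def)
  have WE: "W * \<Theta> * E < min 1 (\<epsilon> / 2)"
  proof -
    have "W * \<Theta> * E < (W * \<Theta> + 1) * E" using E by simp
    also have "\<dots> = min 1 (\<epsilon> / 2)" using WT by (simp add: E_def)
    finally show ?thesis .
  qed
  obtain \<tau>\<^sub>0 where \<tau>\<^sub>0: "\<tau>\<^sub>0 > 0" "\<And>\<tau> u. 0 < \<tau> \<Longrightarrow> \<tau> < \<tau>\<^sub>0 \<Longrightarrow> u \<in> D \<Longrightarrow>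
      \<Phi> (euler_step K \<tau> u) \<le> \<Phi> u - a * \<tau> * (norm (u - K u))\<^sup>2 + \<tau> * E"
    using descent[OF E] by blast
  have "bounded (D \<union> C)"
    using D(2) C(1) by (simp add: compact_imp_bounded)
  then obtain R0 where R0: "\<And>u. u \<in> D \<union> C \<Longrightarrow> norm u \<le> R0"
    by (auto simp: bounded_iff)
  define R where "R = 2 * \<bar>R0\<bar> + 1"
  have R: "R > 0" by (simp add: R_def)
  have norm_R: "norm (u - K u) \<le> R" if "u \<in> D" for u
  proof -
    have "norm u \<le> R0" "norm (K u) \<le> R0"
      using that D(1) C(2) R0 by blast+
    then show ?thesis
      using norm_triangle_ineq4[of u "K u"] by (simp add: R_def)
  qed
  \<comment> \<open>The number of steps per window. The three summands give
    \<open>\<tau> < \<tau>\<^sub>0\<close>, \<open>\<tau> \<le> 1\<close> and a step length of at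
    most \<open>\<eta> / 2\<close>.\<close>
  obtain P :: nat where "real P > \<Theta> / \<tau>\<^sub>0 + \<Theta> + \<Theta> * R * 2 / \<eta>"
    using reals_Archimedean2 by blast
  moreover have "\<Theta> / \<tau>\<^sub>0 \<ge> 0" "\<Theta> * R * 2 / \<eta> \<ge> 0"
    using \<Theta> \<tau>\<^sub>0(1) R \<eta> by simp_all
  ultimately have P: "real P > \<Theta> / \<tau>\<^sub>0" "real P > \<Theta>" "real P > \<Theta> * R * 2 / \<eta>" "real P > 0"
    using \<Theta> by linarith+
  define \<tau> where "\<tau> = \<Theta> / P"
  have \<tau>: "\<tau> > 0" "\<tau> < \<tau>\<^sub>0" "\<tau> \<le> 1" "\<tau> * R \<le> \<eta> / 2" "P * \<tau> = \<Theta>"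
    using P \<Theta> \<tau>\<^sub>0(1) \<eta> by (simp_all add: \<tau>_def field_simps)
  define S where "S = euler_step K \<tau>"
  have S_D: "(S ^^ j) u \<in> D" if "u \<in> D" for j u
    using that D_step \<tau> by (induction j) (auto simp: S_def)
  have reach: "\<exists>w<W. (S ^^ (Suc w * P)) u0 \<in> ?N2" if u0: "u0 \<in> coord_sphere b (W * m)" for u0
  proof (rule ccontr)
    assume contra: "\<not> (\<exists>w<W. (S ^^ (Suc w * P)) u0 \<in> ?N2)"
    define u where "u = (\<lambda>j. (S ^^ j) u0)"
    define g where "g = (\<lambda>j. norm (u j - K (u j)))"
    \<comment> \<open>Subtracting the errors accumulated so far makes the values of \<Phi> along the
      orbit decreasing.\<close>
    define f where "f = (\<lambda>j. \<Phi> (u j) - j * (\<tau> * E))"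
    have uD: "u j \<in> D" for j
      using S_D sphere(1)[OF u0] by (simp add: u_def)
    have uSuc: "u (Suc j) = euler_step K \<tau> (u j)" for j
      by (simp add: u_def S_def)
    have dec: "f (Suc j) \<le> f j - a * \<tau> * (g j)\<^sup>2" for j
      using \<tau>\<^sub>0(2)[OF \<tau>(1,2) uD, of j] by (simp add: f_def g_def uSuc algebra_simps)
    have step: "norm (u (Suc j) - u j) = \<tau> * g j" for j
    proof -
      have "u (Suc j) - u j = (- \<tau>) *\<^sub>R (u j - K (u j))"
        by (simp add: uSuc euler_step_def algebra_simps)
      then show ?thesis
        using \<tau>(1) by (simp add: g_def)
    qed
    have small: "\<tau> * g j \<le> \<eta> / 2" for j
    proof -
      have "\<tau> * g j \<le> \<tau> * R"
        using norm_R[OF uD] \<tau>(1) by (simp add: g_def)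
      then show ?thesis using \<tau>(4) by simp
    qed
    have f_Suc: "f (Suc j) \<le> f j" for j
      using dec[of j] a \<tau>(1) by (smt (verit) mult_nonneg_nonneg zero_le_power2)
    have f_le: "f j \<le> - \<epsilon>" for j
      using lift_Suc_antimono_le[of f 0 j, OF f_Suc] sphere(2)[OF u0] by (simp add: f_def u_def)
    have time: "j * (\<tau> * E) \<le> W * \<Theta> * E" if "j \<le> W * P" for j
    proof -
      have "real j * (\<tau> * E) \<le> real (W * P) * (\<tau> * E)"
        using that \<tau>(1) E by (intro mult_right_mono) (simp_all only: of_nat_le_iff, simp)
      also have "\<dots> = W * (P * \<tau>) * E" by (simp add: mult_ac)
      finally show ?thesis using \<tau>(5) by simp
    qed
    have big: "r \<le> norm (u j)" if "j \<le> W * P" for j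
    proof (rule ccontr)
      assume "\<not> r \<le> norm (u j)"
      then have "- (\<epsilon> / 2) \<le> \<Phi> (u j)"
        using r(2)[OF uD] by simp
      moreover have "\<Phi> (u j) \<le> - \<epsilon> + W * \<Theta> * E"
        using f_le[of j] time[OF that] by (simp add: f_def)
      ultimately show False
        using WE by simp
    qed
    have drop: "\<delta> \<le> f (w * P) - f (Suc w * P)" if "w < W" for w
      unfolding \<delta>_def
    proof (rule window_drop[of a \<tau> \<sigma> _ _ f g u _ _ F])
      fix j assume j: "w * P \<le> j" "j < Suc w * P" "u j \<notin> ?N1"
      have "Suc w * P \<le> W * P"
        using that by (intro mult_right_mono) auto
      then show "\<sigma> \<le> g j"
        using \<sigma>(2)[of "u j"] big[of j] j uD[of j] D(1) by (auto simp: g_def)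
    next
      fix j assume j: "u j \<in> ?N2" "u j \<notin> ?N1"
      then obtain v where v: "v \<in> F" "dist v (u j) < 2 * \<eta>"
        by auto
      have "norm v \<le> norm (u j) + dist v (u j)"
        by (metis add.commute dist_norm norm_triangle_sub)
      then have "\<rho> / 2 \<le> norm (u j)"
        using F_norm[OF v(1)] v(2) \<rho>(1) by (simp add: \<eta>_def)
      then show "\<sigma>\<^sub>0 \<le> g j"
        using \<sigma>\<^sub>0(2)[of "u j"] j(2) uD[of j] D(1) by (auto simp: g_def)
    next
      have "real (Suc w * P - w * P) * (a * \<tau> * \<sigma>\<^sup>2) = (P * \<tau>) * (a * \<sigma>\<^sup>2)"
        by simp
      also have "\<dots> = \<delta>"
        using a \<sigma>(1) unfolding \<tau>(5) by (simp add: \<Theta>_def)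
      finally show "a * \<sigma>\<^sub>0 * \<eta> / 2 \<le> real (Suc w * P - w * P) * (a * \<tau> * \<sigma>\<^sup>2)"
        unfolding \<delta>_def by linarith
    next
      show "u (Suc w * P) \<notin> ?N2"
        using contra that unfolding u_def by blast
    qed (use a \<tau> \<sigma> \<sigma>\<^sub>0 \<eta> dec step small in auto)
    have "w * \<delta> \<le> f 0 - f (w * P)" if "w \<le> W" for w
      using that
    proof (induction w)
      case (Suc w)
      then have "w * \<delta> \<le> f 0 - f (w * P)" "w < W" by auto
      then show ?case
        using drop[of w] by (simp add: algebra_simps)
    qed simp
    from this[of W] have "W * \<delta> \<le> f 0 - f (W * P)" by simp
    moreover have "f (W * P) \<ge> - B - 1"
      using lower[OF uD, of "W * P"] time[of "W * P"] WE unfolding f_def by linarith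
    ultimately show False
      using f_le[of 0] \<epsilon> W by linarith
  qed
  \<comment> \<open>With the number of iterations fixed, uniform continuity of \<open>K\<close>
    passes to all the iterates in question; it supplies the separation distance \<open>d\<close> for
    the covering theorem.\<close>
  have S_uc: "\<exists>d>0. \<forall>u\<in>D. \<forall>v\<in>D. dist u v < d \<longrightarrow> dist ((S ^^ j) u) ((S ^^ j) v) < e" if "e > 0" for j e
    using that
  proof (induction j arbitrary: e)
    case 0
    then show ?case by auto
  next
    case (Suc j)
    have "uniformly_continuous_on X S"
      unfolding S_def euler_step_def
      by (intro uniformly_continuous_on_add bounded_linear.uniformly_continuous_on[OF bounded_linear_scaleR_right]
          uniformly_continuous_on_id uc)
    then obtain d where d: "d > 0" "\<And>u v. u \<in> X \<Longrightarrow> v \<in> X \<Longrightarrow> dist u v < d \<Longrightarrow> dist (S u) (S v) < e"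
      unfolding uniformly_continuous_on_def using Suc.prems by metis
    obtain d' where d': "d' > 0" "\<forall>u\<in>D. \<forall>v\<in>D. dist u v < d' \<longrightarrow> dist ((S ^^ j) u) ((S ^^ j) v) < d"
      using Suc.IH[OF d(1)] by blast
    have "dist ((S ^^ Suc j) u) ((S ^^ Suc j) v) < e" if "u \<in> D" "v \<in> D" "dist u v < d'" for u v
      using d(2) d'(2) that S_D D(1) by (simp add: subset_iff)
    then show ?case using d'(1) by blast
  qed
  have S_uc': "\<exists>d>0. \<forall>j\<le>J. \<forall>u\<in>D. \<forall>v\<in>D. dist u v < d \<longrightarrow> dist ((S ^^ j) u) ((S ^^ j) v) < \<rho>" for J
  proof (induction J)
    case 0
    then show ?case using \<rho>(1) by auto
  next
    case (Suc J)
    then obtain d where d: "d > 0" "\<forall>j\<le>J. \<forall>u\<in>D. \<forall>v\<in>D. dist u v < d \<longrightarrow> dist ((S ^^ j) u) ((S ^^ j) v) < \<rho>"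
      by blast
    obtain d' where d': "d' > 0" "\<forall>u\<in>D. \<forall>v\<in>D. dist u v < d' \<longrightarrow> dist ((S ^^ Suc J) u) ((S ^^ Suc J) v) < \<rho>"
      using S_uc[OF \<rho>(1), of "Suc J"] by blast
    show ?case
      using d d' by (intro exI[of _ "min d d'"]) (auto simp: le_Suc_eq simp del: funpow.simps)
  qed
  obtain d where d: "d > 0" "\<And>j u v. j \<le> W * P \<Longrightarrow> u \<in> D \<Longrightarrow> v \<in> D \<Longrightarrow> dist u v < d \<Longrightarrow>
      dist ((S ^^ j) u) ((S ^^ j) v) < \<rho>"
    using S_uc'[of "W * P"] by blast
  have S_odd: "(S ^^ j) (- u) = - (S ^^ j) u" if "u \<in> D" for j u
  proof (induction j)
    case (Suc j)
    have "(S ^^ j) u \<in> X" using S_D[OF that] D(1) by blast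
    then have "S (- (S ^^ j) u) = - S ((S ^^ j) u)"
      by (simp add: S_def euler_step_def K_odd)
    then show ?case
      using Suc by simp
  qed simp
  obtain h where h: "bij_betw h {0..<m} F"
    using ex_bij_betw_nat_finite[OF F(2)] m_def by blast
  have hF: "h i \<in> F" if "i < m" for i
    using h that by (auto simp: bij_betw_def)
  \<comment> \<open>The label \<open>l\<close> encodes a window by \<open>l div m\<close> and a ball
    by \<open>l mod m\<close>; \<open>Suc\<close> appears because the position at the end of the
    window counts.\<close>
  define A where "A = (\<lambda>l u. (S ^^ (Suc (l div m) * P)) u \<in> ball (h (l mod m)) (2 * \<eta>))"
  have "W * m < W * m"
  proof (rule antipodal_cover[of b "W * m" "W * m" A d])
    fix u assume u: "u \<in> coord_sphere b (W * m)"
    obtain w v where w: "w < W" "v \<in> F" "(S ^^ (Suc w * P)) u \<in> ball v (2 * \<eta>)"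
      using reach[OF u] by blast
    then obtain i where i: "i < m" "v = h i"
      using h unfolding bij_betw_def by (metis atLeast0LessThan imageE lessThan_iff)
    have "w * m + i < Suc w * m" using i by simp
    also have "\<dots> \<le> W * m" using w by (intro mult_right_mono) auto
    finally have "w * m + i < W * m" .
    moreover have "A (w * m + i) u"
      using w i by (simp add: A_def)
    ultimately show "\<exists>l<W * m. A l u" by blast
  next
    fix u v l
    assume u: "u \<in> coord_sphere b (W * m)" and v: "v \<in> coord_sphere b (W * m)" and l: "l < W * m"
      and duv: "dist u v < d" and Au: "A l u"
    show "\<not> A l (- v)"
    proof
      assume Av: "A l (- v)"
      have "m > 0" using l by (cases m) auto
      then have hl: "h (l mod m) \<in> F" using hF by simp
      have "l div m < W" using l by (simp add: less_mult_imp_div_less)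
      then have t: "Suc (l div m) * P \<le> W * P" by (intro mult_right_mono) auto
      \<comment> \<open>Close starting points have close end points \<open>x\<close> and
        \<open>y\<close>; if \<open>x\<close> and \<open>- y\<close> were in the same ball, its
        centre would have norm below \<open>\<rho>\<close>.\<close>
      define x where "x = (S ^^ (Suc (l div m) * P)) u"
      define y where "y = (S ^^ (Suc (l div m) * P)) v"
      have "dist x y < \<rho>"
        unfolding x_def y_def using d(2)[OF t] sphere(1) u v duv by blast
      moreover have "norm (h (l mod m) - x) < 2 * \<eta>"
        using Au by (simp add: A_def x_def dist_norm)
      moreover have "norm (h (l mod m) + y) < 2 * \<eta>"
        using Av S_odd[OF sphere(1)[OF v], of "Suc (l div m) * P"] unfolding A_def y_def mem_ball dist_norm by simp
      moreover have "2 * norm (h (l mod m)) = norm ((h (l mod m) - x) + (h (l mod m) + y) + (x - y))"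
        by (simp add: scaleR_2[symmetric])
      moreover have "\<dots> \<le> norm (h (l mod m) - x) + norm (h (l mod m) + y) + norm (x - y)"
        by (rule order_trans[OF norm_triangle_ineq add_right_mono[OF norm_triangle_ineq]])
      ultimately show False
        using F_norm[OF hl] \<rho>(1) by (simp add: dist_norm \<eta>_def)
    qed
  qed (rule d(1))
  then show False by simp
qed

section \<open>The periodic Green operator\<close>

lemma integral_window_has_vector_derivative:
  fixes f :: "real \<Rightarrow> 'a::banach"
  assumes f: "continuous_on UNIV f" and "T \<ge> 0"
  shows "((\<lambda>t. integral {t..t + T} f) has_vector_derivative (f (t + T) - f t)) (at t)"
proof -
  define I where "I = (\<lambda>x. integral {t - 1..x} f)"
  have dI: "(I has_vector_derivative f x) (at x)" if "t - 1 < x" "x < t + T + 2" for x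
  proof -
    have "(I has_vector_derivative f x) (at x within {t - 1..t + T + 2})"
      unfolding I_def
      by (rule integral_has_vector_derivative) (use that f continuous_on_subset in auto)
    then show ?thesis
      using that at_within_Icc_at[of "t - 1" x "t + T + 2"] by simp
  qed
  have "((\<lambda>s. s + T) has_vector_derivative 1) (at t)"
    by (auto intro!: derivative_eq_intros)
  from vector_diff_chain_at[OF this dI[of "t + T"]] have "((\<lambda>s. I (s + T)) has_vector_derivative f (t + T)) (at t)"
    using \<open>T \<ge> 0\<close> by (simp add: o_def)
  then have "((\<lambda>s. I (s + T) - I s) has_vector_derivative f (t + T) - f t) (at t)"
    using has_vector_derivative_diff[OF _ dI[of t]] \<open>T \<ge> 0\<close> by fastforce
  then show ?thesis
  proof (rule has_vector_derivative_transform_within_open[of _ _ _ "ball t 1"])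
    fix s assume "s \<in> ball t 1"
    then have "t - 1 \<le> s" by (auto simp: dist_real_def)
    then show "I (s + T) - I s = integral {s..s + T} f"
      using Henstock_Kurzweil_Integration.integral_combine[of "t - 1" s "s + T" f] \<open>T \<ge> 0\<close>
        integrable_continuous_interval[OF continuous_on_subset[OF f subset_UNIV]]
      by (simp add: I_def algebra_simps)
  qed auto
qed

lemma integral_exp:
  assumes "\<kappa> \<noteq> (0::real)" "T \<ge> 0"
  shows "((\<lambda>s. exp (\<kappa> * s)) has_integral (exp (\<kappa> * T) - 1) / \<kappa>) {0..T}"
proof -
  have "((\<lambda>s. exp (\<kappa> * s)) has_integral exp (\<kappa> * T) / \<kappa> - exp (\<kappa> * 0) / \<kappa>) {0..T}"
    using assms by (intro fundamental_theorem_of_calculus)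
      (auto intro!: derivative_eq_intros simp flip: has_real_derivative_iff_has_vector_derivative)
  then show ?thesis
    by (simp add: diff_divide_distrib)
qed

text \<open>The \<open>T\<close>-periodic solution \<open>w\<close> of \<open>w' = - \<kappa> w + h\<close>.\<close>

definition periodic_resolvent :: "real \<Rightarrow> real \<Rightarrow> (real \<Rightarrow> 'a::euclidean_space) \<Rightarrow> real \<Rightarrow> 'a" where
  "periodic_resolvent T \<kappa> h t =
     (1 / (exp (\<kappa> * T) - 1)) *\<^sub>R integral {0..T} (\<lambda>s. exp (\<kappa> * s) *\<^sub>R h (t + s))"

text \<open>After a shift by \<open>t\<close> the integral runs over a sliding window of length
  \<open>T\<close>, with a factor \<open>exp (- \<kappa> * t)\<close> in front. Differentiating this
  factor yields the term with \<open>- \<kappa>\<close>; the two ends of the window combine to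
  \<open>h t\<close>, by periodicity of \<open>h\<close> and the normalising constant.\<close>

lemma periodic_resolvent_deriv:
  assumes h: "continuous_on UNIV h" "\<And>t. h (t + T) = h t" and "T > 0" "\<kappa> \<noteq> 0"
  shows "(periodic_resolvent T \<kappa> h has_vector_derivative - \<kappa> *\<^sub>R periodic_resolvent T \<kappa> h t + h t) (at t)"
proof -
  define c where "c = 1 / (exp (\<kappa> * T) - 1)"
  have c: "c * (exp (\<kappa> * T) - 1) = 1"
    using \<open>T > 0\<close> \<open>\<kappa> \<noteq> 0\<close> by (simp add: c_def)
  let ?f = "\<lambda>s. exp (\<kappa> * s) *\<^sub>R h s"
  have f: "continuous_on UNIV ?f"
    using h(1) by (intro continuous_intros)
  have eq: "periodic_resolvent T \<kappa> h t = (c * exp (- \<kappa> * t)) *\<^sub>R integral {t..t + T} ?f" for t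
  proof -
    have "integral {t..t + T} ?f = integral {0..T} (\<lambda>s. ?f (s + t))"
      using integral_shift[of 0 t T ?f] continuous_on_subset[OF f subset_UNIV]
      by (simp add: o_def add.commute)
    also have "\<dots> = integral {0..T} (\<lambda>s. exp (\<kappa> * t) *\<^sub>R exp (\<kappa> * s) *\<^sub>R h (t + s))"
      by (simp add: distrib_left exp_add add.commute mult.commute)
    also have "\<dots> = exp (\<kappa> * t) *\<^sub>R integral {0..T} (\<lambda>s. exp (\<kappa> * s) *\<^sub>R h (t + s))"
      by (rule integral_cmul)
    finally show ?thesis
      by (simp add: periodic_resolvent_def c_def flip: exp_add)
  qed
  have "((\<lambda>t. (c * exp (- \<kappa> * t)) *\<^sub>R integral {t..t + T} ?f) has_vector_derivative
     (c * exp (- \<kappa> * t)) *\<^sub>R (?f (t + T) - ?f t) + (- \<kappa> * (c * exp (- \<kappa> * t))) *\<^sub>R integral {t..t + T} ?f) (at t)"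
    using \<open>T > 0\<close>
    by (intro has_vector_derivative_scaleR integral_window_has_vector_derivative f)
       (auto intro!: derivative_eq_intros)
  moreover have "(c * exp (- \<kappa> * t)) *\<^sub>R (?f (t + T) - ?f t) = h t"
  proof -
    have "(c * exp (- \<kappa> * t)) *\<^sub>R (?f (t + T) - ?f t) =
       (c * exp (- \<kappa> * t) * (exp (\<kappa> * (t + T)) - exp (\<kappa> * t))) *\<^sub>R h t"
      using h(2)[of t] by (simp add: algebra_simps)
    also have "c * exp (- \<kappa> * t) * (exp (\<kappa> * (t + T)) - exp (\<kappa> * t)) = c * (exp (\<kappa> * T) - 1)"
      by (simp add: distrib_left exp_add exp_minus field_simps)
    finally show ?thesis using c by simp
  qed
  ultimately show ?thesis
    unfolding eq[abs_def] by (simp add: add.commute)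
qed

lemma periodic_resolvent_periodic:
  assumes "\<And>t. h (t + T) = h t"
  shows "periodic_resolvent T \<kappa> h (t + T) = periodic_resolvent T \<kappa> h t"
proof -
  have "h (t + T + s) = h (t + s)" for s
    using assms[of "t + s"] by (simp add: algebra_simps)
  then show ?thesis by (simp add: periodic_resolvent_def)
qed

lemma integrable_resolvent_kernel:
  fixes h :: "real \<Rightarrow> 'a::euclidean_space"
  assumes "continuous_on UNIV h"
  shows "(\<lambda>s. exp (\<kappa> * s) *\<^sub>R h (t + s)) integrable_on {0..T}"
  by (rule integrable_continuous_interval)
     (intro continuous_intros continuous_on_compose2[OF assms]; simp)

lemma periodic_resolvent_diff:
  assumes "continuous_on UNIV g" "continuous_on UNIV h"
  shows "periodic_resolvent T \<kappa> g t - periodic_resolvent T \<kappa> h t = periodic_resolvent T \<kappa> (\<lambda>s. g s - h s) t"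
proof -
  have "integral {0..T} (\<lambda>s. exp (\<kappa> * s) *\<^sub>R g (t + s)) - integral {0..T} (\<lambda>s. exp (\<kappa> * s) *\<^sub>R h (t + s)) =
      integral {0..T} (\<lambda>s. exp (\<kappa> * s) *\<^sub>R g (t + s) - exp (\<kappa> * s) *\<^sub>R h (t + s))"
    by (rule integral_diff[symmetric]; intro integrable_resolvent_kernel assms)
  then show ?thesis
    by (simp add: periodic_resolvent_def scaleR_diff_right[symmetric])
qed

lemma periodic_resolvent_uminus: "periodic_resolvent T \<kappa> (\<lambda>s. - h s) t = - periodic_resolvent T \<kappa> h t"
  by (simp add: periodic_resolvent_def)

text \<open>The kernel has constant sign and integral \<open>1 / \<kappa>\<close>, hence total mass
  1 when \<open>\<kappa>\<close> is 1 or -1.\<close>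

lemma norm_periodic_resolvent_le:
  assumes "continuous_on UNIV h" "\<And>s. norm (h s) \<le> S" "T > 0" "\<bar>\<kappa>\<bar> = 1"
  shows "norm (periodic_resolvent T \<kappa> h t) \<le> S"
proof -
  have int: "((\<lambda>s. exp (\<kappa> * s) * S) has_integral (exp (\<kappa> * T) - 1) / \<kappa> * S) {0..T}"
    using assms by (intro has_integral_mult_left integral_exp) auto
  have "norm (integral {0..T} (\<lambda>s. exp (\<kappa> * s) *\<^sub>R h (t + s))) \<le> integral {0..T} (\<lambda>s. exp (\<kappa> * s) * S)"
    using assms int by (intro integral_norm_bound_integral integrable_resolvent_kernel) auto
  also have "\<dots> = (exp (\<kappa> * T) - 1) / \<kappa> * S"
    using int by (rule integral_unique)
  finally have le: "norm (integral {0..T} (\<lambda>s. exp (\<kappa> * s) *\<^sub>R h (t + s))) \<le> (exp (\<kappa> * T) - 1) / \<kappa> * S" .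
  have "(exp (\<kappa> * T) - 1) / \<kappa> = \<bar>exp (\<kappa> * T) - 1\<bar>" "\<bar>exp (\<kappa> * T) - 1\<bar> > 0"
    using assms(3,4) by (auto simp: abs_if split: if_splits)
  then show ?thesis
    using le by (simp add: periodic_resolvent_def field_simps)
qed

text \<open>The \<open>T\<close>-periodic solution \<open>w\<close> of \<open>w'' = w - h\<close>, and its derivative.\<close>

definition green :: "real \<Rightarrow> (real \<Rightarrow> 'a::euclidean_space) \<Rightarrow> real \<Rightarrow> 'a" where
  "green T h t = (1 / 2) *\<^sub>R (periodic_resolvent T 1 h t - periodic_resolvent T (-1) h t)"

definition green_deriv :: "real \<Rightarrow> (real \<Rightarrow> 'a::euclidean_space) \<Rightarrow> real \<Rightarrow> 'a" where
  "green_deriv T h t = (1 / 2) *\<^sub>R (- periodic_resolvent T 1 h t - periodic_resolvent T (-1) h t)"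

context
  fixes T :: real and h :: "real \<Rightarrow> 'a::euclidean_space"
  assumes h: "continuous_on UNIV h" "\<And>t. h (t + T) = h t" and T: "T > 0"
begin

text \<open>The inverse of 1 - d^2/dt^2 is half the sum of the inverses of 1 + d/dt and 1 - d/dt;
  these are the resolvent for \<open>\<kappa> = 1\<close> and minus the resolvent for
  \<open>\<kappa> = -1\<close>. In the first derivative the two occurrences of \<open>h\<close>
  cancel.\<close>

lemma green_has_vector_derivative:
  "(green T h has_vector_derivative green_deriv T h t) (at t)"
proof -
  have "((\<lambda>t. (1 / 2) *\<^sub>R (periodic_resolvent T 1 h t - periodic_resolvent T (-1) h t)) has_vector_derivative
     (1 / 2) *\<^sub>R ((- 1 *\<^sub>R periodic_resolvent T 1 h t + h t) - (- (-1) *\<^sub>R periodic_resolvent T (-1) h t + h t))) (at t)"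
    by (intro bounded_linear.has_vector_derivative[OF bounded_linear_scaleR_right] has_vector_derivative_diff
        periodic_resolvent_deriv[OF h T]) auto
  then show ?thesis
    by (simp add: green_def[abs_def] green_deriv_def)
qed

lemma green_deriv_has_vector_derivative:
  "(green_deriv T h has_vector_derivative green T h t - h t) (at t)"
proof -
  have "((\<lambda>t. (1 / 2) *\<^sub>R (- periodic_resolvent T 1 h t - periodic_resolvent T (-1) h t)) has_vector_derivative
     (1 / 2) *\<^sub>R (- (- 1 *\<^sub>R periodic_resolvent T 1 h t + h t) - (- (-1) *\<^sub>R periodic_resolvent T (-1) h t + h t))) (at t)"
    by (intro bounded_linear.has_vector_derivative[OF bounded_linear_scaleR_right] has_vector_derivative_diff
        has_vector_derivative_minus periodic_resolvent_deriv[OF h T]) auto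
  moreover have "(1 / 2) *\<^sub>R (- (- 1 *\<^sub>R periodic_resolvent T 1 h t + h t) - (- (-1) *\<^sub>R periodic_resolvent T (-1) h t + h t))
     = green T h t - h t"
    unfolding green_def by (simp add: algebra_simps flip: scaleR_2)
  ultimately show ?thesis
    by (simp add: green_deriv_def[abs_def])
qed

lemma green_periodic: "green T h (t + T) = green T h t"
  by (simp add: green_def periodic_resolvent_periodic[where h = h, OF h(2)])

lemma green_deriv_periodic: "green_deriv T h (t + T) = green_deriv T h t"
  by (simp add: green_deriv_def periodic_resolvent_periodic[where h = h, OF h(2)])

lemma norm_green_le:
  assumes "\<And>s. norm (h s) \<le> S"
  shows "norm (green T h t) \<le> S" "norm (green_deriv T h t) \<le> S"
proof -
  have "norm (periodic_resolvent T 1 h t) \<le> S" "norm (periodic_resolvent T (-1) h t) \<le> S"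
    using norm_periodic_resolvent_le[OF h(1) assms T] by auto
  then show "norm (green T h t) \<le> S" "norm (green_deriv T h t) \<le> S"
    using norm_triangle_ineq4[of "periodic_resolvent T 1 h t" "periodic_resolvent T (-1) h t"]
      norm_triangle_ineq4[of "- periodic_resolvent T 1 h t" "periodic_resolvent T (-1) h t"]
    by (auto simp: green_def green_deriv_def)
qed

lemma green_lipschitz:
  assumes "\<And>s. norm (h s) \<le> S"
  shows "norm (green T h s - green T h t) \<le> S * \<bar>s - t\<bar>"
proof -
  have "norm (green T h s - green T h t) \<le> S * norm (s - t)"
  proof (rule differentiable_bound[of UNIV _ "\<lambda>x d. d *\<^sub>R green_deriv T h x"])
    fix x
    show "(green T h has_derivative (\<lambda>d. d *\<^sub>R green_deriv T h x)) (at x within UNIV)"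
      using green_has_vector_derivative by (simp add: has_vector_derivative_def)
    show "onorm (\<lambda>d. d *\<^sub>R green_deriv T h x) \<le> S"
      using norm_green_le(2)[OF assms] onorm_scaleR_left[OF bounded_linear_ident, of "green_deriv T h x"]
      by (simp add: onorm_id)
  qed auto
  then show ?thesis by simp
qed

end

lemma green_diff:
  assumes "continuous_on UNIV g" "continuous_on UNIV h"
  shows "green T g t - green T h t = green T (\<lambda>s. g s - h s) t"
  unfolding green_def periodic_resolvent_diff[OF assms, symmetric] by (simp add: algebra_simps)

lemma green_uminus: "green T (\<lambda>s. - h s) t = - green T h t"
  by (simp add: green_def periodic_resolvent_uminus algebra_simps)

section \<open>Periodic functions in the sup norm and their compact subsets\<close>

definition periodic_bcontfuns :: "real \<Rightarrow> (real \<Rightarrow>\<^sub>C 'a::real_normed_vector) set" where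
  "periodic_bcontfuns T = {u. \<forall>t. apply_bcontfun u (t + T) = apply_bcontfun u t}"

lemma apply_bcontfun_tendsto: "(f \<longlongrightarrow> l) F \<Longrightarrow> ((\<lambda>n. apply_bcontfun (f n) x) \<longlongrightarrow> apply_bcontfun l x) F"
  using tendsto_bcontfun_uniform_limit tendsto_uniform_limitI by (metis UNIV_I)

lemma closed_periodic_bcontfuns: "closed (periodic_bcontfuns T)"
  unfolding closed_sequential_limits
proof (intro allI impI, elim conjE)
  fix u l assume u: "\<forall>n. u n \<in> periodic_bcontfuns T" and ul: "u \<longlonglongrightarrow> l"
  have "apply_bcontfun l (t + T) = apply_bcontfun l t" for t
    using LIMSEQ_unique[OF apply_bcontfun_tendsto[OF ul, of "t + T"]] apply_bcontfun_tendsto[OF ul, of t] u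
    by (simp add: periodic_bcontfuns_def)
  then show "l \<in> periodic_bcontfuns T"
    by (simp add: periodic_bcontfuns_def)
qed

lemma periodic_shift_int:
  fixes f :: "real \<Rightarrow> 'a"
  assumes "\<And>t. f (t + T) = f t"
  shows "f (t + of_int n * T) = f t"
proof (induction n rule: int_induct[where k = 0])
  case base then show ?case by simp
next
  case (step1 i)
  then show ?case using assms[of "t + of_int i * T"] by (simp add: algebra_simps)
next
  case (step2 i)
  then show ?case using assms[of "t + of_int (i - 1) * T"] by (simp add: algebra_simps)
qed

text \<open>The codomain is arbitrary, so that a pair of periodic functions can be moved to the same
  point of a period.\<close>

lemma periodic_reduce:
  fixes f :: "real \<Rightarrow> 'a"
  assumes "\<And>t. f (t + T) = f t" "T > 0"
  shows "\<exists>s\<in>{0..T}. \<exists>n::int. s = t + of_int n * T \<and> f s = f t"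
proof -
  define n where "n = - \<lfloor>t / T\<rfloor>"
  have "of_int \<lfloor>t / T\<rfloor> \<le> t / T" "t / T < of_int \<lfloor>t / T\<rfloor> + 1"
    by linarith+
  then have "of_int \<lfloor>t / T\<rfloor> * T \<le> t" "t \<le> (of_int \<lfloor>t / T\<rfloor> + 1) * T"
    using pos_le_divide_eq[OF assms(2)] pos_divide_less_eq[OF assms(2)] less_imp_le by blast+
  then have "t + of_int n * T \<in> {0..T}"
    by (simp add: n_def algebra_simps)
  then show ?thesis
    using periodic_shift_int[of f T t n, OF assms(1)] by blast
qed

text \<open>One constant serves as bound and as Lipschitz constant, since a sup bound on
  \<open>h\<close> is also one for \<open>green T h\<close> and for its derivative.\<close>

definition periodic_lipschitz :: "real \<Rightarrow> real \<Rightarrow> (real \<Rightarrow>\<^sub>C 'a::real_normed_vector) set" where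
  "periodic_lipschitz T C = {u \<in> periodic_bcontfuns T. (\<forall>t. norm (apply_bcontfun u t) \<le> C) \<and>
    (\<forall>s t. norm (apply_bcontfun u s - apply_bcontfun u t) \<le> C * \<bar>s - t\<bar>)}"

lemma periodic_bcontfuns_dist_le:
  assumes "T > 0" "u \<in> periodic_bcontfuns T" "v \<in> periodic_bcontfuns T"
    and "\<And>t. t \<in> {0..T} \<Longrightarrow> dist (apply_bcontfun u t) (apply_bcontfun v t) \<le> e"
  shows "dist u v \<le> e"
proof (rule dist_bound)
  fix t
  obtain s where "s \<in> {0..T}" "(apply_bcontfun u s, apply_bcontfun v s) = (apply_bcontfun u t, apply_bcontfun v t)"
    using periodic_reduce[of "\<lambda>t. (apply_bcontfun u t, apply_bcontfun v t)" T t] assms(1-3)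
    by (auto simp: periodic_bcontfuns_def)
  then show "dist (apply_bcontfun u t) (apply_bcontfun v t) \<le> e"
    using assms(4)[of s] by simp
qed

lemma closed_periodic_lipschitz: "closed (periodic_lipschitz T C)"
  unfolding closed_sequential_limits
proof (intro allI impI, elim conjE)
  fix u l assume u: "\<forall>n. u n \<in> periodic_lipschitz T C" and ul: "u \<longlonglongrightarrow> l"
  have "l \<in> periodic_bcontfuns T"
    by (rule closed_sequentially[OF closed_periodic_bcontfuns _ ul]) (use u in \<open>auto simp: periodic_lipschitz_def\<close>)
  moreover have "norm (apply_bcontfun l t) \<le> C" for t
    by (rule LIMSEQ_le_const2[OF tendsto_norm[OF apply_bcontfun_tendsto[OF ul, of t]]])
       (use u in \<open>auto simp: periodic_lipschitz_def\<close>)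
  moreover have "norm (apply_bcontfun l s - apply_bcontfun l t) \<le> C * \<bar>s - t\<bar>" for s t
    by (rule LIMSEQ_le_const2[OF tendsto_norm[OF tendsto_diff[OF apply_bcontfun_tendsto[OF ul, of s] apply_bcontfun_tendsto[OF ul, of t]]]])
       (use u in \<open>auto simp: periodic_lipschitz_def\<close>)
  ultimately show "l \<in> periodic_lipschitz T C"
    by (simp add: periodic_lipschitz_def)
qed

lemma compact_periodic_lipschitz:
  assumes T: "T > 0"
  shows "compact (periodic_lipschitz T C :: (real \<Rightarrow>\<^sub>C 'a::euclidean_space) set)"
  unfolding compact_def
proof (intro allI impI)
  fix U :: "nat \<Rightarrow> (real \<Rightarrow>\<^sub>C 'a)" assume U: "\<forall>n. U n \<in> periodic_lipschitz T C"
  obtain g k where k: "strict_mono (k :: nat \<Rightarrow> nat)"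
    and g: "\<And>e. 0 < e \<Longrightarrow> \<exists>N. \<forall>n x. n \<ge> N \<and> x \<in> {0..T} \<longrightarrow> norm (apply_bcontfun (U (k n)) x - g x) < e"
  proof (rule Arzela_Ascoli[of "{0..T}" "\<lambda>n. apply_bcontfun (U n)" C])
    show "norm (apply_bcontfun (U n) x) \<le> C" for n x
      using U by (simp add: periodic_lipschitz_def)
    show "\<exists>d>0. \<forall>n y. y \<in> {0..T} \<and> norm (x - y) < d \<longrightarrow> norm (apply_bcontfun (U n) x - apply_bcontfun (U n) y) < e"
      if "e > 0" for x e
    proof (intro exI[of _ "e / (\<bar>C\<bar> + 1)"] conjI allI impI)
      fix n y assume y: "y \<in> {0..T} \<and> norm (x - y) < e / (\<bar>C\<bar> + 1)"
      have "norm (apply_bcontfun (U n) x - apply_bcontfun (U n) y) \<le> C * \<bar>x - y\<bar>"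
        using U by (simp add: periodic_lipschitz_def)
      also have "\<dots> \<le> (\<bar>C\<bar> + 1) * \<bar>x - y\<bar>"
        by (intro mult_right_mono) auto
      also have "\<dots> < e"
        using y by (simp add: field_simps)
      finally show "norm (apply_bcontfun (U n) x - apply_bcontfun (U n) y) < e" .
    qed (use that in simp)
  qed auto
  \<comment> \<open>Uniform convergence on one period makes the subsequence Cauchy in the sup norm;
    the limit then comes from completeness, which avoids a periodic extension of
    \<open>g\<close>.\<close>
  have "Cauchy (U \<circ> k)"
  proof (rule metric_CauchyI)
    fix e :: real assume "e > 0"
    then obtain N where N: "\<And>n x. n \<ge> N \<Longrightarrow> x \<in> {0..T} \<Longrightarrow> norm (apply_bcontfun (U (k n)) x - g x) < e / 3"
      using g[of "e / 3"] by auto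
    have "dist (U (k m)) (U (k n)) < e" if mn: "m \<ge> N" "n \<ge> N" for m n
    proof -
      have "dist (U (k m)) (U (k n)) \<le> 2 * (e / 3)"
      proof (rule periodic_bcontfuns_dist_le[OF T])
        fix t assume t: "t \<in> {0..T}"
        have "dist (apply_bcontfun (U (k m)) t) (apply_bcontfun (U (k n)) t) \<le>
            dist (apply_bcontfun (U (k m)) t) (g t) + dist (apply_bcontfun (U (k n)) t) (g t)"
          by (rule dist_triangle2)
        then show "dist (apply_bcontfun (U (k m)) t) (apply_bcontfun (U (k n)) t) \<le> 2 * (e / 3)"
          using N[OF mn(1) t] N[OF mn(2) t] by (simp add: dist_norm)
      qed (use U in \<open>auto simp: periodic_lipschitz_def\<close>)
      then show ?thesis using \<open>e > 0\<close> by simp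
    qed
    then show "\<exists>M. \<forall>m\<ge>M. \<forall>n\<ge>M. dist ((U \<circ> k) m) ((U \<circ> k) n) < e"
      by auto
  qed
  then obtain l where l: "(U \<circ> k) \<longlonglongrightarrow> l"
    using Cauchy_convergent convergentD by blast
  have "l \<in> periodic_lipschitz T C"
    by (rule closed_sequentially[OF closed_periodic_lipschitz _ l]) (use U in auto)
  then show "\<exists>l\<in>periodic_lipschitz T C. \<exists>r. strict_mono r \<and> (U \<circ> r) \<longlonglongrightarrow> l"
    using k l by blast
qed

section \<open>The functional of the truncated problem\<close>

text \<open>The derivative of \<open>(norm (g t))\<^sup>2\<close> is dominated by the energy
  density, so its values at two points of a period differ by at most the energy. Averaging over one
  of the points bounds the maximum by the mean plus the energy, whence the constant
  \<open>1 + 1 / T\<close>.\<close>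

lemma sobolev_bound:
  fixes g :: "real \<Rightarrow> 'a::euclidean_space"
  assumes T: "T > 0" and per: "\<And>t. g (t + T) = g t"
    and g': "\<And>t. (g has_vector_derivative g' t) (at t)" "continuous_on UNIV g'"
  shows "(norm (g t))\<^sup>2 \<le> (1 + 1 / T) * integral {0..T} (\<lambda>t. (norm (g' t))\<^sup>2 + (norm (g t))\<^sup>2)"
proof -
  have g: "continuous_on UNIV g"
    using g'(1) by (intro continuous_at_imp_continuous_on ballI) (meson has_vector_derivative_continuous)
  define e where "e = (\<lambda>t. (norm (g' t))\<^sup>2 + (norm (g t))\<^sup>2)"
  have int: "f integrable_on {a..b}" if "continuous_on UNIV f" for f :: "real \<Rightarrow> real" and a b
    using that continuous_on_subset by (blast intro: integrable_continuous_interval)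
  have e: "continuous_on UNIV e"
    unfolding e_def by (intro continuous_intros g g')
  have n2: "((\<lambda>t. (norm (g t))\<^sup>2) has_vector_derivative 2 * (g t \<bullet> g' t)) (at t)" for t
    using has_derivative_inner[OF g'(1)[of t, unfolded has_vector_derivative_def] g'(1)[of t, unfolded has_vector_derivative_def]]
    unfolding has_vector_derivative_def power2_norm_eq_inner
    by (rule has_derivative_eq_rhs) (auto simp: fun_eq_iff inner_commute)
  have le_e: "2 * (g t \<bullet> g' t) \<le> e t" "- (2 * (g t \<bullet> g' t)) \<le> e t" for t
  proof -
    have "\<bar>g t \<bullet> g' t\<bar> \<le> norm (g t) * norm (g' t)"
      by (rule Cauchy_Schwarz_ineq2)
    then show "2 * (g t \<bullet> g' t) \<le> e t" "- (2 * (g t \<bullet> g' t)) \<le> e t"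
      using sum_squares_bound[of "norm (g t)" "norm (g' t)"] by (auto simp: e_def)
  qed
  have step: "\<bar>(norm (g y))\<^sup>2 - (norm (g x))\<^sup>2\<bar> \<le> integral {0..T} e" if "0 \<le> x" "y \<le> T" "x \<le> y" for x y
  proof -
    have 1: "((\<lambda>t. 2 * (g t \<bullet> g' t)) has_integral (norm (g y))\<^sup>2 - (norm (g x))\<^sup>2) {x..y}"
      using that n2 by (intro fundamental_theorem_of_calculus) (auto intro: has_vector_derivative_at_within)
    have 2: "(e has_integral integral {x..y} e) {x..y}"
      by (intro integrable_integral int e)
    have "(norm (g y))\<^sup>2 - (norm (g x))\<^sup>2 \<le> integral {x..y} e"
      by (rule has_integral_le[OF 1 2 le_e(1)])
    moreover have "- ((norm (g y))\<^sup>2 - (norm (g x))\<^sup>2) \<le> integral {x..y} e"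
      by (rule has_integral_le[OF has_integral_neg[OF 1] 2 le_e(2)])
    moreover have "integral {x..y} e \<le> integral {0..T} e"
      using that by (intro integral_subset_le int e) (auto simp: e_def)
    ultimately show ?thesis by linarith
  qed
  have all: "(norm (g y))\<^sup>2 \<le> (norm (g x))\<^sup>2 + integral {0..T} e" if "x \<in> {0..T}" "y \<in> {0..T}" for x y
    using step[of x y] step[of y x] that by (cases "x \<le> y") auto
  obtain s where s: "s \<in> {0..T}" "g s = g t"
    using periodic_reduce[of g T t] per T by auto
  have "T * (norm (g s))\<^sup>2 = integral {0..T} (\<lambda>x. (norm (g s))\<^sup>2)"
    using T by simp
  also have "\<dots> \<le> integral {0..T} (\<lambda>x. (norm (g x))\<^sup>2 + integral {0..T} e)"
    by (rule integral_le; (intro int continuous_intros g)?) (rule all[OF _ s(1)])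
  also have "\<dots> = integral {0..T} (\<lambda>x. (norm (g x))\<^sup>2) + T * integral {0..T} e"
    using T by (subst integral_add) (auto intro!: int continuous_intros g)
  also have "integral {0..T} (\<lambda>x. (norm (g x))\<^sup>2) \<le> integral {0..T} e"
    by (intro integral_le int e continuous_intros g) (simp add: e_def)
  finally have "T * (norm (g s))\<^sup>2 \<le> integral {0..T} e + T * integral {0..T} e"
    by simp
  then have "(norm (g s))\<^sup>2 \<le> (1 + 1 / T) * integral {0..T} e"
    using T by (simp add: field_simps)
  then show ?thesis
    using s by (simp add: e_def)
qed


section \<open>Orthogonality of the cosines over a period\<close>

lemma has_integral_cos_period:
  assumes "T > 0" "n \<noteq> (0::int)"
  shows "((\<lambda>t. cos (2 * pi * of_int n * t / T)) has_integral 0) {0..T}"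
proof -
  define w where "w = 2 * pi * of_int n / T"
  have w: "w \<noteq> 0" using assms by (simp add: w_def)
  have "((\<lambda>t. cos (w * t)) has_integral sin (w * T) / w - sin (w * 0) / w) {0..T}"
    using assms w by (intro fundamental_theorem_of_calculus)
      (auto intro!: derivative_eq_intros simp flip: has_real_derivative_iff_has_vector_derivative)
  moreover have "sin (w * T) = 0"
    using assms sin_int_2pin[of n] by (simp add: w_def mult.assoc)
  ultimately show ?thesis
    by (simp add: w_def)
qed

text \<open>Starting with \<open>Suc i\<close> leaves out the constant mode; all the cosines then
  have the same square integral \<open>T / 2\<close>, and the mean square is constant on the
  coordinate sphere.\<close>

definition freq :: "real \<Rightarrow> nat \<Rightarrow> real" where
  "freq T i = 2 * pi * real (Suc i) / T"

lemma has_integral_cos_cos: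
  assumes "T > 0"
  shows "((\<lambda>t. cos (freq T i * t) * cos (freq T j * t)) has_integral (if i = j then T / 2 else 0)) {0..T}"
proof -
  have eq: "cos (freq T i * t) * cos (freq T j * t) =
      (1 / 2) * (cos (2 * pi * of_int (int i - int j) * t / T) + cos (2 * pi * of_int (int i + int j + 2) * t / T))" for t
  proof -
    have "2 * pi * of_int (int i - int j) * t / T = freq T i * t - freq T j * t"
      "2 * pi * of_int (int i + int j + 2) * t / T = freq T i * t + freq T j * t"
      by (simp_all add: freq_def algebra_simps add_divide_distrib diff_divide_distrib)
    then show ?thesis
      by (simp add: cos_times_cos)
  qed
  have 1: "((\<lambda>t. cos (2 * pi * of_int (int i + int j + 2) * t / T)) has_integral 0) {0..T}"
    using assms by (intro has_integral_cos_period) auto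
  have 2: "((\<lambda>t. cos (2 * pi * of_int (int i - int j) * t / T)) has_integral (if i = j then T else 0)) {0..T}"
  proof (cases "i = j")
    case True
    then show ?thesis
      using assms has_integral_const_real[of "1::real" 0 T] by simp
  next
    case False
    then show ?thesis
      using has_integral_cos_period[OF assms, of "int i - int j"] by simp
  qed
  show ?thesis
    unfolding eq using has_integral_mult_right[OF has_integral_add[OF 2 1], of "1 / 2"] by (simp split: if_splits)
qed

lemma has_integral_cos_sum_square:
  assumes "T > 0"
  shows "((\<lambda>t. (\<Sum>i\<le>k. c i * cos (freq T i * t))\<^sup>2) has_integral T / 2 * (\<Sum>i\<le>k. (c i)\<^sup>2)) {0..T}"
proof -
  have "((\<lambda>t. \<Sum>i\<le>k. \<Sum>j\<le>k. (c i * c j) * (cos (freq T i * t) * cos (freq T j * t))) has_integral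
     (\<Sum>i\<le>k. \<Sum>j\<le>k. (c i * c j) * (if i = j then T / 2 else 0))) {0..T}"
    by (intro has_integral_sum has_integral_mult_right has_integral_cos_cos assms) auto
  moreover have "(\<Sum>i\<le>k. \<Sum>j\<le>k. (c i * c j) * (if i = j then T / 2 else 0)) = T / 2 * (\<Sum>i\<le>k. (c i)\<^sup>2)"
  proof -
    have "(\<Sum>j\<le>k. (c i * c j) * (if i = j then T / 2 else 0)) = T / 2 * (c i)\<^sup>2" if "i \<le> k" for i
    proof -
      have "(\<Sum>j\<le>k. (c i * c j) * (if i = j then T / 2 else 0)) = (\<Sum>j\<le>k. if i = j then T / 2 * (c i)\<^sup>2 else 0)"
        by (intro sum.cong refl) (auto simp: power2_eq_square)
      then show ?thesis using that by simp
    qed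
    then show ?thesis
      unfolding sum_distrib_left by (intro sum.cong) auto
  qed
  moreover have "(\<lambda>t. (\<Sum>i\<le>k. c i * cos (freq T i * t))\<^sup>2) =
      (\<lambda>t. \<Sum>i\<le>k. \<Sum>j\<le>k. (c i * c j) * (cos (freq T i * t) * cos (freq T j * t)))"
    by (simp add: power2_eq_square sum_product mult_ac)
  ultimately show ?thesis by simp
qed

text \<open>The interface between the cutoff and the variational argument. \<open>p_uc\<close> is
  uniform in time and space, which makes the step size of the descent independent of
  \<open>u\<close>; \<open>Q_super\<close> refers to one period, where the integrals are
  taken.\<close>

locale truncated_problem =
  fixes T C B :: real and Q :: "real \<Rightarrow> 'a::euclidean_space \<Rightarrow> real" and p :: "real \<Rightarrow> 'a \<Rightarrow> 'a"
  assumes T: "T > 0"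
    and p_cont: "continuous_on UNIV (\<lambda>(t, x). p t x)"
    and Q_cont: "continuous_on UNIV (\<lambda>(t, x). Q t x)"
    and Q_deriv: "\<And>t x. (Q t has_derivative (\<lambda>h. p t x \<bullet> h)) (at x)"
    and p_periodic: "\<And>t x. p (t + T) x = p t x"
    and p_bound: "\<And>t x. norm (p t x) \<le> C"
    and Q_bound: "\<And>t x. Q t x \<le> B"
    and p_odd: "\<And>t x. p t (- x) = - p t x"
    and Q_0: "\<And>t. Q t 0 = 0"
    and Q_super: "\<And>M. \<exists>r>0. \<forall>t\<in>{0..T}. \<forall>x. norm x < r \<longrightarrow> M * (norm x)\<^sup>2 \<le> Q t x"
    and p_uc: "\<And>e. e > 0 \<Longrightarrow> \<exists>d>0. \<forall>t x y. norm (x - y) < d \<longrightarrow> norm (p t x - p t y) < e"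
begin

abbreviation X :: "(real \<Rightarrow>\<^sub>C 'a) set" where "X \<equiv> periodic_bcontfuns T"

definition nemytskii :: "(real \<Rightarrow>\<^sub>C 'a) \<Rightarrow> real \<Rightarrow> 'a" where
  "nemytskii u s = p s (apply_bcontfun u s)"

definition green_op :: "(real \<Rightarrow>\<^sub>C 'a) \<Rightarrow> (real \<Rightarrow>\<^sub>C 'a)" where
  "green_op u = Bcontfun (green T (nemytskii u))"

definition C1_deriv :: "(real \<Rightarrow>\<^sub>C 'a) \<Rightarrow> (real \<Rightarrow> 'a) \<Rightarrow> bool" where
  "C1_deriv u v \<longleftrightarrow> continuous_on UNIV v \<and> (\<forall>t. (apply_bcontfun u has_vector_derivative v t) (at t))"

text \<open>As \<open>green_op\<close> takes values of norm at most \<open>C\<close>, the ball of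
  radius \<open>C + 1\<close> is invariant under Euler steps by convexity, and it contains all
  functions of norm at most 1, as the spheres require. Differentiability gives \<Phi> its meaning,
  but is not a closed condition in the sup norm; hence the distinction between \<open>D\<close> and
  \<open>X\<close>.\<close>

definition D :: "(real \<Rightarrow>\<^sub>C 'a) set" where
  "D = {u \<in> X. norm u \<le> C + 1 \<and> (\<exists>v. C1_deriv u v)}"

definition lagrangian :: "(real \<Rightarrow> 'a) \<Rightarrow> (real \<Rightarrow> 'a) \<Rightarrow> real \<Rightarrow> real" where
  "lagrangian u v t = (norm (v t))\<^sup>2 / 2 + (norm (u t))\<^sup>2 / 2 - Q t (u t)"

definition \<Phi> :: "(real \<Rightarrow>\<^sub>C 'a) \<Rightarrow> real" where
  "\<Phi> u = integral {0..T} (lagrangian (apply_bcontfun u) (\<lambda>t. vector_derivative (apply_bcontfun u) (at t)))"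

lemma C_nonneg: "C \<ge> 0"
  using p_bound[of 0 0] norm_ge_zero order_trans by blast

lemma nemytskii_cont: "continuous_on UNIV (nemytskii u)"
proof -
  have "continuous_on UNIV (\<lambda>s. (s, apply_bcontfun u s))"
    by (intro continuous_on_Pair continuous_on_id continuous_on_apply_bcontfun)
  from continuous_on_compose2[OF p_cont this] show ?thesis
    by (simp add: nemytskii_def[abs_def])
qed

lemma nemytskii_periodic: "u \<in> X \<Longrightarrow> nemytskii u (t + T) = nemytskii u t"
  by (simp add: nemytskii_def periodic_bcontfuns_def p_periodic)

lemma nemytskii_bound: "norm (nemytskii u t) \<le> C"
  by (simp add: nemytskii_def p_bound)

lemma green_op_apply:
  assumes "u \<in> X"
  shows "apply_bcontfun (green_op u) = green T (nemytskii u)"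
proof -
  have "continuous_on UNIV (green T (nemytskii u))"
    using green_has_vector_derivative[OF nemytskii_cont nemytskii_periodic[OF assms] T]
    by (intro continuous_at_imp_continuous_on ballI) (meson has_vector_derivative_continuous)
  then have "green T (nemytskii u) \<in> bcontfun"
    using norm_green_le(1)[OF nemytskii_cont nemytskii_periodic[OF assms] T nemytskii_bound]
    by (rule bcontfun_normI)
  then show ?thesis
    by (simp add: green_op_def Bcontfun_inverse)
qed

lemma green_op_lipschitz: "u \<in> X \<Longrightarrow> green_op u \<in> periodic_lipschitz T C"
  using green_periodic[OF nemytskii_cont nemytskii_periodic T]
    norm_green_le(1)[OF nemytskii_cont nemytskii_periodic T nemytskii_bound]
    green_lipschitz[OF nemytskii_cont nemytskii_periodic T nemytskii_bound]
  by (simp add: periodic_lipschitz_def periodic_bcontfuns_def[of T] green_op_apply)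

lemma green_op_norm: "u \<in> X \<Longrightarrow> norm (green_op u) \<le> C"
  using green_op_lipschitz[of u] norm_bound[of "green_op u" C] by (simp add: periodic_lipschitz_def)

lemma green_op_C1: "u \<in> X \<Longrightarrow> C1_deriv (green_op u) (green_deriv T (nemytskii u))"
proof -
  assume u: "u \<in> X"
  have "continuous_on UNIV (green_deriv T (nemytskii u))"
    using green_deriv_has_vector_derivative[OF nemytskii_cont nemytskii_periodic[OF u] T]
    by (intro continuous_at_imp_continuous_on ballI) (meson has_vector_derivative_continuous)
  then show ?thesis
    using green_has_vector_derivative[OF nemytskii_cont nemytskii_periodic[OF u] T]
    by (simp add: C1_deriv_def green_op_apply[OF u])
qed

lemma green_op_uc: "uniformly_continuous_on X green_op"
  unfolding uniformly_continuous_on_def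
proof (intro allI impI)
  fix e :: real assume "e > 0"
  then obtain d where d: "d > 0" "\<And>t x y. norm (x - y) < d \<Longrightarrow> norm (p t x - p t y) < e / 2"
    using p_uc[of "e / 2"] by auto
  have "dist (green_op v) (green_op u) < e" if uv: "u \<in> X" "v \<in> X" "dist v u < d" for u v
  proof -
    have "dist (green_op v) (green_op u) \<le> e / 2"
    proof (rule dist_bound)
      fix t
      have "norm (green T (\<lambda>s. nemytskii v s - nemytskii u s) t) \<le> e / 2"
      proof (rule norm_green_le(1)[OF _ _ T])
        show "continuous_on UNIV (\<lambda>s. nemytskii v s - nemytskii u s)"
          by (intro continuous_intros nemytskii_cont)
        show "nemytskii v (s + T) - nemytskii u (s + T) = nemytskii v s - nemytskii u s" for s
          using uv by (simp add: nemytskii_periodic)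
        show "norm (nemytskii v s - nemytskii u s) \<le> e / 2" for s
          using d(2)[of "apply_bcontfun v s" "apply_bcontfun u s" s] dist_bounded[of v s u] uv(3)
          by (simp add: nemytskii_def dist_norm)
      qed
      then show "dist (apply_bcontfun (green_op v) t) (apply_bcontfun (green_op u) t) \<le> e / 2"
        using uv by (simp add: green_op_apply dist_norm green_diff[OF nemytskii_cont nemytskii_cont])
    qed
    then show ?thesis using \<open>e > 0\<close> by simp
  qed
  then show "\<exists>d>0. \<forall>u\<in>X. \<forall>v\<in>X. dist v u < d \<longrightarrow> dist (green_op v) (green_op u) < e"
    using d(1) by blast
qed

lemma X_uminus: "u \<in> X \<Longrightarrow> - u \<in> X"
  by (simp add: periodic_bcontfuns_def)

lemma green_op_odd: "u \<in> X \<Longrightarrow> green_op (- u) = - green_op u"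
proof (rule bcontfun_eqI)
  fix t assume u: "u \<in> X"
  have "nemytskii (- u) = (\<lambda>s. - nemytskii u s)"
    by (simp add: nemytskii_def fun_eq_iff p_odd)
  then show "apply_bcontfun (green_op (- u)) t = apply_bcontfun (- green_op u) t"
    using u by (simp add: green_op_apply X_uminus green_uminus)
qed

lemma C1_deriv_combine:
  "C1_deriv u v \<Longrightarrow> C1_deriv u' v' \<Longrightarrow> C1_deriv (a *\<^sub>R u + b *\<^sub>R u') (\<lambda>t. a *\<^sub>R v t + b *\<^sub>R v' t)"
proof -
  assume *: "C1_deriv u v" "C1_deriv u' v'"
  have "apply_bcontfun (a *\<^sub>R u + b *\<^sub>R u') = (\<lambda>t. a *\<^sub>R apply_bcontfun u t + b *\<^sub>R apply_bcontfun u' t)"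
    by (simp add: fun_eq_iff)
  then show ?thesis
    using * unfolding C1_deriv_def
    by (auto intro!: continuous_intros has_vector_derivative_add
        bounded_linear.has_vector_derivative[OF bounded_linear_scaleR_right])
qed

lemma euler_step_D:
  assumes "u \<in> D" "0 \<le> \<tau>" "\<tau> \<le> 1"
  shows "euler_step green_op \<tau> u \<in> D"
proof -
  obtain v where u: "u \<in> X" "norm u \<le> C + 1" "C1_deriv u v"
    using assms by (auto simp: D_def)
  have "euler_step green_op \<tau> u \<in> X"
    using u(1) green_op_lipschitz[OF u(1)] by (simp add: euler_step_def periodic_bcontfuns_def periodic_lipschitz_def)
  moreover have "norm (euler_step green_op \<tau> u) \<le> C + 1"
  proof -
    have "norm (euler_step green_op \<tau> u) \<le> (1 - \<tau>) * norm u + \<tau> * norm (green_op u)"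
      unfolding euler_step_def using assms by (intro norm_triangle_le) simp
    also have "\<dots> \<le> (1 - \<tau>) * (C + 1) + \<tau> * (C + 1)"
      using assms u green_op_norm[OF u(1)] by (intro add_mono mult_left_mono) auto
    finally show ?thesis by (simp add: algebra_simps)
  qed
  moreover have "C1_deriv (euler_step green_op \<tau> u) (\<lambda>t. (1 - \<tau>) *\<^sub>R v t + \<tau> *\<^sub>R green_deriv T (nemytskii u) t)"
    unfolding euler_step_def by (intro C1_deriv_combine u green_op_C1)
  ultimately show ?thesis
    by (auto simp: D_def)
qed

lemma \<Phi>_eq: "C1_deriv u v \<Longrightarrow> \<Phi> u = integral {0..T} (lagrangian (apply_bcontfun u) v)"
proof -
  assume "C1_deriv u v"
  then have "vector_derivative (apply_bcontfun u) (at t) = v t" for t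
    by (simp add: C1_deriv_def vector_derivative_at)
  then show ?thesis
    by (simp add: \<Phi>_def)
qed

lemma lagrangian_cont:
  assumes "C1_deriv u v"
  shows "continuous_on UNIV (lagrangian (apply_bcontfun u) v)"
proof -
  have "continuous_on UNIV (\<lambda>t. Q t (apply_bcontfun u t))"
  proof -
    have "continuous_on UNIV (\<lambda>s. (s, apply_bcontfun u s))"
      by (intro continuous_on_Pair continuous_on_id continuous_on_apply_bcontfun)
    from continuous_on_compose2[OF Q_cont this] show ?thesis
      by simp
  qed
  then show ?thesis
    using assms unfolding lagrangian_def[abs_def] C1_deriv_def by (auto intro!: continuous_intros)
qed

lemma lagrangian_integrable:
  "C1_deriv u v \<Longrightarrow> lagrangian (apply_bcontfun u) v integrable_on {0..T}"
  using lagrangian_cont by (intro integrable_continuous_interval) (rule continuous_on_subset, auto)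

lemma \<Phi>_ge:
  assumes "u \<in> D" "\<And>t. Q t (apply_bcontfun u t) \<le> b"
  shows "- (T * b) \<le> \<Phi> u"
proof -
  obtain v where v: "C1_deriv u v"
    using assms(1) by (auto simp: D_def)
  have "integral {0..T} (\<lambda>t. - b) \<le> integral {0..T} (lagrangian (apply_bcontfun u) v)"
  proof (rule integral_le[OF _ lagrangian_integrable[OF v]])
    fix t
    show "- b \<le> lagrangian (apply_bcontfun u) v t"
      using assms(2)[of t] zero_le_power2[of "norm (v t)"] zero_le_power2[of "norm (apply_bcontfun u t)"]
      unfolding lagrangian_def by linarith
  qed (rule integrable_const_ivl)
  then show ?thesis
    using T by (simp add: \<Phi>_eq[OF v])
qed

lemma Q_le: "Q t x \<le> C * norm x"
proof -
  have "norm (Q t x - Q t 0) \<le> C * norm (x - 0)"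
  proof (rule differentiable_bound[of UNIV _ "\<lambda>x h. p t x \<bullet> h"])
    fix y
    show "onorm (\<lambda>h. p t y \<bullet> h) \<le> C"
    proof (rule onorm_bound[OF C_nonneg])
      fix h
      have "norm (p t y \<bullet> h) \<le> norm (p t y) * norm h"
        by (simp add: Cauchy_Schwarz_ineq2)
      also have "\<dots> \<le> C * norm h"
        by (intro mult_right_mono p_bound) simp
      finally show "norm (p t y \<bullet> h) \<le> C * norm h" .
    qed
  qed (use Q_deriv in auto)
  then show ?thesis
    by (simp add: Q_0)
qed

lemma Q_expansion:
  assumes "\<And>y. norm (y - x) \<le> norm (x' - x) \<Longrightarrow> norm (p t y - p t x) \<le> e"
  shows "\<bar>Q t x' - Q t x - p t x \<bullet> (x' - x)\<bar> \<le> norm (x' - x) * e"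
proof -
  have "0 \<le> e"
    using assms[of x] by (simp add: order_trans[OF norm_ge_zero])
  have "norm (Q t x' - Q t x - p t x \<bullet> (x' - x)) \<le> norm (x' - x) * e"
  proof (rule differentiable_bound_linearization[of x x' "cball x (norm (x' - x))" _ "\<lambda>y h. p t y \<bullet> h" x])
    fix s :: real assume "s \<in> {0..1}"
    then show "x + s *\<^sub>R (x' - x) \<in> cball x (norm (x' - x))"
      by (simp add: dist_norm mult_left_le_one_le)
  next
    fix y
    show "(Q t has_derivative (\<lambda>h. p t y \<bullet> h)) (at y within cball x (norm (x' - x)))"
      using Q_deriv by (rule has_derivative_at_withinI)
    assume y: "y \<in> cball x (norm (x' - x))"
    have "norm (p t y - p t x) \<le> e"
      using assms[of y] y by (simp add: dist_norm norm_minus_commute)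
    then show "onorm ((\<lambda>h. p t y \<bullet> h) - (\<lambda>h. p t x \<bullet> h)) \<le> e"
      unfolding fun_diff_def inner_diff_left[symmetric]
    proof (intro onorm_bound \<open>0 \<le> e\<close>)
      fix h
      have "norm ((p t y - p t x) \<bullet> h) \<le> norm (p t y - p t x) * norm h"
        by (simp add: Cauchy_Schwarz_ineq2)
      also have "\<dots> \<le> e * norm h"
        using \<open>norm (p t y - p t x) \<le> e\<close> by (intro mult_right_mono) auto
      finally show "norm ((p t y - p t x) \<bullet> h) \<le> e * norm h" .
    qed
  qed simp
  then show ?thesis by simp
qed

text \<open>For \<open>g = u - green_op u\<close> the first variation of \<open>\<Phi>\<close> in direction \<open>- g\<close> is minus the
  squared \<open>H\<^sup>1\<close> norm of \<open>g\<close>, which dominates the squared supremum norm by \<open>sobolev_bound\<close>; the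
  nonlinear remainder is absorbed by the uniform continuity of \<open>p\<close>.\<close>

lemma \<Phi>_descent:
  assumes "E > 0"
  shows "\<exists>\<tau>\<^sub>0>0. \<forall>\<tau> u. 0 < \<tau> \<longrightarrow> \<tau> < \<tau>\<^sub>0 \<longrightarrow> u \<in> D \<longrightarrow>
    \<Phi> (euler_step green_op \<tau> u) \<le> \<Phi> u - 1 / (2 * (1 + 1 / T)) * \<tau> * (norm (u - green_op u))\<^sup>2 + \<tau> * E"
proof -
  define e where "e = sqrt (E / T)"
  have e: "e > 0" "T * e\<^sup>2 = E"
    using assms T by (simp_all add: e_def)
  obtain d where d: "d > 0" "\<And>t x y. norm (x - y) < d \<Longrightarrow> norm (p t x - p t y) < e"
    using p_uc[OF e(1)] by blast
  \<comment> \<open>The bound 1/2 gives \<open>\<tau>\<^sup>2 \<le> \<tau> / 2\<close>; the other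
    one makes the displacement \<open>\<tau> * norm (g t)\<close> smaller than \<open>d\<close>,
    because \<open>norm (g t) \<le> 2 * C + 1\<close>.\<close>
  define \<tau>\<^sub>0 where "\<tau>\<^sub>0 = min (1 / 2) (d / (2 * C + 2))"
  have \<tau>\<^sub>0: "\<tau>\<^sub>0 > 0" using d(1) C_nonneg by (simp add: \<tau>\<^sub>0_def)
  have "\<Phi> (euler_step green_op \<tau> u) \<le> \<Phi> u - 1 / (2 * (1 + 1 / T)) * \<tau> * (norm (u - green_op u))\<^sup>2 + \<tau> * E"
    if \<tau>: "0 < \<tau>" "\<tau> < \<tau>\<^sub>0" and "u \<in> D" for \<tau> u
  proof -
    obtain v where u: "u \<in> X" "norm u \<le> C + 1" "C1_deriv u v"
      using \<open>u \<in> D\<close> by (auto simp: D_def)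
    define h where "h = nemytskii u"
    define w where "w = green T h"
    define w' where "w' = green_deriv T h"
    define g where "g = (\<lambda>t. apply_bcontfun u t - w t)"
    define g' where "g' = (\<lambda>t. v t - w' t)"
    have w: "apply_bcontfun (green_op u) = w" "C1_deriv (green_op u) w'"
      using green_op_apply[OF u(1)] green_op_C1[OF u(1)] by (simp_all add: w_def w'_def h_def)
    have w'_deriv: "(w' has_vector_derivative w t - h t) (at t)" for t
      unfolding w_def w'_def h_def
      by (rule green_deriv_has_vector_derivative[OF nemytskii_cont nemytskii_periodic[OF u(1)] T])
    have g_deriv: "(g has_vector_derivative g' t) (at t)" for t
      using u(3) w unfolding C1_deriv_def g_def g'_def by (auto intro!: has_vector_derivative_diff)
    have cont: "continuous_on UNIV g'" "continuous_on UNIV w'" "continuous_on UNIV w" "continuous_on UNIV g"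
      "continuous_on UNIV h"
    proof -
      show "continuous_on UNIV g'" "continuous_on UNIV w'"
        using u(3) w(2) by (auto simp: C1_deriv_def g'_def intro!: continuous_intros)
      show "continuous_on UNIV w" unfolding w(1)[symmetric] by simp
      then show "continuous_on UNIV g" unfolding g_def by (intro continuous_intros) auto
      show "continuous_on UNIV h" unfolding h_def by (rule nemytskii_cont)
    qed
    have int: "f integrable_on {0..T}" if "continuous_on UNIV f" for f :: "real \<Rightarrow> real"
      using that by (intro integrable_continuous_interval) (rule continuous_on_subset, auto)
    define I where "I = integral {0..T} (\<lambda>t. (norm (g' t))\<^sup>2 + (norm (g t))\<^sup>2)"
    define u\<tau> where "u\<tau> = (\<lambda>t. apply_bcontfun u t - \<tau> *\<^sub>R g t)"
    define v\<tau> where "v\<tau> = (\<lambda>t. v t - \<tau> *\<^sub>R g' t)"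
    have u\<tau>: "apply_bcontfun (euler_step green_op \<tau> u) = u\<tau>"
      by (simp add: euler_step_def u\<tau>_def g_def w(1) fun_eq_iff algebra_simps)
    have v\<tau>: "C1_deriv (euler_step green_op \<tau> u) v\<tau>"
    proof -
      have "v\<tau> = (\<lambda>t. (1 - \<tau>) *\<^sub>R v t + \<tau> *\<^sub>R w' t)"
        by (simp add: v\<tau>_def g'_def fun_eq_iff algebra_simps)
      then show ?thesis
        unfolding euler_step_def using C1_deriv_combine[OF u(3) w(2)] by simp
    qed
    have norm_g: "norm (g t) \<le> 2 * C + 1" for t
    proof -
      have "norm (apply_bcontfun u t) \<le> C + 1" "norm (w t) \<le> C"
        using norm_bounded[of u t] norm_bounded[of "green_op u" t] u(2) green_op_norm[OF u(1)] w(1) by auto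
      then show ?thesis
        using norm_triangle_ineq4[of "apply_bcontfun u t" "w t"] by (simp add: g_def)
    qed
    have pointwise: "lagrangian u\<tau> v\<tau> t \<le> lagrangian (apply_bcontfun u) v t -
       \<tau> * (w' t \<bullet> g' t + (w t - h t) \<bullet> g t) - \<tau> / 2 * ((norm (g' t))\<^sup>2 + (norm (g t))\<^sup>2) + \<tau> * e\<^sup>2" for t
    proof -
      define x where "x = apply_bcontfun u t"
      have x: "x = w t + g t" and vt: "v t = w' t + g' t" and ht: "h t = p t x"
        by (simp_all add: x_def g_def g'_def h_def nemytskii_def)
      have \<tau>g: "\<tau> * norm (g t) < d"
      proof -
        have "\<tau> * norm (g t) \<le> \<tau> * (2 * C + 2)"
          using norm_g[of t] \<tau>(1) by (intro mult_left_mono) auto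
        also have "\<dots> < d"
          using \<tau>(2) C_nonneg by (simp add: \<tau>\<^sub>0_def pos_less_divide_eq)
        finally show ?thesis .
      qed
      have "\<bar>Q t (x - \<tau> *\<^sub>R g t) - Q t x - p t x \<bullet> (x - \<tau> *\<^sub>R g t - x)\<bar> \<le> norm (x - \<tau> *\<^sub>R g t - x) * e"
        using \<tau>g \<tau>(1) d(2) by (intro Q_expansion less_imp_le) auto
      then have Qle: "Q t x - Q t (x - \<tau> *\<^sub>R g t) \<le> \<tau> * (h t \<bullet> g t) + \<tau> * (norm (g t) * e)"
        using \<tau>(1) by (simp add: ht)
      \<comment> \<open>Young's inequality: the part quadratic in \<open>g t\<close> is absorbed by
        the descent, and the rest is a constant that does not depend on \<open>u\<close>.\<close>
      have "norm (g t) * e \<le> e\<^sup>2 + (norm (g t))\<^sup>2 / 4"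
        using zero_le_power2[of "norm (g t) / 2 - e"] by (simp add: power2_eq_square algebra_simps)
      then have Qle': "Q t x - Q t (x - \<tau> *\<^sub>R g t) \<le> \<tau> * (h t \<bullet> g t) + \<tau> * (e\<^sup>2 + (norm (g t))\<^sup>2 / 4)"
        using Qle \<tau>(1) by (smt (verit) mult_left_mono)
      have sq: "(norm (a - \<tau> *\<^sub>R b))\<^sup>2 = (norm a)\<^sup>2 - 2 * \<tau> * (a \<bullet> b) + \<tau>\<^sup>2 * (norm b)\<^sup>2" for a b :: 'a
        unfolding power2_norm_eq_inner
        by (simp add: inner_diff_left inner_diff_right inner_commute power2_eq_square[of \<tau>] algebra_simps)
      have \<tau>2: "\<tau>\<^sup>2 * c \<le> \<tau> / 2 * c" if "c \<ge> 0" for c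
      proof (rule mult_right_mono[OF _ that])
        have "\<tau> \<le> 1 / 2" using \<tau>(2) by (simp add: \<tau>\<^sub>0_def)
        then have "\<tau> * \<tau> \<le> \<tau> * (1 / 2)" using \<tau>(1) by (intro mult_left_mono) auto
        then show "\<tau>\<^sup>2 \<le> \<tau> / 2" by (simp add: power2_eq_square)
      qed
      have inn: "v t \<bullet> g' t = w' t \<bullet> g' t + (norm (g' t))\<^sup>2" "x \<bullet> g t = w t \<bullet> g t + (norm (g t))\<^sup>2"
        by (simp_all add: x vt inner_add_left power2_norm_eq_inner)
      have "lagrangian u\<tau> v\<tau> t = ((norm (v t))\<^sup>2 - 2 * \<tau> * (v t \<bullet> g' t) + \<tau>\<^sup>2 * (norm (g' t))\<^sup>2) / 2 +
          ((norm x)\<^sup>2 - 2 * \<tau> * (x \<bullet> g t) + \<tau>\<^sup>2 * (norm (g t))\<^sup>2) / 2 - Q t (x - \<tau> *\<^sub>R g t)"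
        by (simp add: lagrangian_def u\<tau>_def v\<tau>_def sq x_def)
      also have "\<dots> \<le> (norm (v t))\<^sup>2 / 2 - \<tau> * (v t \<bullet> g' t) + \<tau> / 4 * (norm (g' t))\<^sup>2 +
          (norm x)\<^sup>2 / 2 - \<tau> * (x \<bullet> g t) + \<tau> / 4 * (norm (g t))\<^sup>2 - Q t x +
          \<tau> * (h t \<bullet> g t) + \<tau> * (e\<^sup>2 + (norm (g t))\<^sup>2 / 4)"
        using Qle' \<tau>2[of "(norm (g' t))\<^sup>2"] \<tau>2[of "(norm (g t))\<^sup>2"]
        by (simp add: diff_divide_distrib add_divide_distrib)
      also have "\<dots> = lagrangian (apply_bcontfun u) v t - \<tau> * (w' t \<bullet> g' t + (w t - h t) \<bullet> g t)
          - \<tau> * 3 / 4 * (norm (g' t))\<^sup>2 - \<tau> / 2 * (norm (g t))\<^sup>2 + \<tau> * e\<^sup>2"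
        unfolding inn by (simp add: lagrangian_def x_def[symmetric] inner_diff_left algebra_simps)
      also have "\<dots> \<le> lagrangian (apply_bcontfun u) v t - \<tau> * (w' t \<bullet> g' t + (w t - h t) \<bullet> g t)
          - \<tau> / 2 * (norm (g' t))\<^sup>2 - \<tau> / 2 * (norm (g t))\<^sup>2 + \<tau> * e\<^sup>2"
        using \<tau>(1) by (simp add: mult_right_mono)
      finally show ?thesis by (simp add: algebra_simps)
    qed
    \<comment> \<open>The Green problem in weak form, tested with \<open>g\<close>: by
      \<open>w'' = w - h\<close> the integrand is the derivative of
      \<open>w' t \<bullet> g t\<close>, and periodicity removes the boundary terms. So the mixed
      term of the first variation vanishes and only the squares of \<open>g\<close> and
      \<open>g'\<close> remain.\<close>
    have ibp: "((\<lambda>t. w' t \<bullet> g' t + (w t - h t) \<bullet> g t) has_integral 0) {0..T}"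
    proof -
      have "((\<lambda>t. w' t \<bullet> g' t + (w t - h t) \<bullet> g t) has_integral w' T \<bullet> g T - w' 0 \<bullet> g 0) {0..T}"
      proof (rule fundamental_theorem_of_calculus)
        fix t
        have "((\<lambda>t. w' t \<bullet> g t) has_vector_derivative w' t \<bullet> g' t + (w t - h t) \<bullet> g t) (at t)"
          using bounded_bilinear.has_vector_derivative[OF bounded_bilinear_inner w'_deriv g_deriv] .
        then show "((\<lambda>t. w' t \<bullet> g t) has_vector_derivative w' t \<bullet> g' t + (w t - h t) \<bullet> g t) (at t within {0..T})"
          by (rule has_vector_derivative_at_within)
      qed (use T in simp)
      moreover have "w' T = w' 0"
        using green_deriv_periodic[where h = h and T = T and t = 0, OF nemytskii_cont[of u, folded h_def] _ T]
          nemytskii_periodic[OF u(1), folded h_def] by (simp add: w'_def)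
      moreover have "g T = g 0"
      proof -
        have "apply_bcontfun u (0 + T) = apply_bcontfun u 0" using u(1) unfolding periodic_bcontfuns_def by blast
        moreover have "w (0 + T) = w 0"
          unfolding w_def h_def by (rule green_periodic[OF nemytskii_cont nemytskii_periodic[OF u(1)] T])
        ultimately show ?thesis by (simp add: g_def)
      qed
      ultimately show ?thesis by simp
    qed
    have "\<Phi> (euler_step green_op \<tau> u) = integral {0..T} (lagrangian u\<tau> v\<tau>)"
      using \<Phi>_eq[OF v\<tau>] u\<tau> by simp
    also have "\<dots> \<le> integral {0..T} (\<lambda>t. lagrangian (apply_bcontfun u) v t -
       \<tau> * (w' t \<bullet> g' t + (w t - h t) \<bullet> g t) - \<tau> / 2 * ((norm (g' t))\<^sup>2 + (norm (g t))\<^sup>2) + \<tau> * e\<^sup>2)"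
    proof (rule integral_le)
      show "lagrangian u\<tau> v\<tau> integrable_on {0..T}"
        using lagrangian_integrable[OF v\<tau>] u\<tau> by simp
    qed (use pointwise in \<open>auto intro!: int continuous_intros cont lagrangian_cont[OF u(3)]\<close>)
    also have "\<dots> = \<Phi> u - \<tau> * 0 - \<tau> / 2 * I + T * (\<tau> * e\<^sup>2)"
    proof (rule integral_unique)
      have "((\<lambda>t. \<tau> * e\<^sup>2) has_integral T * (\<tau> * e\<^sup>2)) {0..T}"
        using has_integral_const_real[of "\<tau> * e\<^sup>2" 0 T] T by simp
      moreover have "((\<lambda>t. (norm (g' t))\<^sup>2 + (norm (g t))\<^sup>2) has_integral I) {0..T}"
        unfolding I_def by (intro integrable_integral int continuous_intros cont)
      moreover have "(lagrangian (apply_bcontfun u) v has_integral \<Phi> u) {0..T}"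
        unfolding \<Phi>_eq[OF u(3)] by (intro integrable_integral lagrangian_integrable u)
      ultimately show "((\<lambda>t. lagrangian (apply_bcontfun u) v t -
         \<tau> * (w' t \<bullet> g' t + (w t - h t) \<bullet> g t) - \<tau> / 2 * ((norm (g' t))\<^sup>2 + (norm (g t))\<^sup>2) + \<tau> * e\<^sup>2)
         has_integral \<Phi> u - \<tau> * 0 - \<tau> / 2 * I + T * (\<tau> * e\<^sup>2)) {0..T}"
        using ibp by (intro has_integral_add has_integral_diff has_integral_mult_right)
    qed
    finally have main: "\<Phi> (euler_step green_op \<tau> u) \<le> \<Phi> u - \<tau> / 2 * I + \<tau> * E"
      by (simp add: e(2)[symmetric] algebra_simps)
    have g_per: "g (t + T) = g t" for t
      using u(1) green_periodic[OF nemytskii_cont nemytskii_periodic[OF u(1)] T]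
      by (simp add: g_def w_def h_def periodic_bcontfuns_def)
    have sob: "(norm (g t))\<^sup>2 \<le> (1 + 1 / T) * I" for t
      unfolding I_def by (rule sobolev_bound[OF T g_per g_deriv cont(1)])
    have "norm (u - green_op u) \<le> sqrt ((1 + 1 / T) * I)"
    proof (rule norm_bound)
      fix t
      show "norm (apply_bcontfun (u - green_op u) t) \<le> sqrt ((1 + 1 / T) * I)"
        using sob[of t] by (simp add: g_def w(1) real_le_rsqrt)
    qed
    then have "(norm (u - green_op u))\<^sup>2 \<le> (sqrt ((1 + 1 / T) * I))\<^sup>2"
      by (intro power_mono) auto
    also have "\<dots> = (1 + 1 / T) * I"
      using sob[of 0] by (simp add: order_trans[OF zero_le_power2])
    finally have "(norm (u - green_op u))\<^sup>2 / (1 + 1 / T) \<le> I"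
      using T by (simp add: divide_le_eq mult.commute add_pos_pos)
    then have "\<tau> / 2 * ((norm (u - green_op u))\<^sup>2 / (1 + 1 / T)) \<le> \<tau> / 2 * I"
      using \<tau>(1) by (intro mult_left_mono) auto
    moreover have "\<tau> / 2 * ((norm (u - green_op u))\<^sup>2 / (1 + 1 / T)) = 1 / (2 * (1 + 1 / T)) * \<tau> * (norm (u - green_op u))\<^sup>2"
      by simp
    ultimately show ?thesis
      using main by linarith
  qed
  then show ?thesis
    using \<tau>\<^sub>0 by blast
qed

end

section \<open>The functional near zero and the existence of small solutions\<close>

lemma apply_bcontfun_sum: "apply_bcontfun (sum f I) t = (\<Sum>i\<in>I. apply_bcontfun (f i) t)"
  by (induction I rule: infinite_finite_induct) auto

lemma cos_freq_periodic: "T > 0 \<Longrightarrow> cos (freq T i * (t + T)) = cos (freq T i * t)"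
proof -
  assume T: "T > 0"
  have "freq T i * (t + T) = freq T i * t + 2 * pi * of_int (int (Suc i))"
    using T by (simp add: freq_def field_simps)
  then show ?thesis
    using sin_int_2pin[of "int (Suc i)"] cos_int_2pin[of "int (Suc i)"] by (simp add: cos_add)
qed

context truncated_problem
begin

lemma \<Phi>_lsc:
  assumes "\<epsilon> > 0"
  shows "\<exists>r>0. \<forall>u\<in>D. norm u < r \<longrightarrow> - \<epsilon> \<le> \<Phi> u"
proof (intro exI[of _ "\<epsilon> / (T * (C + 1))"] conjI ballI impI)
  have C1: "C + 1 > 0" using C_nonneg by simp
  show "\<epsilon> / (T * (C + 1)) > 0"
    using assms T C1 by simp
  fix u assume u: "u \<in> D" "norm u < \<epsilon> / (T * (C + 1))"
  have "- (T * ((C + 1) * norm u)) \<le> \<Phi> u"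
  proof (rule \<Phi>_ge[OF u(1)])
    fix t
    have "Q t (apply_bcontfun u t) \<le> C * norm (apply_bcontfun u t)"
      by (rule Q_le)
    also have "\<dots> \<le> (C + 1) * norm u"
      using C_nonneg norm_bounded[of u t] by (intro mult_mono) auto
    finally show "Q t (apply_bcontfun u t) \<le> (C + 1) * norm u" .
  qed
  moreover have "T * ((C + 1) * norm u) \<le> \<epsilon>"
    using u(2) T C1 by (simp add: pos_less_divide_eq mult_ac)
  ultimately show "- \<epsilon> \<le> \<Phi> u"
    by linarith
qed

text \<open>On small multiples of trigonometric polynomials in one fixed direction the quadratic
  part of \<Phi> is of order \<open>s\<^sup>2\<close> with a constant depending on \<open>k\<close>,
  and superquadraticity lets \<open>Q\<close> dominate it. Although \<open>f\<close> may vanish at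
  some times, its mean square over a period is fixed by orthogonality.\<close>

lemma negative_sphere: "\<exists>b \<epsilon>. \<epsilon> > 0 \<and> (\<forall>u\<in>coord_sphere b k. u \<in> D \<and> \<Phi> u \<le> - \<epsilon>)"
proof -
  obtain e :: 'a where e: "norm e = 1"
    using norm_Basis[OF SOME_Basis] by blast
  define n where "n = real (k + 1)"
  define L where "L = (\<Sum>i\<le>k. freq T i)"
  have n: "n \<ge> 1" by (simp add: n_def)
  have freq_nonneg: "freq T i \<ge> 0" for i
    using T by (simp add: freq_def)
  \<comment> \<open>\<open>L\<close> bounds \<open>f'\<close> and \<open>n\<close> bounds
    \<open>f\<close>, so \<open>L\<^sup>2 + n\<^sup>2\<close> compensates the quadratic part; the
    extra 1 leaves \<open>- (s\<^sup>2 * T / 2)\<close>.\<close>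
  define M where "M = L\<^sup>2 + n\<^sup>2 + 1"
  obtain r where r: "r > 0" "\<And>t x. t \<in> {0..T} \<Longrightarrow> norm x < r \<Longrightarrow> M * (norm x)\<^sup>2 \<le> Q t x"
    using Q_super[of M] by blast
  \<comment> \<open>As \<open>s * n\<close> bounds the sup norm on the sphere, the sphere lies in
    \<open>D\<close> and in the range where the bound for \<open>Q\<close> applies.\<close>
  define s where "s = min 1 (r / 2) / n"
  have s: "s > 0" "s * n \<le> 1" "s * n < r"
    using n r(1) by (simp_all add: s_def)
  define b where "b = (\<lambda>i. Bcontfun (\<lambda>t. (s * cos (freq T i * t)) *\<^sub>R e))"
  have b: "apply_bcontfun (b i) = (\<lambda>t. (s * cos (freq T i * t)) *\<^sub>R e)" for i
  proof -
    have "(\<lambda>t. (s * cos (freq T i * t)) *\<^sub>R e) \<in> bcontfun"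
    proof (rule bcontfun_normI)
      show "norm ((s * cos (freq T i * t)) *\<^sub>R e) \<le> s * 1" for t
        using s(1) e by (simp add: abs_mult mult_left_le)
    qed (intro continuous_intros)
    then show ?thesis by (simp add: b_def Bcontfun_inverse)
  qed
  have "u \<in> D \<and> \<Phi> u \<le> - (s\<^sup>2 * T / 2)" if "u \<in> coord_sphere b k" for u
  proof -
    obtain c where c: "u = (\<Sum>i\<le>k. c i *\<^sub>R b i)" "(\<Sum>i\<le>k. (c i)\<^sup>2) = 1"
      using \<open>u \<in> _\<close> by (auto simp: coord_sphere_def)
    have c1: "\<bar>c i\<bar> \<le> 1" if "i \<le> k" for i
    proof -
      have "(c i)\<^sup>2 \<le> (\<Sum>i\<le>k. (c i)\<^sup>2)"
        using that by (intro member_le_sum) auto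
      then show ?thesis
        using c(2) by (simp add: abs_square_le_1)
    qed
    define f where "f = (\<lambda>t. \<Sum>i\<le>k. c i * cos (freq T i * t))"
    define f' where "f' = (\<lambda>t. \<Sum>i\<le>k. c i * (- (sin (freq T i * t) * freq T i)))"
    have f_le: "\<bar>f t\<bar> \<le> n" for t
    proof -
      have "\<bar>f t\<bar> \<le> (\<Sum>i\<le>k. \<bar>c i * cos (freq T i * t)\<bar>)"
        unfolding f_def by (rule sum_abs)
      also have "\<dots> \<le> (\<Sum>i\<le>k. 1 * 1)"
        unfolding abs_mult using c1 by (intro sum_mono mult_mono) auto
      finally show ?thesis by (simp add: n_def)
    qed
    have f'_le: "\<bar>f' t\<bar> \<le> L" for t
    proof -
      have "\<bar>f' t\<bar> \<le> (\<Sum>i\<le>k. \<bar>c i * (- (sin (freq T i * t) * freq T i))\<bar>)"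
        unfolding f'_def by (rule sum_abs)
      also have "\<dots> \<le> (\<Sum>i\<le>k. 1 * (1 * freq T i))"
        unfolding abs_mult abs_minus using c1 freq_nonneg by (intro sum_mono mult_mono) auto
      finally show ?thesis by (simp add: L_def)
    qed
    have f_deriv: "(f has_vector_derivative f' t) (at t)" for t
      unfolding f_def f'_def has_real_derivative_iff_has_vector_derivative[symmetric]
      by (auto intro!: derivative_eq_intros sum.cong)
    have f_cont: "continuous_on UNIV f" "continuous_on UNIV f'"
      unfolding f_def f'_def by (intro continuous_intros)+
    have u: "apply_bcontfun u = (\<lambda>t. (s * f t) *\<^sub>R e)"
      by (simp add: c(1) fun_eq_iff apply_bcontfun_sum b f_def sum_distrib_left scaleR_sum_left mult_ac)
    have v: "C1_deriv u (\<lambda>t. (s * f' t) *\<^sub>R e)"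
      unfolding C1_deriv_def u
    proof (intro conjI allI)
      show "continuous_on UNIV (\<lambda>t. (s * f' t) *\<^sub>R e)"
        by (intro continuous_intros f_cont)
      fix t
      show "((\<lambda>t. (s * f t) *\<^sub>R e) has_vector_derivative (s * f' t) *\<^sub>R e) (at t)"
        by (intro bounded_linear.has_vector_derivative[OF bounded_linear_scaleR_left]
            bounded_linear.has_vector_derivative[OF bounded_linear_mult_right] f_deriv)
    qed
    have norm_u: "norm (apply_bcontfun u t) = s * \<bar>f t\<bar>" for t
      using s(1) e by (simp add: u abs_mult)
    have norm_le: "norm (apply_bcontfun u t) \<le> s * n" for t
      unfolding norm_u using f_le[of t] s(1) by (intro mult_left_mono) auto
    have "u \<in> X"
      using cos_freq_periodic[OF T] by (simp add: periodic_bcontfuns_def u f_def)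
    moreover have "norm u \<le> C + 1"
      using norm_bound[of u "s * n"] norm_le s(2) C_nonneg by fastforce
    ultimately have "u \<in> D"
      using v by (auto simp: D_def)
    moreover have "\<Phi> u \<le> - (s\<^sup>2 * T / 2)"
    proof -
      have 1: "(lagrangian (apply_bcontfun u) (\<lambda>t. (s * f' t) *\<^sub>R e) has_integral \<Phi> u) {0..T}"
        unfolding \<Phi>_eq[OF v] by (intro integrable_integral lagrangian_integrable v)
      have 2: "((\<lambda>t. s\<^sup>2 / 2 * (L\<^sup>2 + n\<^sup>2) - M * s\<^sup>2 * (f t)\<^sup>2) has_integral
          T * (s\<^sup>2 / 2 * (L\<^sup>2 + n\<^sup>2)) - M * s\<^sup>2 * (T / 2 * 1)) {0..T}"
        using has_integral_const_real[of "s\<^sup>2 / 2 * (L\<^sup>2 + n\<^sup>2)" 0 T] T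
          has_integral_mult_right[OF has_integral_cos_sum_square[OF T, of c k], of "M * s\<^sup>2"] c(2)
        by (intro has_integral_diff) (simp_all add: f_def)
      have "\<Phi> u \<le> T * (s\<^sup>2 / 2 * (L\<^sup>2 + n\<^sup>2)) - M * s\<^sup>2 * (T / 2 * 1)"
      proof (rule has_integral_le[OF 1 2])
        fix t assume t: "t \<in> {0..T}"
        have "M * (norm (apply_bcontfun u t))\<^sup>2 \<le> Q t (apply_bcontfun u t)"
          using r(2)[OF t] norm_le[of t] s(3) by simp
        then have Q: "M * s\<^sup>2 * (f t)\<^sup>2 \<le> Q t (apply_bcontfun u t)"
          unfolding norm_u by (simp add: power_mult_distrib mult_ac)
        have "(f t)\<^sup>2 \<le> n\<^sup>2" "(f' t)\<^sup>2 \<le> L\<^sup>2"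
          using f_le[of t] f'_le[of t] by (metis abs_ge_zero power2_abs power_mono)+
        then have "s\<^sup>2 / 2 * ((f' t)\<^sup>2 + (f t)\<^sup>2) \<le> s\<^sup>2 / 2 * (L\<^sup>2 + n\<^sup>2)"
          by (intro mult_left_mono add_mono) auto
        then have "(norm ((s * f' t) *\<^sub>R e))\<^sup>2 / 2 + (norm (apply_bcontfun u t))\<^sup>2 / 2 \<le> s\<^sup>2 / 2 * (L\<^sup>2 + n\<^sup>2)"
          unfolding norm_u using e by (simp add: power_mult_distrib algebra_simps)
        then show "lagrangian (apply_bcontfun u) (\<lambda>t. (s * f' t) *\<^sub>R e) t \<le> s\<^sup>2 / 2 * (L\<^sup>2 + n\<^sup>2) - M * s\<^sup>2 * (f t)\<^sup>2"
          using Q by (simp add: lagrangian_def)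
      qed
      also have "\<dots> = - (s\<^sup>2 * T / 2)"
        by (simp add: M_def field_simps)
      finally show ?thesis .
    qed
    ultimately show ?thesis by blast
  qed
  moreover have "s\<^sup>2 * T / 2 > 0"
    using s(1) T by simp
  ultimately show ?thesis by blast
qed

text \<open>Regularity is automatic: a fixed point of \<open>green_op\<close> is itself a value of
  the Green operator, whose first two derivatives are explicit. The absence of small solutions thus
  isolates 0 among the fixed points, as the contradiction argument requires.\<close>

theorem small_solution_exists:
  assumes "\<rho> > 0"
  shows "\<exists>u v. u \<noteq> (\<lambda>t. 0) \<and> (\<forall>t. u (t + T) = u t) \<and> (\<forall>t. norm (u t) < \<rho>) \<and> (\<forall>t. v (t + T) = v t) \<and>
    (\<forall>t. (u has_vector_derivative v t) (at t)) \<and> (\<forall>t. (v has_vector_derivative u t - p t (u t)) (at t))"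
proof (rule ccontr)
  assume none: "\<not> ?thesis"
  have nofix: "u = 0 \<or> \<rho> \<le> norm u" if u: "u \<in> X" "green_op u = u" for u
  proof (rule ccontr)
    assume nu: "\<not> (u = 0 \<or> \<rho> \<le> norm u)"
    have eq: "apply_bcontfun u = green T (nemytskii u)"
      using green_op_apply[OF u(1)] u(2) by simp
    have "apply_bcontfun u \<noteq> (\<lambda>t. 0)"
    proof
      assume "apply_bcontfun u = (\<lambda>t. 0)"
      then have "u = 0" by (intro bcontfun_eqI) simp
      then show False using nu by simp
    qed
    moreover have "\<forall>t. apply_bcontfun u (t + T) = apply_bcontfun u t"
      using u(1) by (simp add: periodic_bcontfuns_def)
    moreover have "\<forall>t. norm (apply_bcontfun u t) < \<rho>"
    proof -
      have "norm u < \<rho>" using nu by simp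
      then show ?thesis by (blast intro: le_less_trans norm_bounded)
    qed
    moreover have "\<forall>t. green_deriv T (nemytskii u) (t + T) = green_deriv T (nemytskii u) t"
      using green_deriv_periodic[OF nemytskii_cont nemytskii_periodic[OF u(1)] T] by blast
    moreover have "\<forall>t. (apply_bcontfun u has_vector_derivative green_deriv T (nemytskii u) t) (at t)"
      using green_has_vector_derivative[OF nemytskii_cont nemytskii_periodic[OF u(1)] T] eq by simp
    moreover have "\<forall>t. (green_deriv T (nemytskii u) has_vector_derivative apply_bcontfun u t - p t (apply_bcontfun u t)) (at t)"
    proof
      fix t
      have "nemytskii u t = p t (apply_bcontfun u t)" by (simp add: nemytskii_def)
      then show "(green_deriv T (nemytskii u) has_vector_derivative apply_bcontfun u t - p t (apply_bcontfun u t)) (at t)"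
        using green_deriv_has_vector_derivative[OF nemytskii_cont nemytskii_periodic[OF u(1)] T, of t]
        unfolding eq[symmetric] by simp
    qed
    ultimately show False
      using none by blast
  qed
  show False
  proof (rule clark_contradiction[where X = X and C = "periodic_lipschitz T C" and K = green_op and D = D
        and a = "1 / (2 * (1 + 1 / T))" and \<Phi> = \<Phi> and B = "T * B" and \<rho> = \<rho>])
    show "closed X" by (rule closed_periodic_bcontfuns)
    show "compact (periodic_lipschitz T C :: (real \<Rightarrow>\<^sub>C 'a) set)" by (rule compact_periodic_lipschitz[OF T])
    show "green_op ` X \<subseteq> periodic_lipschitz T C" using green_op_lipschitz by blast
    show "D \<subseteq> X" by (auto simp: D_def)
    show "bounded D" by (auto simp: D_def bounded_iff)
    show "1 / (2 * (1 + 1 / T)) > 0" using T by (simp add: add_pos_pos)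
    show "- (T * B) \<le> \<Phi> u" if "u \<in> D" for u by (rule \<Phi>_ge[OF that Q_bound])
  qed (fact X_uminus green_op_uc green_op_odd euler_step_D \<Phi>_descent \<Phi>_lsc assms nofix negative_sphere)+
qed

end

section \<open>Truncation and conclusion\<close>

definition pos_sq :: "real \<Rightarrow> real" where
  "pos_sq y = (max 0 y)\<^sup>2"

lemma pos_sq_deriv: "(pos_sq has_real_derivative 2 * max 0 y) (at y)"
proof -
  consider "y > 0" | "y < 0" | "y = 0" by linarith
  then show ?thesis
  proof cases
    case 1
    have "((\<lambda>y. y\<^sup>2) has_real_derivative 2 * y) (at y)"
      by (auto intro!: derivative_eq_intros)
    then show ?thesis
      using 1 by (subst has_field_derivative_cong_ev[OF refl, where g = "\<lambda>y. y\<^sup>2" and v = "2 * y"])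
        (auto simp: pos_sq_def intro: eventually_mono[OF eventually_gt_at_top] eventually_nhds_in_open[of "{0<..}" y, THEN eventually_mono])
  next
    case 2
    then show ?thesis
      by (subst has_field_derivative_cong_ev[OF refl, where g = "\<lambda>y. 0" and v = 0])
        (auto simp: pos_sq_def intro: eventually_nhds_in_open[of "{..<0}" y, THEN eventually_mono])
  next
    case 3
    have "((\<lambda>h. max 0 h) \<longlongrightarrow> max 0 0) (at (0::real))"
      by (intro tendsto_intros)
    moreover have "(pos_sq (0 + h) - pos_sq 0) / h = max 0 h" if "h \<noteq> 0" for h
      using that by (auto simp: pos_sq_def max_def power2_eq_square)
    ultimately have "((\<lambda>h. (pos_sq (0 + h) - pos_sq 0) / h) \<longlongrightarrow> 0) (at 0)"
      by (subst tendsto_cong[where g = "max 0"]) (auto simp: eventually_at_filter)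
    then show ?thesis
      using 3 by (simp add: DERIV_def)
  qed
qed

text \<open>Twice the second difference, with step 1/2, of the squared positive part: a quadratic
  spline of class C^1 with knots 1, 3/2 and 2. To the left of 1 the second difference of a square is
  the constant 1/2; to the right of 2 all terms vanish.\<close>

definition cutoff :: "real \<Rightarrow> real" where
  "cutoff s = 2 * pos_sq (2 - s) - 4 * pos_sq (3 / 2 - s) + 2 * pos_sq (1 - s)"

definition cutoff_deriv :: "real \<Rightarrow> real" where
  "cutoff_deriv s = - 4 * max 0 (2 - s) + 8 * max 0 (3 / 2 - s) - 4 * max 0 (1 - s)"

lemma cutoff_has_derivative: "(cutoff has_real_derivative cutoff_deriv s) (at s)"
proof -
  have "((\<lambda>s. pos_sq (c - s)) has_real_derivative 2 * max 0 (c - s) * (-1)) (at s)" for c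
    by (rule DERIV_chain2[OF pos_sq_deriv]) (auto intro!: derivative_eq_intros)
  from this[of 2] this[of "3 / 2"] this[of 1] show ?thesis
    unfolding cutoff_def[abs_def] cutoff_deriv_def by (auto intro!: derivative_eq_intros)
qed

lemma cutoff_inner: "s \<le> 1 \<Longrightarrow> cutoff s = 1" "s \<le> 1 \<Longrightarrow> cutoff_deriv s = 0"
  by (simp_all add: cutoff_def cutoff_deriv_def pos_sq_def max_def power2_eq_square algebra_simps)

lemma cutoff_outer: "s \<ge> 2 \<Longrightarrow> cutoff s = 0" "s \<ge> 2 \<Longrightarrow> cutoff_deriv s = 0"
  by (simp_all add: cutoff_def cutoff_deriv_def pos_sq_def max_def)

lemma continuous_on_cutoff: "continuous_on A cutoff" "continuous_on A cutoff_deriv"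
  unfolding cutoff_def[abs_def] cutoff_deriv_def[abs_def] pos_sq_def[abs_def]
  by (intro continuous_intros)+

text \<open>Cutting off in terms of \<open>x \<bullet> x\<close> keeps differentiability at 0 and
  evenness. Everything vanishes for \<open>norm x \<ge> 2\<close> and is periodic in time, so bounds
  and uniform continuity come from a compact cylinder. Periodicity and oddness of \<open>G\<close>
  follow from periodicity and evenness of \<open>F\<close> by uniqueness of the gradient.\<close>

lemma truncated_problem_cutoff:
  fixes F :: "real \<Rightarrow> 'a::euclidean_space \<Rightarrow> real" and G :: "real \<Rightarrow> 'a \<Rightarrow> 'a"
  assumes T: "T > 0"
    and F_cont: "continuous_on UNIV (\<lambda>(t, x). F t x)"
    and G_cont: "continuous_on UNIV (\<lambda>(t, x). G t x)"
    and F_deriv: "\<And>t x. (F t has_derivative (\<lambda>h. G t x \<bullet> h)) (at x)"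
    and F_periodic: "\<And>t x. F (t + T) x = F t x"
    and F_even: "\<And>t x. F t (- x) = F t x"
    and F_0: "\<And>t. F t 0 = 0"
    and F_super: "\<And>M. \<exists>r>0. \<forall>t\<in>{0..T}. \<forall>x. norm x < r \<longrightarrow> M * (norm x)\<^sup>2 \<le> F t x"
  shows "\<exists>C B Q p. truncated_problem T C B Q p \<and> (\<forall>t x. norm x \<le> 1 \<longrightarrow> p t x = G t x)"
proof -
  define Q where "Q = (\<lambda>t x. cutoff (x \<bullet> x) * F t x)"
  define p where "p = (\<lambda>t x. (2 * cutoff_deriv (x \<bullet> x) * F t x) *\<^sub>R x + cutoff (x \<bullet> x) *\<^sub>R G t x)"
  have G_unique: "G t x = y" if "(F t has_derivative (\<lambda>h. y \<bullet> h)) (at x)" for t x y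
    using gradient_eqI[of "F t" x] that F_deriv[of t x] by (metis (no_types, lifting) ext gderiv_def inner_commute)
  have G_periodic: "G (t + T) x = G t x" for t x
  proof (rule G_unique)
    have "F (t + T) = F t" using F_periodic by (intro ext)
    then show "(F (t + T) has_derivative (\<lambda>h. G t x \<bullet> h)) (at x)" using F_deriv by simp
  qed
  have G_odd: "G t (- x) = - G t x" for t x
  proof (rule G_unique)
    have "(F t \<circ> uminus has_derivative (\<lambda>h. G t x \<bullet> h) \<circ> uminus) (at (- x))"
      by (rule diff_chain_at) (use F_deriv[of t x] in \<open>auto intro!: derivative_eq_intros\<close>)
    moreover have "F t \<circ> uminus = F t" using F_even by (simp add: fun_eq_iff)
    moreover have "(\<lambda>h. G t x \<bullet> h) \<circ> uminus = (\<lambda>h. - G t x \<bullet> h)" by (simp add: fun_eq_iff)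
    ultimately show "(F t has_derivative (\<lambda>h. - G t x \<bullet> h)) (at (- x))" by simp
  qed
  have p_periodic: "p (t + T) x = p t x" for t x
    by (simp add: p_def F_periodic G_periodic)
  have far: "p t x = 0" "Q t x = 0" if "norm x \<ge> 2" for t x
  proof -
    have "norm x * norm x \<ge> 2 * 2" using that by (intro mult_mono) auto
    then have "x \<bullet> x \<ge> 2" by (simp add: dot_square_norm power2_eq_square)
    then show "p t x = 0" "Q t x = 0" by (simp_all add: p_def Q_def cutoff_outer)
  qed
  have near: "x \<bullet> x \<le> 1" if "norm x \<le> 1" for x :: 'a
    using that by (simp add: dot_square_norm abs_square_le_1)
  have Fz: "continuous_on UNIV (\<lambda>z. F (fst z) (snd z))" and Gz: "continuous_on UNIV (\<lambda>z. G (fst z) (snd z))"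
    using F_cont G_cont by (simp_all add: case_prod_beta')
  have cz: "continuous_on UNIV (\<lambda>z::real \<times> 'a. cutoff (snd z \<bullet> snd z))"
    "continuous_on UNIV (\<lambda>z::real \<times> 'a. cutoff_deriv (snd z \<bullet> snd z))"
    by (rule continuous_on_compose2[OF continuous_on_cutoff(1)[of UNIV]] continuous_on_compose2[OF continuous_on_cutoff(2)[of UNIV]];
        auto intro!: continuous_intros)+
  have p_cont: "continuous_on UNIV (\<lambda>(t, x). p t x)" and Q_cont: "continuous_on UNIV (\<lambda>(t, x). Q t x)"
    unfolding case_prod_beta' p_def Q_def by (intro continuous_intros Fz Gz cz)+
  \<comment> \<open>Radius 3 leaves a margin: of two points at distance less than 1, either both
    have norm at most 3 or both have norm at least 2, where \<open>p\<close> vanishes.\<close>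
  define S where "S = {0..T} \<times> cball (0::'a) 3"
  have S: "compact S" unfolding S_def by (intro compact_Times) auto
  have "bounded ((\<lambda>(t, x). p t x) ` S)" "bounded ((\<lambda>(t, x). Q t x) ` S)"
    using compact_continuous_image[OF continuous_on_subset[OF p_cont subset_UNIV] S]
      compact_continuous_image[OF continuous_on_subset[OF Q_cont subset_UNIV] S] by (auto dest: compact_imp_bounded)
  then obtain C B where CB: "\<And>t x. (t, x) \<in> S \<Longrightarrow> norm (p t x) \<le> C" "\<And>t x. (t, x) \<in> S \<Longrightarrow> norm (Q t x) \<le> B"
    unfolding bounded_iff by (metis (no_types, lifting) case_prod_conv image_eqI)
  have reduce: "\<exists>s\<in>{0..T}. f s = f t" if "\<And>t. f (t + T) = f t" for f :: "real \<Rightarrow> 'b" and t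
    using periodic_reduce[of f T t] that T by blast
  have zS: "(0, 0) \<in> S" using T by (simp add: S_def)
  have "truncated_problem T C B Q p"
  proof
    show "continuous_on UNIV (\<lambda>(t, x). p t x)" "continuous_on UNIV (\<lambda>(t, x). Q t x)"
      by (fact p_cont Q_cont)+
    show "(Q t has_derivative (\<lambda>h. p t x \<bullet> h)) (at x)" for t x
    proof -
      have "((\<lambda>x. x \<bullet> x) has_derivative (\<lambda>h. 2 * (x \<bullet> h))) (at x)"
        by (auto intro!: derivative_eq_intros simp: inner_commute)
      from has_derivative_compose[OF this cutoff_has_derivative[unfolded has_field_derivative_def]]
      have c: "((\<lambda>x. cutoff (x \<bullet> x)) has_derivative (\<lambda>h. cutoff_deriv (x \<bullet> x) * (2 * (x \<bullet> h)))) (at x)" .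
      have "((\<lambda>x. cutoff (x \<bullet> x) * F t x) has_derivative
          (\<lambda>h. cutoff (x \<bullet> x) * (G t x \<bullet> h) + cutoff_deriv (x \<bullet> x) * (2 * (x \<bullet> h)) * F t x)) (at x)"
        by (rule has_derivative_mult[OF c F_deriv])
      moreover have "(\<lambda>h. cutoff (x \<bullet> x) * (G t x \<bullet> h) + cutoff_deriv (x \<bullet> x) * (2 * (x \<bullet> h)) * F t x) = (\<lambda>h. p t x \<bullet> h)"
        by (simp add: p_def fun_eq_iff inner_add_left)
      ultimately show ?thesis by (simp add: Q_def[abs_def])
    qed
    show "p (t + T) x = p t x" for t x by (rule p_periodic)
    show "norm (p t x) \<le> C" for t x
    proof (cases "norm x \<ge> 2")
      case True
      then show ?thesis using far CB(1)[OF zS] norm_ge_zero order_trans by (metis norm_zero)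
    next
      case False
      obtain s where "s \<in> {0..T}" "p s x = p t x" using reduce[of "\<lambda>t. p t x"] p_periodic by blast
      then show ?thesis using CB(1)[of s x] False by (simp add: S_def)
    qed
    show "Q t x \<le> B" for t x
    proof (cases "norm x \<ge> 2")
      case True
      then show ?thesis using far CB(2)[OF zS] norm_ge_zero order_trans by metis
    next
      case False
      have "Q (t + T) x = Q t x" for t by (simp add: Q_def F_periodic)
      then obtain s where "s \<in> {0..T}" "Q s x = Q t x"
        using reduce[of "\<lambda>t. Q t x"] by blast
      then show ?thesis using CB(2)[of s x] False by (auto simp: S_def)
    qed
    show "p t (- x) = - p t x" for t x
      by (simp add: p_def F_even G_odd)
    show "Q t 0 = 0" for t by (simp add: Q_def F_0)
    show "\<exists>r>0. \<forall>t\<in>{0..T}. \<forall>x. norm x < r \<longrightarrow> M * (norm x)\<^sup>2 \<le> Q t x" for M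
    proof -
      obtain r where r: "r > 0" "\<forall>t\<in>{0..T}. \<forall>x. norm x < r \<longrightarrow> M * (norm x)\<^sup>2 \<le> F t x"
        using F_super by blast
      then show ?thesis
        by (intro exI[of _ "min r 1"]) (auto simp: Q_def cutoff_inner near)
    qed
    show "\<exists>d>0. \<forall>t x y. norm (x - y) < d \<longrightarrow> norm (p t x - p t y) < e" if "e > 0" for e
    proof -
      have "uniformly_continuous_on S (\<lambda>(t, x). p t x)"
        by (rule compact_uniformly_continuous[OF continuous_on_subset[OF p_cont subset_UNIV] S])
      then have "\<exists>d>0. \<forall>z\<in>S. \<forall>z'\<in>S. dist z' z < d \<longrightarrow>
          dist ((\<lambda>(t, x). p t x) z') ((\<lambda>(t, x). p t x) z) < e"
        unfolding uniformly_continuous_on_def using that by blast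
      then obtain d where d: "d > 0" "\<And>z z'. z \<in> S \<Longrightarrow> z' \<in> S \<Longrightarrow> dist z' z < d \<Longrightarrow>
          dist ((\<lambda>(t, x). p t x) z') ((\<lambda>(t, x). p t x) z) < e"
        by blast
      have "norm (p t x - p t y) < e" if xy: "norm (x - y) < min d 1" for t x y
      proof (cases "norm x \<le> 3 \<and> norm y \<le> 3")
        case True
        obtain s where s: "s \<in> {0..T}" "(p s x, p s y) = (p t x, p t y)"
          using reduce[of "\<lambda>t. (p t x, p t y)"] p_periodic by blast
        have "dist (s, x) (s, y) < d"
          using xy by (simp add: dist_Pair_Pair dist_norm)
        then show ?thesis
          using d(2)[of "(s, y)" "(s, x)"] s True by (simp add: S_def dist_norm)
      next
        case False
        then have "norm x \<ge> 2" "norm y \<ge> 2"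
          using xy norm_triangle_ineq2[of x y] norm_triangle_ineq2[of y x] by (auto simp: norm_minus_commute)
        then show ?thesis using far \<open>e > 0\<close> by simp
      qed
      then show ?thesis using d(1) by (intro exI[of _ "min d 1"]) auto
    qed
  qed (fact T)
  moreover have "p t x = G t x" if "norm x \<le> 1" for t x
    using near[OF that] by (simp add: p_def cutoff_inner)
  ultimately show ?thesis by blast
qed

text \<open>The derivative in \<open>x\<close> is the total derivative restricted to the vectors
  \<open>(0, h)\<close>; expanding it over the basis exhibits the gradient as jointly continuous in
  time and space.\<close>

lemma C1_function_partial_gradient:
  fixes V :: "real \<Rightarrow> 'a::euclidean_space \<Rightarrow> real"
  assumes "C1_function (\<lambda>(t, u). V t u)"
  shows "(V t has_derivative (\<lambda>h. gradient (V t) x \<bullet> h)) (at x)"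
    "continuous_on UNIV (\<lambda>(t, x). gradient (V t) x)"
proof -
  obtain f' :: "real \<times> 'a \<Rightarrow> (real \<times> 'a) \<Rightarrow>\<^sub>L real"
    where f': "\<And>z. ((\<lambda>(t, u). V t u) has_derivative blinfun_apply (f' z)) (at z)" "continuous_on UNIV f'"
    using assms by (auto simp: C1_function_def)
  define G where "G = (\<lambda>t x. \<Sum>i\<in>Basis. blinfun_apply (f' (t, x)) (0, i) *\<^sub>R i)"
  have G: "(V t has_derivative (\<lambda>h. G t x \<bullet> h)) (at x)" for t x
  proof -
    have "((\<lambda>x. (t, x)) has_derivative (\<lambda>h. (0, h))) (at x)"
      by (auto intro!: derivative_eq_intros)
    from has_derivative_compose[OF this f'(1)]
    have "(V t has_derivative (\<lambda>h. blinfun_apply (f' (t, x)) (0, h))) (at x)"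
      by simp
    moreover have "blinfun_apply (f' (t, x)) (0, h) = G t x \<bullet> h" for h
    proof -
      have "(0, h) = (\<Sum>i\<in>Basis. (h \<bullet> i) *\<^sub>R (0::real, i))"
        by (rule prod_eqI) (simp_all add: fst_sum snd_sum euclidean_representation)
      then have "blinfun_apply (f' (t, x)) (0, h) = blinfun_apply (f' (t, x)) (\<Sum>i\<in>Basis. (h \<bullet> i) *\<^sub>R (0, i))"
        by (rule arg_cong)
      also have "\<dots> = (\<Sum>i\<in>Basis. (h \<bullet> i) * blinfun_apply (f' (t, x)) (0, i))"
        unfolding blinfun.sum_right blinfun.scaleR_right by simp
      finally have "blinfun_apply (f' (t, x)) (0, h) = (\<Sum>i\<in>Basis. (h \<bullet> i) * blinfun_apply (f' (t, x)) (0, i))" .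
      then show ?thesis
        unfolding G_def inner_sum_left by (simp add: inner_commute mult.commute)
    qed
    ultimately show ?thesis by simp
  qed
  have eq: "gradient (V t) x = G t x" for t x
    using G[of t x] by (intro gradient_eqI) (simp add: gderiv_def inner_commute)
  show "(V t has_derivative (\<lambda>h. gradient (V t) x \<bullet> h)) (at x)"
    unfolding eq by (rule G)
  have "continuous_on UNIV (\<lambda>z. \<Sum>i\<in>Basis. blinfun_apply (f' z) (0, i) *\<^sub>R i)"
    using f'(2) by (intro continuous_intros)
  then show "continuous_on UNIV (\<lambda>(t, x). gradient (V t) x)"
    by (simp add: eq G_def case_prod_beta')
qed

text \<open>Finitely many nonzero functions, each evaluated where it does not vanish, have norms
  with a positive minimum, which a small solution undercuts. Inserting 1 covers the empty
  set.\<close>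

lemma infinite_periodic_solutions_if_small:
  fixes V :: "real \<Rightarrow> 'a::real_inner \<Rightarrow> real"
  assumes "\<And>\<rho>. \<rho> > 0 \<Longrightarrow> \<exists>u. periodic_solution T V u \<and> u \<noteq> (\<lambda>t. 0) \<and> (\<forall>t. norm (u t) < \<rho>)"
  shows "infinite {u. periodic_solution T V u \<and> u \<noteq> (\<lambda>t. 0)}" (is "infinite ?S")
proof
  assume fin: "finite ?S"
  have "\<forall>u\<in>?S. \<exists>t. u t \<noteq> 0" by (auto simp: fun_eq_iff)
  then obtain t where t: "\<And>u. u \<in> ?S \<Longrightarrow> u (t u) \<noteq> 0" by metis
  define \<rho> where "\<rho> = Min (insert 1 ((\<lambda>u. norm (u (t u))) ` ?S))"
  have "\<rho> > 0" unfolding \<rho>_def using fin t by (subst Min_gr_iff) auto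
  then obtain u where u: "u \<in> ?S" "\<forall>t. norm (u t) < \<rho>" using assms by blast
  have "\<rho> \<le> norm (u (t u))" unfolding \<rho>_def using fin u(1) by (intro Min_le) auto
  then show False using u(2) by (meson not_less)
qed

theorem theorem1p1:
  fixes T \<mu> R\<^sub>1 c\<^sub>2 R\<^sub>2 d :: real
    and V W :: "real \<Rightarrow> real ^ 'n \<Rightarrow> real"
    and U :: "real \<Rightarrow> real ^ 'n ^ 'n"
  assumes T_pos: "T > 0"
    and V_C1: "C1_function (\<lambda>(t, u). V t u)"
    and V_periodic: "\<forall>t u. V (t + T) u = V t u"
    and V_form: "\<forall>t u. V t u = 1 / 2 * ((U t *v u) \<bullet> u) + W t u"
    and U_cont: "continuous_on UNIV U"
    and U_periodic: "\<forall>t. U (t + T) = U t"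
    and U_sym: "\<forall>t. transpose (U t) = U t"
    and AQ1_nonneg: "\<forall>t\<in>{0..T}. \<forall>u. W t u \<ge> 0"
    and AQ1_consts: "0 < \<mu>" "\<mu> < 2" "R\<^sub>1 > 0"
    and AQ1: "\<forall>t\<in>{0..T}. \<forall>u. norm u \<ge> R\<^sub>1 \<longrightarrow> gradient (W t) u \<bullet> u \<le> \<mu> * W t u"
    and AQ2_limit: "\<forall>M. \<forall>\<^sub>F u in at 0. \<forall>t\<in>{0..T}. W t u / (norm u)\<^sup>2 \<ge> M"
    and AQ2_consts: "c\<^sub>2 > 0" "R\<^sub>2 > 0"
    and AQ2: "\<forall>t\<in>{0..T}. \<forall>u. norm u \<le> R\<^sub>2 \<longrightarrow> W t u \<le> c\<^sub>2 * norm u"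
    and AQ3_const: "d > 0"
    and AQ3: "\<forall>\<epsilon>>0. \<forall>\<^sub>F u in at_infinity. \<forall>t\<in>{0..T}. W t u / norm u \<ge> d - \<epsilon>"
    and W_even: "\<forall>t\<in>{0..T}. \<forall>u. W t (- u) = W t u"
  shows "infinite {u. periodic_solution T V u \<and> u \<noteq> (\<lambda>t. 0)}"
proof (rule infinite_periodic_solutions_if_small)
  fix \<rho> :: real assume "\<rho> > 0"
  \<comment> \<open>The hypotheses on \<open>W\<close> concern one period; periodicity of
    \<open>V\<close> carries their consequences to all times. Two points are moved at once in order
    to compare \<open>x\<close> with \<open>- x\<close>.\<close>
  have reduce: "\<exists>s\<in>{0..T}. V s x = V t x \<and> V s y = V t y" for t x y
    using periodic_reduce[of "\<lambda>t. (V t x, V t y)" T t] V_periodic T_pos by auto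
  have V_even: "V t (- x) = V t x" for t x
  proof -
    obtain s where s: "s \<in> {0..T}" "V s (- x) = V t (- x)" "V s x = V t x"
      using reduce by blast
    have "(U s *v (- x)) \<bullet> (- x) = (U s *v x) \<bullet> x"
      by (simp add: linear_neg[OF matrix_vector_mul_linear])
    then have "V s (- x) = V s x"
      using W_even s(1) by (simp add: V_form)
    then show ?thesis using s by simp
  qed
  have V_0: "V t 0 = 0" for t
  proof -
    obtain s where s: "s \<in> {0..T}" "V s 0 = V t 0"
      using reduce by blast
    \<comment> \<open>At \<open>u = 0\<close> the linear upper bound and nonnegativity force
      \<open>W s 0 = 0\<close>.\<close>
    have "W s 0 \<le> c\<^sub>2 * norm (0 :: real ^ 'n)"
      using AQ2 AQ2_consts s(1) by (metis less_imp_le norm_zero)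
    then have "W s 0 = 0"
      using AQ1_nonneg s(1) by (metis antisym mult_zero_right norm_zero)
    then show ?thesis using s by (simp add: V_form)
  qed
  define F where "F = (\<lambda>t x. V t x + (x \<bullet> x) / 2)"
  define G where "G = (\<lambda>t x. gradient (V t) x + x)"
  have "\<exists>C B Q p. truncated_problem T C B Q p \<and> (\<forall>t x. norm x \<le> 1 \<longrightarrow> p t x = G t x)"
  proof (rule truncated_problem_cutoff[where F = F])
    have V_cont: "continuous_on UNIV (\<lambda>(t, x). V t x)"
      using V_C1 unfolding C1_function_def
      by (intro continuous_at_imp_continuous_on) (auto intro: has_derivative_continuous)
    show "continuous_on UNIV (\<lambda>(t, x). F t x)" "continuous_on UNIV (\<lambda>(t, x). G t x)"
      using V_cont C1_function_partial_gradient(2)[OF V_C1] unfolding F_def G_def case_prod_beta'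
      by (intro continuous_intros; simp)+
    show "(F t has_derivative (\<lambda>h. G t x \<bullet> h)) (at x)" for t x
      unfolding F_def G_def using C1_function_partial_gradient(1)[OF V_C1, of t x]
      by (auto intro!: derivative_eq_intros simp: inner_add_left inner_add_right inner_commute)
    show "\<exists>r>0. \<forall>t\<in>{0..T}. \<forall>x. norm x < r \<longrightarrow> M * (norm x)\<^sup>2 \<le> F t x" for M
    proof -
      have "bounded (U ` {0..T})"
        by (intro compact_imp_bounded compact_continuous_image continuous_on_subset[OF U_cont]) auto
      then obtain K where K: "\<And>t. t \<in> {0..T} \<Longrightarrow> norm (U t) \<le> K"
        by (metis bounded_iff imageI)
      \<comment> \<open>A bound for the quadratic form of \<open>U\<close> over a period; the growth
        of \<open>W\<close> at 0 is used with \<open>M + c\<close>, so that it outweighs this form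
        as well.\<close>
      define c where "c = real CARD('n) * real CARD('n) * K"
      have Ux: "\<bar>(U t *v x) \<bullet> x\<bar> \<le> c * (norm x)\<^sup>2" if "t \<in> {0..T}" for t x
      proof -
        have "\<bar>U t $ i $ j\<bar> \<le> K" for i j
          using component_le_norm_cart[of "U t $ i" j] Finite_Cartesian_Product.norm_nth_le[of "U t" i] K[OF that] by linarith
        then have "onorm ((*v) (U t)) \<le> c"
          unfolding c_def by (rule onorm_le_matrix_component)
        moreover have "norm (U t *v x) \<le> onorm ((*v) (U t)) * norm x"
          by (intro onorm matrix_vector_mul_bounded_linear)
        ultimately have "norm (U t *v x) \<le> c * norm x"
          by (meson mult_right_mono norm_ge_zero order_trans)
        then have "norm (U t *v x) * norm x \<le> c * norm x * norm x"
          by (intro mult_right_mono) auto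
        then show ?thesis
          using Cauchy_Schwarz_ineq2[of "U t *v x" x] by (simp add: power2_eq_square mult.assoc)
      qed
      have "\<forall>\<^sub>F u in at 0. \<forall>t\<in>{0..T}. W t u / (norm u)\<^sup>2 \<ge> M + c"
        using AQ2_limit by blast
      then obtain r where r: "r > 0" "\<And>u t. u \<noteq> 0 \<Longrightarrow> norm u < r \<Longrightarrow> t \<in> {0..T} \<Longrightarrow> M + c \<le> W t u / (norm u)\<^sup>2"
        unfolding eventually_at by (auto simp: dist_norm)
      have "M * (norm x)\<^sup>2 \<le> F t x" if "t \<in> {0..T}" "norm x < r" for t x
      proof (cases "x = 0")
        case True
        then show ?thesis by (simp add: F_def V_0)
      next
        case False
        then have "(M + c) * (norm x)\<^sup>2 \<le> W t x"
          using r(2)[OF False that(2,1)] by (simp add: pos_le_divide_eq)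
        moreover have "- (c * (norm x)\<^sup>2) \<le> 1 / 2 * ((U t *v x) \<bullet> x)"
          using Ux[OF that(1), of x] zero_le_power2[of "norm x"] by linarith
        moreover have "x \<bullet> x \<ge> 0" by simp
        moreover have "F t x = 1 / 2 * ((U t *v x) \<bullet> x) + W t x + (x \<bullet> x) / 2"
          unfolding F_def using V_form by simp
        moreover have "(M + c) * (norm x)\<^sup>2 = M * (norm x)\<^sup>2 + c * (norm x)\<^sup>2"
          by (rule distrib_right)
        ultimately show ?thesis
          by linarith
      qed
      then show ?thesis using r(1) by blast
    qed
  qed (use T_pos V_periodic in \<open>simp_all add: F_def V_even V_0\<close>)
  then obtain C B Q p where p: "truncated_problem T C B Q p" "\<And>t x. norm x \<le> 1 \<Longrightarrow> p t x = G t x"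
    by blast
  \<comment> \<open>Size below 1 keeps \<open>u t\<close> in the unit ball, where \<open>p\<close>
    is the gradient of the untruncated \<open>F\<close>, so the equation becomes the original
    one.\<close>
  obtain u v where u: "u \<noteq> (\<lambda>t. 0)" "\<And>t. u (t + T) = u t" "\<And>t. norm (u t) < min \<rho> 1" "\<And>t. v (t + T) = v t"
    "\<And>t. (u has_vector_derivative v t) (at t)" "\<And>t. (v has_vector_derivative u t - p t (u t)) (at t)"
    using truncated_problem.small_solution_exists[OF p(1), of "min \<rho> 1"] \<open>\<rho> > 0\<close> by auto
  have "u t - p t (u t) + gradient (V t) (u t) = 0" for t
    using p(2)[of "u t" t] u(3)[of t] by (simp add: G_def)
  then have "periodic_solution T V u"
    unfolding periodic_solution_def using u(2)[of 0] u(4)[of 0] u(2,5,6)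
    by (intro conjI allI exI[of _ v] exI[of _ "\<lambda>t. u t - p t (u t)"]) auto
  then show "\<exists>u. periodic_solution T V u \<and> u \<noteq> (\<lambda>t. 0) \<and> (\<forall>t. norm (u t) < \<rho>)"
    using u(1,3) by (intro exI[of _ u]) auto
qed

end
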